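(* Let $\|\cdot\|_\ell$ be a symmetric norm on $\mathbb{R}^n$. There exists an algorithm that, on any input $A\in\mathbb{R}^{n\times d}$ and $b\in\mathbb{R}^n$, finds a vector $x^*\in\mathbb{R}^d$ in time $\widetilde{O}(\mathrm{nnz}(A)+\mathrm{poly}(d))$ such that with probability at least $0.9$, $\|Ax^*-b\|_\ell\le \sqrt{d}\cdot\mathrm{polylog}(n)\cdot\mathrm{mmc}(\ell)\cdot\min_{x\in\mathbb{R}^d}\|Ax-b\|_\ell$.
   Context: A norm $\|\cdot\|_\ell$ on $\mathbb{R}^n$ is symmetric if $\|(y_1,\dots,y_n)\|_\ell=\|(s_1y_{\sigma(1)},\dots,s_ny_{\sigma(n)})\|_\ell$ for every permutation $\sigma$ of $[n]$ and all signs $s_i\in\{-1,1\}$. For $k\in[n]$, let $\|\cdot\|_{\ell^{(k)}}$ be the norm on $\mathbb{R}^k$ given by $\|(x_1,\dots,x_k)\|_{\ell^{(k)}}=\|(x_1,\dots,x_k,0,\dots,0)\|_\ell$. For a symmetric norm $\|\cdot\|_{\ell'}$ on $\mathbb{R}^k$, its median $M_{\ell'}$ is the value with $\Pr_{x}[\|x\|_{\ell'}\ge M_{\ell'}]\ge 1/2$ and $\Pr_x[\|x\|_{\ell'}\le M_{\ell'}]\ge 1/2$, where $x$ is uniform on the unit sphere $\mathbb{S}^{k-1}$; the modulus of concentration is $\mathrm{mc}(\ell')=\max_{x\in\mathbb{S}^{k-1}}\|x\|_{\ell'}/M_{\ell'}$; and the maximum modulus of concentration is $\mathrm{mmc}(\ell)=\max_{k\in[n]}\mathrm{mc}(\ell^{(k)})$.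 $\mathrm{nnz}(A)$ is the number of nonzero entries of $A$; $\widetilde{O}(f)=f\,\mathrm{polylog} f$. *)

theory Defs
  imports
    "HOL-Probability.Probability"
    "HOL-Computational_Algebra.Polynomial"
    "Jordan_Normal_Form.Matrix"
begin

hide_const (open) Finite_Cartesian_Product.vec Finite_Cartesian_Product.mat
no_notation Finite_Cartesian_Product.vec_nth (infixl "$" 90)

section \<open>Symmetric norms\<close>

definition norm_on :: "nat \<Rightarrow> (real vec \<Rightarrow> real) \<Rightarrow> bool" where
  "norm_on n l \<longleftrightarrow>
     (\<forall>x\<in>carrier_vec n. 0 \<le> l x \<and> (l x = 0 \<longleftrightarrow> x = 0\<^sub>v n)) \<and>
     (\<forall>x\<in>carrier_vec n. \<forall>c. l (c \<cdot>\<^sub>v x) = \<bar>c\<bar> * l x) \<and>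
     (\<forall>x\<in>carrier_vec n. \<forall>y\<in>carrier_vec n. l (x + y) \<le> l x + l y)"

definition symmetric_norm :: "nat \<Rightarrow> (real vec \<Rightarrow> real) \<Rightarrow> bool" where
  "symmetric_norm n l \<longleftrightarrow> norm_on n l \<and>
     (\<forall>y\<in>carrier_vec n. \<forall>\<sigma> s. \<sigma> permutes {..<n} \<longrightarrow> (\<forall>i<n. s i \<in> {-1, 1}) \<longrightarrow>
        l y = l (vec n (\<lambda>i. s i * y $ \<sigma> i)))"

text \<open>The norm \<open>x \<mapsto> l (x\<^sub>1, \<dots>, x\<^sub>k, 0, \<dots>, 0)\<close> on vectors of dimension \<open>k \<le> n\<close>.\<close>

definition restr_norm :: "nat \<Rightarrow> (real vec \<Rightarrow> real) \<Rightarrow> nat \<Rightarrow> real vec \<Rightarrow> real" where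
  "restr_norm n l k x = l (vec n (\<lambda>i. if i < k then x $ i else 0))"


section \<open>Modulus of concentration\<close>

definition unit_sphere :: "nat \<Rightarrow> real vec set" where
  "unit_sphere k = {x \<in> carrier_vec k. L2_set (\<lambda>i. x $ i) {..<k} = 1}"

text \<open>
  The uniform distribution on the unit sphere of dimension \<open>k \<ge> 1\<close>, in coordinates: the law of
  \<open>y / \<parallel>y\<parallel>\<^sub>2\<close> for \<open>y\<close> uniform in the Euclidean unit ball (normalised cone measure).  For
  \<open>k = 1\<close> this is the uniform distribution on the two points \<open>-1\<close> and \<open>1\<close>.
\<close>

definition uniform_sphere :: "nat \<Rightarrow> (nat \<Rightarrow> real) measure" where
  "uniform_sphere k =
     distr
       (uniform_measure (\<Pi>\<^sub>M i\<in>{..<k}. lborel)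
          {y \<in> space (\<Pi>\<^sub>M i\<in>{..<k}. lborel). L2_set y {..<k} \<le> 1})
       (\<Pi>\<^sub>M i\<in>{..<k}. borel)
       (\<lambda>y. \<lambda>i\<in>{..<k}. y i / L2_set y {..<k})"

definition is_median :: "nat \<Rightarrow> (real vec \<Rightarrow> real) \<Rightarrow> real \<Rightarrow> bool" where
  "is_median k l M \<longleftrightarrow>
     measure (uniform_sphere k) {x \<in> space (uniform_sphere k). l (vec k x) \<ge> M} \<ge> 1/2 \<and>
     measure (uniform_sphere k) {x \<in> space (uniform_sphere k). l (vec k x) \<le> M} \<ge> 1/2"

text \<open>For a symmetric norm and \<open>k \<ge> 1\<close> there is exactly one median.\<close>

definition median :: "nat \<Rightarrow> (real vec \<Rightarrow> real) \<Rightarrow> real" where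
  "median k l = (THE M. is_median k l M)"

definition mc :: "nat \<Rightarrow> (real vec \<Rightarrow> real) \<Rightarrow> real" where
  "mc k l = (SUP x\<in>unit_sphere k. l x) / median k l"

definition mmc :: "nat \<Rightarrow> (real vec \<Rightarrow> real) \<Rightarrow> real" where
  "mmc n l = Max ((\<lambda>k. mc k (restr_norm n l k)) ` {1..n})"


section \<open>Randomised real RAM programs\<close>

text \<open>
  A real RAM with separate storage for natural numbers (used for indices, counters and control) and
  for exact real numbers.  Each kind of storage has registers and arrays; a program names finitely
  many registers and arrays, and array cells are addressed by natural-number registers.  On natural
  numbers only addition and truncated subtraction are unit-cost operations, and there is no way
  from reals to naturals (such as rounding) except through branching on a sign.  Randomness
  comes from independent fair coins.
\<close>

record state =
  nreg :: "nat \<Rightarrow> nat"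
  rreg :: "nat \<Rightarrow> real"
  narr :: "nat \<Rightarrow> nat \<Rightarrow> nat"
  rarr :: "nat \<Rightarrow> nat \<Rightarrow> real"

datatype instr =
    NConst nat nat        \<comment> \<open>target register, value\<close>
  | NAdd nat nat nat      \<comment> \<open>target register, argument registers\<close>
  | NSub nat nat nat
  | NLoad nat nat nat     \<comment> \<open>target register, array, index register\<close>
  | NStore nat nat nat    \<comment> \<open>array, index register, source register\<close>
  | ROfNat nat nat
  | RAdd nat nat nat
  | RSub nat nat nat
  | RMul nat nat nat
  | RDiv nat nat nat
  | RLoad nat nat nat
  | RStore nat nat nat

fun effect :: "instr \<Rightarrow> state \<Rightarrow> state" where
  "effect (NConst a m) s = s\<lparr>nreg := (nreg s)(a := m)\<rparr>"
| "effect (NAdd a b c) s = s\<lparr>nreg := (nreg s)(a := nreg s b + nreg s c)\<rparr>"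
| "effect (NSub a b c) s = s\<lparr>nreg := (nreg s)(a := nreg s b - nreg s c)\<rparr>"
| "effect (NLoad a j b) s = s\<lparr>nreg := (nreg s)(a := narr s j (nreg s b))\<rparr>"
| "effect (NStore j b a) s = s\<lparr>narr := (narr s)(j := (narr s j)(nreg s b := nreg s a))\<rparr>"
| "effect (ROfNat a b) s = s\<lparr>rreg := (rreg s)(a := real (nreg s b))\<rparr>"
| "effect (RAdd a b c) s = s\<lparr>rreg := (rreg s)(a := rreg s b + rreg s c)\<rparr>"
| "effect (RSub a b c) s = s\<lparr>rreg := (rreg s)(a := rreg s b - rreg s c)\<rparr>"
| "effect (RMul a b c) s = s\<lparr>rreg := (rreg s)(a := rreg s b * rreg s c)\<rparr>"
| "effect (RDiv a b c) s = s\<lparr>rreg := (rreg s)(a := rreg s b / rreg s c)\<rparr>"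
| "effect (RLoad a j b) s = s\<lparr>rreg := (rreg s)(a := rarr s j (nreg s b))\<rparr>"
| "effect (RStore j b a) s = s\<lparr>rarr := (rarr s)(j := (rarr s j)(nreg s b := rreg s a))\<rparr>"

text \<open>
  \<open>NormQuery a j b\<close> is the program's only access to the norm: real register \<open>a\<close> receives
  the norm of the vector consisting of the first \<open>k\<close> cells of real array \<open>j\<close>, padded with
  zeros, where \<open>k\<close> is the content of natural register \<open>b\<close>.
\<close>

datatype prog =
    Instr instr
  | Flip nat
  | NormQuery nat nat nat
  | Seq prog prog
  | IfNPos nat prog prog
  | IfRPos nat prog prog
  | WhileNPos nat prog

text \<open>
  \<open>exec n l P (s, \<omega>) t (s', \<omega>')\<close>: with norm \<open>l\<close> on vectors of dimension \<open>n\<close>, the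
  program \<open>P\<close> started in state \<open>s\<close> with future coin tosses \<open>\<omega>\<close> halts in state \<open>s'\<close>
  with remaining coin tosses \<open>\<omega>'\<close>, after time \<open>t\<close>.  Instructions, coin tosses and tests take
  time 1, a norm query on \<open>k\<close> cells takes time \<open>k + 1\<close>; a query with \<open>k > n\<close> never halts.
\<close>

inductive exec ::
  "nat \<Rightarrow> (real vec \<Rightarrow> real) \<Rightarrow> prog \<Rightarrow> state \<times> bool stream \<Rightarrow> nat \<Rightarrow> state \<times> bool stream \<Rightarrow> bool"
  for n l where
  exec_Instr: "exec n l (Instr i) (s, \<omega>) 1 (effect i s, \<omega>)"
| exec_Flip: "exec n l (Flip a) (s, \<omega>) 1 (s\<lparr>nreg := (nreg s)(a := of_bool (shd \<omega>))\<rparr>, stl \<omega>)"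
| exec_NormQuery: "nreg s b = k \<Longrightarrow> k \<le> n \<Longrightarrow>
    exec n l (NormQuery a j b) (s, \<omega>) (k + 1)
      (s\<lparr>rreg := (rreg s)(a := restr_norm n l k (vec k (rarr s j)))\<rparr>, \<omega>)"
| exec_Seq: "exec n l P c t c' \<Longrightarrow> exec n l Q c' t' c'' \<Longrightarrow> exec n l (Seq P Q) c (t + t') c''"
| exec_IfN_True: "nreg s a > 0 \<Longrightarrow> exec n l P (s, \<omega>) t c \<Longrightarrow>
    exec n l (IfNPos a P Q) (s, \<omega>) (t + 1) c"
| exec_IfN_False: "nreg s a = 0 \<Longrightarrow> exec n l Q (s, \<omega>) t c \<Longrightarrow>
    exec n l (IfNPos a P Q) (s, \<omega>) (t + 1) c"
| exec_IfR_True: "rreg s a > 0 \<Longrightarrow> exec n l P (s, \<omega>) t c \<Longrightarrow>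
    exec n l (IfRPos a P Q) (s, \<omega>) (t + 1) c"
| exec_IfR_False: "rreg s a \<le> 0 \<Longrightarrow> exec n l Q (s, \<omega>) t c \<Longrightarrow>
    exec n l (IfRPos a P Q) (s, \<omega>) (t + 1) c"
| exec_While_False: "nreg s a = 0 \<Longrightarrow> exec n l (WhileNPos a P) (s, \<omega>) 1 (s, \<omega>)"
| exec_While_True: "nreg s a > 0 \<Longrightarrow> exec n l P (s, \<omega>) t c \<Longrightarrow>
    exec n l (WhileNPos a P) c t' c' \<Longrightarrow>
    exec n l (WhileNPos a P) (s, \<omega>) (t + t' + 1) c'"

inductive_cases exec_InstrE: "exec n l (Instr i) c t c'"
inductive_cases exec_FlipE: "exec n l (Flip a) c t c'"
inductive_cases exec_NormQueryE: "exec n l (NormQuery a j b) c t c'"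
inductive_cases exec_SeqE: "exec n l (Seq P Q) c t c'"
inductive_cases exec_IfNE: "exec n l (IfNPos a P Q) c t c'"
inductive_cases exec_IfRE: "exec n l (IfRPos a P Q) c t c'"
inductive_cases exec_WhileE: "exec n l (WhileNPos a P) c t c'"

lemma exec_deterministic:
  assumes "exec n l P c t c'" and "exec n l P c u c''"
  shows "t = u \<and> c' = c''"
  using assms
proof (induction arbitrary: u c'' rule: exec.induct)
  case (exec_Instr i s \<omega>)
  then show ?case by (auto elim!: exec_InstrE)
next
  case (exec_Flip a s \<omega>)
  then show ?case by (auto elim!: exec_FlipE)
next
  case (exec_NormQuery s b k a j \<omega>)
  then show ?case by (auto elim!: exec_NormQueryE)
next
  case (exec_Seq P c t c' Q t' c1)
  from exec_Seq.prems obtain v v' d where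
    "exec n l P c v d" "exec n l Q d v' c''" "u = v + v'" by (auto elim!: exec_SeqE)
  with exec_Seq.IH show ?case by blast
next
  case (exec_IfN_True s a P \<omega> t c Q)
  from exec_IfN_True.prems exec_IfN_True.hyps obtain v where
    "exec n l P (s, \<omega>) v c''" "u = v + 1" by (auto elim!: exec_IfNE)
  with exec_IfN_True.IH show ?case by blast
next
  case (exec_IfN_False s a Q \<omega> t c P)
  from exec_IfN_False.prems exec_IfN_False.hyps obtain v where
    "exec n l Q (s, \<omega>) v c''" "u = v + 1" by (auto elim!: exec_IfNE)
  with exec_IfN_False.IH show ?case by blast
next
  case (exec_IfR_True s a P \<omega> t c Q)
  from exec_IfR_True.prems exec_IfR_True.hyps obtain v where
    "exec n l P (s, \<omega>) v c''" "u = v + 1" by (auto elim!: exec_IfRE)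
  with exec_IfR_True.IH show ?case by blast
next
  case (exec_IfR_False s a Q \<omega> t c P)
  from exec_IfR_False.prems exec_IfR_False.hyps obtain v where
    "exec n l Q (s, \<omega>) v c''" "u = v + 1" by (auto elim!: exec_IfRE)
  with exec_IfR_False.IH show ?case by blast
next
  case (exec_While_False s a P \<omega>)
  from exec_While_False.prems exec_While_False.hyps show ?case by (auto elim: exec_WhileE)
next
  case (exec_While_True s a P \<omega> t c t' c')
  from exec_While_True.prems exec_While_True.hyps obtain v v' d where
    "exec n l P (s, \<omega>) v d" "exec n l (WhileNPos a P) d v' c''" "u = v + v' + 1"
    by (auto elim: exec_WhileE)
  with exec_While_True.IH show ?case by blast
qed

abbreviation coin_tosses :: "bool stream measure" where
  "coin_tosses \<equiv> stream_space (measure_pmf (bernoulli_pmf (1/2)))"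


section \<open>Input, output and running time\<close>

definition nnz :: "real mat \<Rightarrow> nat" where
  "nnz A = card {(i, j). i < dim_row A \<and> j < dim_col A \<and> A $$ (i, j) \<noteq> 0}"

text \<open>The matrix is presented as a list of its nonzero entries, in any order.\<close>

definition sparse_repr :: "real mat \<Rightarrow> (nat \<times> nat \<times> real) list \<Rightarrow> bool" where
  "sparse_repr A es \<longleftrightarrow> distinct es \<and>
     set es = {(i, j, A $$ (i, j)) | i j. i < dim_row A \<and> j < dim_col A \<and> A $$ (i, j) \<noteq> 0}"

text \<open>
  Natural registers 0, 1, 2 hold the dimensions and the number of nonzero entries, natural arrays
  0, 1 and real array 0 their row indices, column indices and values, real array 1 the vector \<open>b\<close>.
  All other storage is zero.  The output is read from real array 2.
\<close>

definition init_state :: "nat \<Rightarrow> nat \<Rightarrow> (nat \<times> nat \<times> real) list \<Rightarrow> real vec \<Rightarrow> state" where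
  "init_state n d es b =
     \<lparr> nreg = (\<lambda>_. 0)(0 := n, 1 := d, 2 := length es),
       rreg = (\<lambda>_. 0),
       narr = (\<lambda>_ _. 0)
         (0 := (\<lambda>m. if m < length es then fst (es ! m) else 0),
          1 := (\<lambda>m. if m < length es then fst (snd (es ! m)) else 0)),
       rarr = (\<lambda>_ _. 0)
         (0 := (\<lambda>m. if m < length es then snd (snd (es ! m)) else 0),
          1 := (\<lambda>i. if i < n then b $ i else 0)) \<rparr>"

definition out_vec :: "nat \<Rightarrow> state \<Rightarrow> real vec" where
  "out_vec d s = vec d (rarr s 2)"

text \<open>
  \<open>soft_O r f = f polylog f\<close>, where \<open>polylog f\<close> is the polynomial \<open>r\<close> in \<open>log f\<close>.
\<close>

definition soft_O :: "real poly \<Rightarrow> nat \<Rightarrow> real" where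
  "soft_O r f = real f * poly r (ln (real f))"

end

theory Submission
  imports Defs
begin

text \<open>
  Write \<open>\<phi> k\<close> for the norm of a 0-1 vector with \<open>k\<close> ones.  A symmetric norm is determined up to a
  logarithmic factor by \<open>\<phi>\<close>: it is comparable to the largest \<open>t * \<phi> k\<close> such that \<open>k\<close> entries have
  modulus at least \<open>t\<close>.  The maximum modulus of concentration enters only through the inequality
  \<open>\<phi> a / sqrt a \<le> C * \<phi> k / sqrt k\<close> for \<open>a \<le> k\<close>, where \<open>C\<close> is \<open>mmc\<close> up to a logarithmic factor: a
  typical point of the sphere has all coordinates of order \<open>sqrt (ln k / k)\<close>, which bounds the median.

  Every nonzero row independently receives a random weight \<open>\<phi> K\<close>, where \<open>K\<close> is a power of two with
  \<open>Pr[K \<ge> 2 ^ j] = 2 ^ (-j)\<close>, and the weighted rows of the matrix and of the right-hand side are compressed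
  by CountSketch to a number of rows polynomial in \<open>d\<close>, where least squares is solved exactly by
  Gram-Schmidt.  The level sets of all residuals form a family of size \<open>n ^ O(d)\<close>, so with a Chernoff bound
  all of them are hit by enough large weights, and no residual shrinks by more than \<open>sqrt d\<close> up to logarithmic
  factors.  A fixed near-optimal residual is not stretched: the entry of rank \<open>r\<close> rarely gets a weight
  above \<open>\<phi>\<close> of a polylogarithmic multiple of \<open>r\<close>, and below that threshold its expected square is controlled by
  the inequality for \<open>\<phi>\<close>.  Rows of the matrix that vanish contribute the same to every residual.
\<close>

section \<open>Symmetric norms and their fundamental function\<close>

text \<open>The weights are drawn before any residual is known, so they must suit every ordering of
  the rows at once. For all n ^ O(d) level sets to be hit, a set of k rows needs an expected number
  s of order d * log n of large weights, so only weights of scale k / s can be relied on. Going from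
  k to k / s may cost a factor s in \<open>phi\<close> (\<open>phi_ratio\<close>), and the s hits
  give back sqrt s in the Euclidean norm. The remaining sqrt s is the factor sqrt d.

  In the other direction the squared weights are heavy-tailed: scale k occurs with probability about
  1 / k and contributes phi k ^ 2 / k. For scales below the rank r of an entry this is compared with
  phi r ^ 2 / r through \<open>mmc\<close>, for scales above it through \<open>phi_ratio\<close> up
  to a cut-off (\<open>phi_sq_le\<close>).

  The running time must not depend on n. So the program never scans b or the rows, but numbers the
  rows met in the entry list and works with those alone.\<close>

locale sym_norm =
  fixes n :: nat and l :: "real vec \<Rightarrow> real"
  assumes n_pos: "1 \<le> n" and symm: "symmetric_norm n l"
begin

definition nf :: "(nat \<Rightarrow> real) \<Rightarrow> real" where
  "nf x = l (vec n x)"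

definition phi :: "nat \<Rightarrow> real" where
  "phi k = nf (\<lambda>i. of_bool (i < k))"

lemma nf_cong: "(\<And>i. i < n \<Longrightarrow> x i = y i) \<Longrightarrow> nf x = nf y"
  unfolding nf_def by (rule arg_cong[where f = l]) (auto intro: eq_vecI)

lemma nf_nonneg: "0 \<le> nf x"
  using symm by (auto simp: nf_def symmetric_norm_def norm_on_def)

lemma nf_eq_0_iff: "nf x = 0 \<longleftrightarrow> (\<forall>i<n. x i = 0)"
proof -
  have "nf x = 0 \<longleftrightarrow> vec n x = 0\<^sub>v n"
    using symm by (auto simp: nf_def symmetric_norm_def norm_on_def)
  then show ?thesis by (auto simp: vec_eq_iff)
qed

lemma nf_scale: "nf (\<lambda>i. c * x i) = \<bar>c\<bar> * nf x"
proof -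
  have "l (c \<cdot>\<^sub>v vec n x) = \<bar>c\<bar> * l (vec n x)"
    using symm by (auto simp: symmetric_norm_def norm_on_def)
  moreover have "c \<cdot>\<^sub>v vec n x = vec n (\<lambda>i. c * x i)" by (intro eq_vecI) auto
  ultimately show ?thesis by (simp add: nf_def)
qed

lemma nf_add: "nf (\<lambda>i. x i + y i) \<le> nf x + nf y"
proof -
  have "l (vec n x + vec n y) \<le> l (vec n x) + l (vec n y)"
    using symm by (auto simp: symmetric_norm_def norm_on_def)
  moreover have "vec n x + vec n y = vec n (\<lambda>i. x i + y i)" by (intro eq_vecI) auto
  ultimately show ?thesis by (simp add: nf_def)
qed

lemma nf_signed_perm:
  assumes "\<sigma> permutes {..<n}" "\<And>i. i < n \<Longrightarrow> s i \<in> {-1, 1}"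
  shows "nf (\<lambda>i. s i * y (\<sigma> i)) = nf y"
proof -
  have "l (vec n y) = l (vec n (\<lambda>i. s i * vec n y $ \<sigma> i))"
    using symm assms by (auto simp: symmetric_norm_def)
  moreover have "vec n (\<lambda>i. s i * vec n y $ \<sigma> i) = vec n (\<lambda>i. s i * y (\<sigma> i))"
    using permutes_in_image[OF assms(1)] by (intro eq_vecI) auto
  ultimately show ?thesis by (simp add: nf_def)
qed

lemma nf_sum: "finite A \<Longrightarrow> nf (\<lambda>i. \<Sum>a\<in>A. x a i) \<le> (\<Sum>a\<in>A. nf (x a))"
proof (induction A rule: finite_induct)
  case empty
  then show ?case using nf_eq_0_iff[of "\<lambda>_. 0"] by simp
next
  case (insert a A)
  then show ?case using nf_add[of "x a" "\<lambda>i. \<Sum>a\<in>A. x a i"] by simp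
qed

text \<open>Sign invariance makes the norm monotone: shrinking coordinate j is a convex combination
  of y and its reflection in that coordinate.\<close>

lemma nf_mono_single:
  assumes "\<bar>c\<bar> \<le> \<bar>y j\<bar>"
  shows "nf (y(j := c)) \<le> nf y"
proof (cases "y j = 0")
  case True
  with assms have "y(j := c) = y" by auto
  then show ?thesis by simp
next
  case False
  \<comment> \<open>The weight solves r * y j - (1 - r) * y j = c.\<close>
  define r where "r = (1 + c / y j) / 2"
  have cr: "\<bar>c / y j\<bar> \<le> 1" using assms False by (simp add: abs_divide)
  then have "c / y j \<le> 1" "- 1 \<le> c / y j" unfolding abs_le_iff by linarith+
  then have r: "0 \<le> r" "r \<le> 1" unfolding r_def by simp_all
  let ?s = "\<lambda>i. if i = j then -1 else 1 :: real"
  have eq: "y(j := c) = (\<lambda>i. r * y i + (1 - r) * (?s i * y (id i)))"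
    using False by (auto simp: fun_eq_iff r_def field_simps)
  have "nf (y(j := c)) \<le> nf (\<lambda>i. r * y i) + nf (\<lambda>i. (1 - r) * (?s i * y (id i)))"
    unfolding eq by (rule nf_add)
  also have "nf (\<lambda>i. r * y i) = r * nf y" using r by (simp add: nf_scale)
  also have "nf (\<lambda>i. (1 - r) * (?s i * y (id i))) = (1 - r) * nf y"
    using r nf_signed_perm[OF permutes_id, of ?s y] nf_scale[of "1 - r" "\<lambda>i. ?s i * y (id i)"] by simp
  also have "r * nf y + (1 - r) * nf y = nf y" by (simp add: algebra_simps)
  finally show ?thesis .
qed

lemma nf_mono:
  assumes "\<And>i. i < n \<Longrightarrow> \<bar>x i\<bar> \<le> \<bar>y i\<bar>"
  shows "nf x \<le> nf y"
proof -
  have "k \<le> n \<Longrightarrow> nf (\<lambda>i. if i < k then x i else y i) \<le> nf y" for k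
  proof (induction k)
    case (Suc k)
    let ?h = "\<lambda>i. if i < k then x i else y i"
    have "(\<lambda>i. if i < Suc k then x i else y i) = ?h(k := x k)" by (auto simp: fun_eq_iff)
    moreover have "nf (?h(k := x k)) \<le> nf ?h"
      using Suc.prems assms[of k] by (intro nf_mono_single) auto
    ultimately show ?case using Suc by simp
  qed simp
  from this[of n] have "nf (\<lambda>i. if i < n then x i else y i) \<le> nf y" by simp
  moreover have "nf (\<lambda>i. if i < n then x i else y i) = nf x" by (rule nf_cong) simp
  ultimately show ?thesis by simp
qed

lemma phi_card:
  assumes "T \<subseteq> {..<n}"
  shows "nf (\<lambda>i. of_bool (i \<in> T)) = phi (card T)"
proof -
  let ?k = "card T"
  have fin: "finite T" using assms finite_subset by blast
  have kn: "?k \<le> n" using card_mono[OF _ assms] by simp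
  obtain f where f: "bij_betw f T {..<?k}"
    using fin ex_bij_betw_finite_nat[OF fin] by (auto simp: atLeast0LessThan)
  have "card ({..<n} - T) = card {?k..<n}" using assms fin by (simp add: card_Diff_subset)
  then obtain g where g: "bij_betw g ({..<n} - T) {?k..<n}"
    using finite_same_card_bij[of "{..<n} - T" "{?k..<n}"] by auto
  define \<sigma> where "\<sigma> i = (if i \<in> T then f i else if i < n then g i else i)" for i
  have "bij_betw \<sigma> (T \<union> ({..<n} - T)) ({..<?k} \<union> {?k..<n})"
  proof (rule bij_betw_combine)
    show "bij_betw \<sigma> T {..<?k}" using f by (rule bij_betw_cong[THEN iffD1, rotated]) (simp add: \<sigma>_def)
    show "bij_betw \<sigma> ({..<n} - T) {?k..<n}"
      using g by (rule bij_betw_cong[THEN iffD1, rotated]) (simp add: \<sigma>_def)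
  qed auto
  moreover have "T \<union> ({..<n} - T) = {..<n}" "{..<?k} \<union> {?k..<n} = {..<n}" using assms kn by auto
  ultimately have "bij_betw \<sigma> {..<n} {..<n}" by simp
  then have perm: "\<sigma> permutes {..<n}" using assms by (intro bij_imp_permutes) (auto simp: \<sigma>_def)
  have "nf (\<lambda>i. 1 * of_bool (\<sigma> i < ?k)) = phi ?k"
    unfolding phi_def using nf_signed_perm[OF perm, of "\<lambda>_. 1" "\<lambda>i. of_bool (i < ?k)"] by simp
  moreover have "\<sigma> i < ?k \<longleftrightarrow> i \<in> T" if "i < n" for i
  proof (cases "i \<in> T")
    case True
    then have "f i \<in> {..<?k}" using f bij_betwE by blast
    then show ?thesis using True by (simp add: \<sigma>_def)
  next
    case False
    then have "g i \<in> {?k..<n}" using g bij_betwE that by blast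
    then show ?thesis using False that by (simp add: \<sigma>_def)
  qed
  then have "nf (\<lambda>i. 1 * of_bool (\<sigma> i < ?k)) = nf (\<lambda>i. of_bool (i \<in> T))"
    by (intro nf_cong) simp
  ultimately show ?thesis by simp
qed

lemma phi_nonneg: "0 \<le> phi k"
  unfolding phi_def by (rule nf_nonneg)

lemma phi_mono: "j \<le> k \<Longrightarrow> phi j \<le> phi k"
  unfolding phi_def by (rule nf_mono) auto

lemma phi_pos:
  assumes "1 \<le> k"
  shows "0 < phi k"
proof -
  have "nf (\<lambda>i. of_bool (i < k)) \<noteq> 0" using assms n_pos by (auto simp: nf_eq_0_iff intro!: exI[of _ 0])
  then show ?thesis using phi_nonneg[of k] by (simp add: phi_def)
qed

lemma phi_0: "phi 0 = 0"
  by (simp add: phi_def nf_eq_0_iff)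

lemma phi_add:
  assumes "a + b \<le> n"
  shows "phi (a + b) \<le> phi a + phi b"
proof -
  have "phi (a + b) = nf (\<lambda>i. of_bool (i < a) + of_bool (i \<in> {a..<a + b}))"
    unfolding phi_def by (rule nf_cong) auto
  also have "\<dots> \<le> phi a + nf (\<lambda>i. of_bool (i \<in> {a..<a + b}))" unfolding phi_def by (rule nf_add)
  also have "nf (\<lambda>i. of_bool (i \<in> {a..<a + b})) = phi (card {a..<a + b})"
    using assms by (intro phi_card) auto
  finally show ?thesis by simp
qed

lemma phi_mult: "q * j + r \<le> n \<Longrightarrow> r \<le> j \<Longrightarrow> phi (q * j + r) \<le> (real q + 1) * phi j"
proof (induction q)
  case 0
  then show ?case using phi_mono[of r j] by simp
next
  case (Suc q)
  have "phi (Suc q * j + r) = phi (j + (q * j + r))" by (simp add: add.assoc)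
  also have "\<dots> \<le> phi j + phi (q * j + r)" using Suc.prems by (intro phi_add) simp
  also have "\<dots> \<le> phi j + (real q + 1) * phi j" using Suc by simp
  finally show ?case by (simp add: algebra_simps)
qed

text \<open>Cover k ones by k div j full blocks of length j and a remainder; the number of blocks is
  at most 2 * k / j. So \<open>phi k / k\<close> decreases up to a factor 2, for every symmetric
  norm and without \<open>mmc\<close>.\<close>

lemma phi_ratio:
  assumes "1 \<le> j" "j \<le> k" "k \<le> n"
  shows "phi k * real j \<le> 2 * real k * phi j"
proof -
  have "phi k \<le> (real (k div j) + 1) * phi j"
    using phi_mult[of "k div j" j "k mod j"] assms by (simp add: less_imp_le)
  then have "phi k * real j \<le> (real (k div j) + 1) * phi j * real j" by (intro mult_right_mono) auto
  also have "\<dots> = (real (k div j * j) + real j) * phi j" by (simp add: algebra_simps)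
  also have "\<dots> \<le> (real k + real k) * phi j"
    using assms phi_nonneg[of j] div_times_less_eq_dividend[of k j]
    by (intro mult_right_mono add_mono) (simp_all only: of_nat_le_iff)
  finally show ?thesis by (simp add: algebra_simps)
qed

lemma nf_lower:
  assumes "T \<subseteq> {..<n}" "0 \<le> t" "\<And>i. i \<in> T \<Longrightarrow> t \<le> \<bar>v i\<bar>"
  shows "t * phi (card T) \<le> nf v"
proof -
  have "t * phi (card T) = nf (\<lambda>i. t * of_bool (i \<in> T))"
    using assms(1,2) by (simp add: nf_scale phi_card)
  also have "\<dots> \<le> nf v" using assms by (intro nf_mono) auto
  finally show ?thesis .
qed

lemma nf_le_sum: "nf x \<le> phi 1 * (\<Sum>i<n. \<bar>x i\<bar>)"
proof -
  have "nf x = nf (\<lambda>i. \<Sum>j<n. x j * of_bool (i \<in> {j}))"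
    by (rule nf_cong) (simp add: of_bool_def sum.If_cases mult.commute if_distrib cong: if_cong)
  also have "\<dots> \<le> (\<Sum>j<n. nf (\<lambda>i. x j * of_bool (i \<in> {j})))" by (rule nf_sum) simp
  also have "\<dots> = (\<Sum>j<n. \<bar>x j\<bar> * phi 1)"
  proof (rule sum.cong)
    fix j assume "j \<in> {..<n}"
    then have "nf (\<lambda>i. of_bool (i \<in> {j})) = phi (card {j})" by (intro phi_card) auto
    then show "nf (\<lambda>i. x j * of_bool (i \<in> {j})) = \<bar>x j\<bar> * phi 1"
      using nf_scale[of "x j" "\<lambda>i. of_bool (i \<in> {j})"] by simp
  qed simp
  finally show ?thesis by (simp add: sum_distrib_left mult.commute)
qed

text \<open>This makes the norm continuous, hence Borel measurable, in its coordinates, on which the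
  uniqueness of the median rests.\<close>

lemma nf_lipschitz: "\<bar>nf x - nf y\<bar> \<le> phi 1 * (\<Sum>i<n. \<bar>x i - y i\<bar>)"
proof -
  have *: "nf x - nf y \<le> phi 1 * (\<Sum>i<n. \<bar>x i - y i\<bar>)" for x y
    using nf_add[of "\<lambda>i. x i - y i" y] nf_le_sum[of "\<lambda>i. x i - y i"] by simp
  show ?thesis using *[of x y] *[of y x] by (simp add: abs_minus_commute abs_le_iff)
qed

text \<open>Dyadic layers: with thresholds t q = max / 2 ^ q, each entry is at most t Q plus the sum
  of 2 * t p over the layers that contain it. The Q + 1 layers count twice and the remainder t Q
  once, hence 2 * Q + 3; the largest of these terms names the level set.\<close>

lemma nf_upper:
  assumes R: "R \<subseteq> {..<n}" and card: "card R \<le> 2 ^ Q" and nz: "i0 \<in> R" "v i0 \<noteq> 0"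
  shows "\<exists>t>0. {i\<in>R. t \<le> \<bar>v i\<bar>} \<noteq> {} \<and>
    nf (\<lambda>i. if i \<in> R then v i else 0) \<le> (2 * real Q + 3) * (t * phi (card {i\<in>R. t \<le> \<bar>v i\<bar>}))"
proof -
  have fin: "finite R" using R finite_subset by blast
  define vm where "vm = Max ((\<lambda>i. \<bar>v i\<bar>) ` R)"
  have vm: "\<bar>v i\<bar> \<le> vm" if "i \<in> R" for i using that fin by (simp add: vm_def)
  have vm_pos: "0 < vm" using vm[OF nz(1)] nz(2) by linarith
  have "vm \<in> (\<lambda>i. \<bar>v i\<bar>) ` R" unfolding vm_def using fin nz by (intro Max_in) auto
  then obtain im where im: "im \<in> R" "\<bar>v im\<bar> = vm" by auto
  define t where "t q = vm / 2 ^ q" for q :: nat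
  define T where "T q = {i\<in>R. t q \<le> \<bar>v i\<bar>}" for q
  have t_pos: "0 < t q" for q using vm_pos by (simp add: t_def)
  have im_T: "im \<in> T q" for q
    using im vm_pos by (simp add: T_def t_def field_simps mult_le_cancel_left1)
  have T_sub: "T q \<subseteq> {..<n}" for q using R by (auto simp: T_def)
  have finT: "finite (T q)" for q using T_sub finite_subset by blast
  have pt: "\<bar>v i\<bar> \<le> t q + (\<Sum>p\<le>q. 2 * t p * of_bool (i \<in> T p))" if "i \<in> R" for i q
  proof (induction q)
    case 0
    have "\<bar>v i\<bar> \<le> t 0 + 0" using vm[OF that] by (simp add: t_def)
    also have "\<dots> \<le> t 0 + (\<Sum>p\<le>0. 2 * t p * of_bool (i \<in> T p))"
      using t_pos by (intro add_left_mono sum_nonneg) (simp add: less_imp_le)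
    finally show ?case .
  next
    case (Suc q)
    have S: "0 \<le> (\<Sum>p\<le>q. 2 * t p * of_bool (i \<in> T p))"
      using t_pos by (intro sum_nonneg) (simp add: less_imp_le)
    show ?case
    proof (cases "i \<in> T (Suc q)")
      case True
      \<comment> \<open>Since 2 * t (q + 1) = t q, the term of the new layer takes over the old
        remainder.\<close>
      then show ?thesis using Suc t_pos[of "Suc q"] by (simp add: t_def)
    next
      case False
      then have "\<bar>v i\<bar> \<le> t (Suc q)" using that by (simp add: T_def)
      then show ?thesis using S False by simp
    qed
  qed
  let ?w = "\<lambda>i. if i \<in> R then v i else 0"
  let ?F = "\<lambda>q. t q * phi (card (T q))"
  have "nf ?w \<le> nf (\<lambda>i. t Q * of_bool (i \<in> R) + (\<Sum>p\<le>Q. 2 * t p * of_bool (i \<in> T p)))"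
  proof (rule nf_mono)
    fix i
    have "0 \<le> t Q * of_bool (i \<in> R) + (\<Sum>p\<le>Q. 2 * t p * of_bool (i \<in> T p))"
      using t_pos by (intro add_nonneg_nonneg sum_nonneg) (simp_all add: less_imp_le)
    then show "\<bar>?w i\<bar> \<le> \<bar>t Q * of_bool (i \<in> R) + (\<Sum>p\<le>Q. 2 * t p * of_bool (i \<in> T p))\<bar>"
      using pt[of i Q] by auto
  qed
  also have "\<dots> \<le> nf (\<lambda>i. t Q * of_bool (i \<in> R)) + nf (\<lambda>i. \<Sum>p\<le>Q. 2 * t p * of_bool (i \<in> T p))"
    by (rule nf_add)
  also have "nf (\<lambda>i. t Q * of_bool (i \<in> R)) = t Q * phi (card R)"
    using t_pos[of Q] R by (simp add: nf_scale phi_card)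
  \<comment> \<open>The remainder is harmless because R has at most 2 ^ Q elements: phi (card R)
    \<le> 2 ^ Q * phi 1 cancels the 2 ^ Q in t Q.\<close>
  also have "\<dots> \<le> ?F 0"
  proof -
    have "phi (card R) * real 1 \<le> 2 * real (card R) * phi 1 \<and> phi (card R) \<le> real (card R) * phi 1"
    proof -
      have "phi k \<le> real k * phi 1" if "k \<le> n" for k using that
      proof (induction k)
        case (Suc k)
        then show ?case using phi_add[of k 1] by (simp add: algebra_simps)
      qed (simp add: phi_0)
      then have "phi (card R) \<le> real (card R) * phi 1" using card_mono[OF _ R] by simp
      moreover have "0 \<le> real (card R) * phi 1" using phi_nonneg by simp
      ultimately show ?thesis by simp
    qed
    then have "t Q * phi (card R) \<le> t Q * (real (card R) * phi 1)"
      using t_pos[of Q] by (intro mult_left_mono) auto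
    also have "\<dots> \<le> t Q * (2 ^ Q * phi 1)"
    proof -
      have "real (card R) \<le> 2 ^ Q" using card by (metis of_nat_le_iff of_nat_numeral of_nat_power)
      then show ?thesis using t_pos[of Q] phi_nonneg by (intro mult_left_mono mult_right_mono) auto
    qed
    also have "\<dots> = t 0 * phi 1" by (simp add: t_def)
    also have "\<dots> \<le> ?F 0"
    proof -
      have "1 \<le> card (T 0)" using im_T[of 0] finT[of 0] by (simp add: Suc_le_eq card_gt_0_iff) blast
      then show ?thesis using t_pos[of 0] by (intro mult_left_mono phi_mono) auto
    qed
    finally show ?thesis .
  qed
  also have "nf (\<lambda>i. \<Sum>p\<le>Q. 2 * t p * of_bool (i \<in> T p)) \<le> (\<Sum>p\<le>Q. 2 * ?F p)"
  proof -
    have "nf (\<lambda>i. 2 * t p * of_bool (i \<in> T p)) = 2 * ?F p" for p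
      using nf_scale[of "2 * t p" "\<lambda>i. of_bool (i \<in> T p)"] t_pos[of p] T_sub[of p]
      by (simp add: phi_card)
    then show ?thesis using nf_sum[of "{..Q}" "\<lambda>p i. 2 * t p * of_bool (i \<in> T p)"] by simp
  qed
  finally have main: "nf ?w \<le> ?F 0 + (\<Sum>p\<le>Q. 2 * ?F p)" by simp
  define m where "m = Max (?F ` {..Q})"
  have m: "?F p \<le> m" if "p \<le> Q" for p using that by (simp add: m_def)
  have "m \<in> ?F ` {..Q}" unfolding m_def by (intro Max_in) auto
  then obtain q where q: "q \<le> Q" "m = ?F q" by auto
  have "?F 0 + (\<Sum>p\<le>Q. 2 * ?F p) \<le> m + (\<Sum>p\<le>Q. 2 * m)"
    using m by (intro add_mono sum_mono mult_left_mono) auto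
  also have "\<dots> = (2 * real Q + 3) * m" by (simp add: algebra_simps)
  finally have "nf ?w \<le> (2 * real Q + 3) * ?F q" using main q by simp
  moreover have "T q \<noteq> {}" using im_T by blast
  ultimately show ?thesis using t_pos[of q] unfolding T_def by blast
qed

end

section \<open>Uniqueness and size of the median\<close>

text \<open>The infimum M of the points where the distribution function reaches 1/2 works: right
  continuity bounds the mass of {..M} from below, and the left limit bounds the mass of {..<M} from
  above.\<close>

lemma median_exists:
  assumes "real_distribution D"
  shows "\<exists>M. 1/2 \<le> measure D {M..} \<and> 1/2 \<le> measure D {..M}"
proof -
  interpret real_distribution D by fact
  define S where "S = {m. 1/2 \<le> cdf D m}"
  have "eventually (\<lambda>m. 1/2 < cdf D m) at_top"
    by (rule order_tendstoD(1)[OF cdf_lim_at_top_prob]) simp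
  then obtain m1 where "1/2 < cdf D m1" using eventually_happens'[OF trivial_limit_at_top_linorder] by blast
  then have "m1 \<in> S" by (simp add: S_def)
  then have S_ne: "S \<noteq> {}" by blast
  have "eventually (\<lambda>m. cdf D m < 1/2) at_bot"
    by (rule order_tendstoD(2)[OF cdf_lim_at_bot]) simp
  then obtain m0 where m0: "cdf D m0 < 1/2" using eventually_happens'[OF trivial_limit_at_bot_linorder] by blast
  have bdd: "bdd_below S"
  proof (rule bdd_belowI[of _ m0], rule ccontr)
    fix m assume "m \<in> S" "\<not> m0 \<le> m"
    then show False using m0 cdf_nondecreasing[of m m0] by (simp add: S_def)
  qed
  define M where "M = Inf S"
  have up: "1/2 \<le> cdf D m" if "M < m" for m
  proof -
    have "Inf S < m" using that by (simp add: M_def)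
    then obtain m' where "m' \<in> S" "m' < m" using cInf_lessD[OF S_ne] by blast
    then show ?thesis using cdf_nondecreasing[of m' m] by (simp add: S_def)
  qed
  have down: "cdf D m \<le> 1/2" if "m < M" for m
  proof (rule ccontr)
    assume "\<not> cdf D m \<le> 1/2"
    then have "m \<in> S" by (simp add: S_def)
    then show False using cInf_lower[OF _ bdd] that by (fastforce simp: M_def)
  qed
  have "(cdf D \<longlongrightarrow> cdf D M) (at_right M)"
    using cdf_is_right_cont[of M] by (simp add: continuous_within)
  then have 1: "1/2 \<le> cdf D M"
  proof (rule tendsto_lowerbound)
    show "eventually (\<lambda>m. 1/2 \<le> cdf D m) (at_right M)"
      by (rule eventually_at_rightI[of M "M + 1"], rule up) simp_all
  qed simp
  have "measure D {..<M} \<le> 1/2"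
  proof (rule tendsto_upperbound[OF cdf_at_left])
    show "eventually (\<lambda>m. cdf D m \<le> 1/2) (at_left M)"
      by (rule eventually_at_leftI[of "M - 1"], rule down) simp_all
  qed simp
  moreover have "measure D {M..} = 1 - measure D {..<M}"
  proof -
    have "{M..} = space D - {..<M}" by auto
    then show ?thesis using prob_compl[of "{..<M}"] by simp
  qed
  ultimately show ?thesis using 1 by (intro exI[of _ M]) (simp add: cdf_def2)
qed

lemma emeasure_lborel_open_pos:
  fixes S :: "real set"
  assumes "open S" "S \<noteq> {}"
  shows "0 < emeasure lborel S"
proof -
  obtain x where "x \<in> S" using assms(2) by blast
  then obtain e where e: "0 < e" "cball x e \<subseteq> S" using assms(1) open_contains_cball by blast
  have "0 < emeasure lborel {x - e..x + e}" using e by simp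
  also have "\<dots> \<le> emeasure lborel S"
    using e assms(1) by (intro emeasure_mono) (auto simp: cball_eq_atLeastAtMost)
  finally show ?thesis .
qed

section \<open>Volumes of balls and caps under product Lebesgue measure\<close>

abbreviation lborel_PiM :: "nat \<Rightarrow> (nat \<Rightarrow> real) measure" where
  "lborel_PiM k \<equiv> \<Pi>\<^sub>M i\<in>{..<k}. lborel"

lemma product_sigma_finite_lborel: "product_sigma_finite (\<lambda>_. lborel :: real measure)"
  by (simp add: product_sigma_finite_def sigma_finite_lborel)

lemma lborel_PiM_translate:
  "distr (lborel_PiM k) (lborel_PiM k) (\<lambda>y. \<lambda>i\<in>{..<k}. c i + y i) = lborel_PiM k"
proof (rule product_sigma_finite.PiM_eqI[OF product_sigma_finite_lborel])
  fix A :: "nat \<Rightarrow> real set"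
  assume A: "\<And>i. i \<in> {..<k} \<Longrightarrow> A i \<in> sets lborel"
  let ?A' = "\<lambda>i. (+) (c i) -` A i"
  have A': "?A' i \<in> sets lborel" if "i < k" for i
    using measurable_sets[of "(+) (c i)" borel borel "A i"] A[of i] that by simp
  have "emeasure (distr (lborel_PiM k) (lborel_PiM k) (\<lambda>y. \<lambda>i\<in>{..<k}. c i + y i)) (Pi\<^sub>E {..<k} A)
      = emeasure (lborel_PiM k) ((\<lambda>y. \<lambda>i\<in>{..<k}. c i + y i) -` Pi\<^sub>E {..<k} A \<inter> space (lborel_PiM k))"
    using A by (intro emeasure_distr sets_PiM_I_finite) auto
  also have "(\<lambda>y. \<lambda>i\<in>{..<k}. c i + y i) -` Pi\<^sub>E {..<k} A \<inter> space (lborel_PiM k) = Pi\<^sub>E {..<k} ?A'"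
    by (auto simp: space_PiM PiE_def Pi_def)
  also have "emeasure (lborel_PiM k) \<dots> = (\<Prod>i<k. emeasure lborel (?A' i))"
    using A' by (intro product_sigma_finite.emeasure_PiM[OF product_sigma_finite_lborel]) auto
  also have "\<dots> = (\<Prod>i<k. emeasure lborel (A i))"
  proof (rule prod.cong)
    fix i assume i: "i \<in> {..<k}"
    have "emeasure lborel (A i) = emeasure (distr lborel borel ((+) (c i))) (A i)"
      by (simp add: lborel_distr_plus)
    also have "\<dots> = emeasure lborel (?A' i)" using A[OF i] by (subst emeasure_distr) auto
    finally show "emeasure lborel (?A' i) = emeasure lborel (A i)" by simp
  qed simp
  finally show "emeasure (distr (lborel_PiM k) (lborel_PiM k) (\<lambda>y. \<lambda>i\<in>{..<k}. c i + y i)) (Pi\<^sub>E {..<k} A)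
    = (\<Prod>i<k. emeasure lborel (A i))" .
qed auto

lemma L2_set_measurable [measurable]:
  "(\<lambda>y. L2_set y {..<k}) \<in> borel_measurable (lborel_PiM k)"
  unfolding L2_set_def by measurable

lemma coord_measurable: "i < k \<Longrightarrow> (\<lambda>y. y i) \<in> borel_measurable (lborel_PiM k)"
  using measurable_component_singleton[of i "{..<k}" "\<lambda>_. lborel :: real measure"] by simp

lemma emeasure_translated_ball:
  assumes "0 < r"
  shows "emeasure (lborel_PiM k) {y \<in> space (lborel_PiM k). L2_set (\<lambda>i. c i + y i) {..<k} \<le> r}
    = ennreal (unit_ball_vol (real k) * r ^ k)"
proof -
  let ?T = "\<lambda>y. \<lambda>i\<in>{..<k}. c i + y i"
  let ?B = "{f. sqrt (\<Sum>i<k. (f i)\<^sup>2) \<le> r} \<inter> space (lborel_PiM k)"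
  have B: "?B = {y \<in> space (lborel_PiM k). L2_set y {..<k} \<le> r}" by (auto simp: L2_set_def)
  have "ennreal (unit_ball_vol (real k) * r ^ k) = emeasure (lborel_PiM k) ?B"
    using emeasure_cball_aux[of "{..<k}" r] assms by simp
  also have "\<dots> = emeasure (distr (lborel_PiM k) (lborel_PiM k) ?T) ?B"
    by (simp add: lborel_PiM_translate)
  also have "\<dots> = emeasure (lborel_PiM k) (?T -` ?B \<inter> space (lborel_PiM k))"
    unfolding B by (intro emeasure_distr) measurable
  also have "?T -` ?B \<inter> space (lborel_PiM k) = {y \<in> space (lborel_PiM k). L2_set (\<lambda>i. c i + y i) {..<k} \<le> r}"
    by (auto simp: space_PiM L2_set_def)
  finally show ?thesis by simp
qed

definition ball_set :: "nat \<Rightarrow> (nat \<Rightarrow> real) set" where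
  "ball_set k = {y \<in> space (lborel_PiM k). L2_set y {..<k} \<le> 1}"

lemma ball_set_sets [measurable]: "ball_set k \<in> sets (lborel_PiM k)"
  unfolding ball_set_def by measurable

lemma emeasure_ball_set: "emeasure (lborel_PiM k) (ball_set k) = ennreal (unit_ball_vol (real k))"
  using emeasure_translated_ball[of 1 k "\<lambda>_. 0"] by (simp add: ball_set_def)

abbreviation uniform_ball :: "nat \<Rightarrow> (nat \<Rightarrow> real) measure" where
  "uniform_ball k \<equiv> uniform_measure (lborel_PiM k) (ball_set k)"

lemma unit_ball_vol_ne_0: "unit_ball_vol (real k) \<noteq> 0"
  using unit_ball_vol_pos[of "real k"] by linarith

lemma prob_space_uniform_ball: "prob_space (uniform_ball k)"
  by (rule prob_space_uniform_measure) (simp_all add: emeasure_ball_set unit_ball_vol_ne_0)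

lemma measure_uniform_ball:
  "A \<in> sets (lborel_PiM k) \<Longrightarrow>
    measure (uniform_ball k) A = measure (lborel_PiM k) (ball_set k \<inter> A) / unit_ball_vol (real k)"
  by (subst measure_uniform_measure) (simp_all add: emeasure_ball_set measure_def unit_ball_vol_ne_0)

text \<open>The part of the cone inside the unit ball lies in the ball of radius sqrt (1 - a ^ 2)
  around the point a * s on axis i, so a ratio of volumes bounds its probability. Cones in the ball
  replace caps on the sphere, in line with the definition of \<open>uniform_sphere\<close>.\<close>

lemma prob_cap:
  assumes i: "i < k" and a: "0 \<le> a" "a\<^sup>2 \<le> 1/2" and s: "s \<in> {-1, 1 :: real}"
  shows "measure (uniform_ball k) {y \<in> space (lborel_PiM k). a * L2_set y {..<k} \<le> s * y i} \<le> sqrt (1 - a\<^sup>2) ^ k"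
proof -
  let ?A = "{y \<in> space (lborel_PiM k). a * L2_set y {..<k} \<le> s * y i}"
  let ?c = "\<lambda>j. if j = i then - (a * s) else 0"
  let ?r = "sqrt (1 - a\<^sup>2)"
  let ?S = "{y \<in> space (lborel_PiM k). L2_set (\<lambda>j. ?c j + y j) {..<k} \<le> ?r}"
  have r: "0 < ?r" using a by simp
  note [measurable] = coord_measurable[OF i]
  have A [measurable]: "?A \<in> sets (lborel_PiM k)" by measurable
  have sub: "ball_set k \<inter> ?A \<subseteq> ?S"
  proof
    fix y assume y: "y \<in> ball_set k \<inter> ?A"
    define q where "q = L2_set y {..<k}"
    have q: "0 \<le> q" "q \<le> 1" using y by (auto simp: q_def ball_set_def)
    have q2: "q\<^sup>2 = (\<Sum>j<k. (y j)\<^sup>2)" by (simp add: q_def L2_set_def sum_nonneg)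
    have "(\<Sum>j<k. (?c j + y j)\<^sup>2) = (\<Sum>j<k. (y j)\<^sup>2 + (if j = i then a\<^sup>2 - 2 * a * (s * y i) else 0))"
    proof (rule sum.cong)
      fix j
      have "(- (a * s) + y i)\<^sup>2 = (y i)\<^sup>2 + (a\<^sup>2 * (s * s) - 2 * a * (s * y i))"
        by (simp add: power2_eq_square algebra_simps)
      moreover have "s * s = 1" using s by auto
      ultimately show "(?c j + y j)\<^sup>2 = (y j)\<^sup>2 + (if j = i then a\<^sup>2 - 2 * a * (s * y i) else 0)" by simp
    qed simp
    also have "\<dots> = q\<^sup>2 + (a\<^sup>2 - 2 * a * (s * y i))" using i by (simp add: sum.distrib q2)
    also have "\<dots> \<le> q\<^sup>2 + (a\<^sup>2 - 2 * a * (a * q))"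
      using y a(1) by (intro add_left_mono diff_left_mono mult_left_mono) (auto simp: q_def)
    \<comment> \<open>Replacing q ^ 2 by q makes the bound affine in q; for a ^ 2 \<le> 1/2 it is
      largest at q = 1, where it equals 1 - a ^ 2.\<close>
    also have "\<dots> \<le> q + (a\<^sup>2 - 2 * a\<^sup>2 * q)"
      using q mult_left_mono[of q 1 q] by (simp add: power2_eq_square)
    also have "\<dots> = a\<^sup>2 + q * (1 - 2 * a\<^sup>2)" by (simp add: algebra_simps)
    also have "\<dots> \<le> a\<^sup>2 + 1 * (1 - 2 * a\<^sup>2)" using q a by (intro add_left_mono mult_right_mono) auto
    finally have "(\<Sum>j<k. (?c j + y j)\<^sup>2) \<le> 1 - a\<^sup>2" by simp
    then show "y \<in> ?S" using y by (auto simp: L2_set_def)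
  qed
  have S: "emeasure (lborel_PiM k) ?S = ennreal (unit_ball_vol (real k) * ?r ^ k)"
    by (rule emeasure_translated_ball[OF r])
  have "measure (lborel_PiM k) (ball_set k \<inter> ?A) \<le> measure (lborel_PiM k) ?S"
  proof (rule measure_mono_fmeasurable[OF sub])
    have [measurable]: "(\<lambda>y. L2_set (\<lambda>j. ?c j + y j) {..<k}) \<in> borel_measurable (lborel_PiM k)"
      unfolding L2_set_def
      by (rule measurable_compose[OF _ borel_measurable_sqrt], intro borel_measurable_sum
          borel_measurable_power borel_measurable_add borel_measurable_const) (rule coord_measurable, simp)
    have "?S \<in> sets (lborel_PiM k)" by measurable
    then show "?S \<in> fmeasurable (lborel_PiM k)" using S by (intro fmeasurableI) auto
    show "ball_set k \<inter> ?A \<in> sets (lborel_PiM k)" using A ball_set_sets by (rule sets.Int[rotated])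
  qed
  also have "\<dots> = unit_ball_vol (real k) * ?r ^ k" unfolding measure_def S using r by simp
  finally have "measure (lborel_PiM k) (ball_set k \<inter> ?A) / unit_ball_vol (real k) \<le> ?r ^ k"
    using unit_ball_vol_pos[of "real k"] by (simp add: pos_divide_le_eq mult.commute)
  then show ?thesis using measure_uniform_ball[OF A] by simp
qed

text \<open>This is sqrt 2 * a for a ^ 2 = 2 * ln (4 * k + 1) / k. With this a each of the 2 * k
  caps has probability at most 1 / (4 * k + 1); the extra sqrt 2 makes the bound at least 1 as soon
  as a is too large for \<open>prob_cap\<close>.\<close>

definition coord_bound :: "nat \<Rightarrow> real" where
  "coord_bound k = 2 * sqrt (ln (4 * real k + 1) / real k)"

lemma L2_set_ge_abs: "i < k \<Longrightarrow> \<bar>y i\<bar> \<le> L2_set y {..<k}" for y :: "nat \<Rightarrow> real"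
proof -
  assume i: "i < k"
  have "(y i)\<^sup>2 \<le> (\<Sum>j<k. (y j)\<^sup>2)" using i by (intro member_le_sum) auto
  then show ?thesis unfolding L2_set_def by (metis real_sqrt_abs real_sqrt_le_iff)
qed

text \<open>Union bound over the 2 * k caps. The inequality is strict because it has to contradict a
  median event, whose probability is at least 1/2.\<close>

lemma prob_large_coord:
  assumes "1 \<le> k"
  shows "measure (uniform_ball k) {y \<in> space (lborel_PiM k). \<exists>i<k. coord_bound k * L2_set y {..<k} < \<bar>y i\<bar>} < 1/2"
proof -
  interpret U: prob_space "uniform_ball k" by (rule prob_space_uniform_ball)
  define a where "a = sqrt (2 * ln (4 * real k + 1) / real k)"
  have ln_pos: "0 < ln (4 * real k + 1)" using assms by simp
  have a0: "0 \<le> a" using assms ln_pos by (simp add: a_def)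
  have a2: "a\<^sup>2 = 2 * ln (4 * real k + 1) / real k" using assms ln_pos by (simp add: a_def)
  have cb: "coord_bound k = sqrt 2 * a"
    using assms by (simp add: coord_bound_def a_def real_sqrt_mult real_sqrt_divide)
  have sets_eq: "sets (uniform_ball k) = sets (lborel_PiM k)" by simp
  show ?thesis
  proof (cases "a\<^sup>2 \<le> 1/2")
    case True
    let ?A = "\<lambda>(i, s). {y \<in> space (lborel_PiM k). a * L2_set y {..<k} \<le> s * y i}"
    let ?I = "{..<k} \<times> {-1, 1 :: real}"
    have A_sets: "?A p \<in> sets (lborel_PiM k)" if "p \<in> ?I" for p
    proof -
      obtain i s where p: "p = (i, s)" by (cases p)
      then have p2: "i < k" using that by simp
      have "{y \<in> space (lborel_PiM k). a * L2_set y {..<k} \<le> s * y i} \<in> sets (lborel_PiM k)"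
        using coord_measurable[OF p2] by measurable
      then show ?thesis by (simp add: p)
    qed
    have sub: "{y \<in> space (lborel_PiM k). \<exists>i<k. coord_bound k * L2_set y {..<k} < \<bar>y i\<bar>} \<subseteq> (\<Union>p\<in>?I. ?A p)"
    proof
      fix y assume "y \<in> {y \<in> space (lborel_PiM k). \<exists>i<k. coord_bound k * L2_set y {..<k} < \<bar>y i\<bar>}"
      then obtain i where y: "y \<in> space (lborel_PiM k)" "i < k" "coord_bound k * L2_set y {..<k} < \<bar>y i\<bar>"
        by blast
      have "1 * (a * L2_set y {..<k}) \<le> sqrt 2 * (a * L2_set y {..<k})"
        using a0 by (intro mult_right_mono) auto
      then have le: "a * L2_set y {..<k} \<le> \<bar>y i\<bar>" using y(3) cb by simp
      show "y \<in> (\<Union>p\<in>?I. ?A p)"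
      proof (cases "0 \<le> y i")
        case True
        then have "y \<in> ?A (i, 1)" using le y(1) by simp
        then show ?thesis using y(2) by (intro UN_I[of "(i, 1)"]) simp_all
      next
        case False
        then have "y \<in> ?A (i, -1)" using le y(1) by simp
        then show ?thesis using y(2) by (intro UN_I[of "(i, -1)"]) simp_all
      qed
    qed
    have "measure (uniform_ball k) {y \<in> space (lborel_PiM k). \<exists>i<k. coord_bound k * L2_set y {..<k} < \<bar>y i\<bar>}
        \<le> measure (uniform_ball k) (\<Union>p\<in>?I. ?A p)"
      using A_sets by (intro U.finite_measure_mono[OF sub], unfold sets_eq, intro sets.finite_UN) blast+
    also have "\<dots> \<le> (\<Sum>p\<in>?I. measure (uniform_ball k) (?A p))"
      using A_sets by (intro U.finite_measure_subadditive_finite) (simp, unfold sets_eq, blast)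
    also have "\<dots> \<le> (\<Sum>p\<in>?I. sqrt (1 - a\<^sup>2) ^ k)"
    proof (rule sum_mono)
      fix p assume "p \<in> ?I"
      then obtain i s where "p = (i, s)" "i < k" "s \<in> {-1, 1 :: real}" by blast
      then show "measure (uniform_ball k) (?A p) \<le> sqrt (1 - a\<^sup>2) ^ k"
        using prob_cap[OF _ a0 True, of i k s] by simp
    qed
    also have "\<dots> = 2 * real k * sqrt (1 - a\<^sup>2) ^ k"
      by (simp add: card_cartesian_product)
    also have "sqrt (1 - a\<^sup>2) ^ k \<le> inverse (4 * real k + 1)"
    proof -
      have "sqrt (1 - a\<^sup>2) \<le> sqrt (exp (- a\<^sup>2))"
        using exp_ge_add_one_self[of "- a\<^sup>2"] by simp
      also have "\<dots> = exp (- a\<^sup>2 / 2)"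
        by (rule real_sqrt_unique) (simp_all add: power2_eq_square exp_add[symmetric])
      finally have "sqrt (1 - a\<^sup>2) ^ k \<le> exp (- a\<^sup>2 / 2) ^ k" using True by (intro power_mono) auto
      also have "\<dots> = exp (- ln (4 * real k + 1))"
        using assms by (simp add: exp_of_nat_mult[symmetric] a2)
      also have "\<dots> = inverse (4 * real k + 1)" by (simp add: exp_minus)
      finally show ?thesis .
    qed
    then have "2 * real k * sqrt (1 - a\<^sup>2) ^ k \<le> 2 * real k * inverse (4 * real k + 1)"
      by (intro mult_left_mono) auto
    also have "\<dots> < 1/2" by (simp add: field_simps)
    finally show ?thesis .
  next
    case False
    have "1 \<le> (sqrt 2 * a)\<^sup>2" using False by (simp add: power_mult_distrib)
    then have "1 \<le> coord_bound k" using a0 cb by (intro power2_le_imp_le[of 1]) (simp_all add: cb)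
    then have "\<bar>y i\<bar> \<le> coord_bound k * L2_set y {..<k}" if "i < k" for y :: "nat \<Rightarrow> real" and i
      using L2_set_ge_abs[OF that, of y] mult_right_mono[of 1 "coord_bound k" "L2_set y {..<k}"] by simp
    then have "\<not> (\<exists>i<k. coord_bound k * L2_set y {..<k} < \<bar>y i\<bar>)" for y :: "nat \<Rightarrow> real"
      by (meson not_less)
    then have empty: "{y \<in> space (lborel_PiM k). \<exists>i<k. coord_bound k * L2_set y {..<k} < \<bar>y i\<bar>} = {}" by blast
    show ?thesis unfolding empty by simp
  qed
qed

section \<open>The norm on the sphere as a random variable on the ball\<close>

context sym_norm
begin

lemma continuous_on_nf:
  fixes x :: "'b::topological_space \<Rightarrow> nat \<Rightarrow> real"
  assumes "\<And>i. i < n \<Longrightarrow> continuous_on S (\<lambda>t. x t i)"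
  shows "continuous_on S (\<lambda>t. nf (x t))"
  unfolding continuous_on_def
proof
  fix t0 assume t0: "t0 \<in> S"
  have "((\<lambda>t. phi 1 * (\<Sum>i<n. \<bar>x t i - x t0 i\<bar>)) \<longlongrightarrow> phi 1 * (\<Sum>i<n. \<bar>x t0 i - x t0 i\<bar>)) (at t0 within S)"
    using assms t0 unfolding continuous_on_def
    by (intro tendsto_mult tendsto_const tendsto_sum tendsto_rabs tendsto_diff) auto
  then have "((\<lambda>t. phi 1 * (\<Sum>i<n. \<bar>x t i - x t0 i\<bar>)) \<longlongrightarrow> 0) (at t0 within S)" by simp
  then have "((\<lambda>t. nf (x t) - nf (x t0)) \<longlongrightarrow> 0) (at t0 within S)"
    by (rule Lim_null_comparison[rotated]) (intro always_eventually allI, simp only: real_norm_def nf_lipschitz)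
  then show "((\<lambda>t. nf (x t)) \<longlongrightarrow> nf (x t0)) (at t0 within S)"
    by (simp add: LIM_zero_iff)
qed

lemma measurable_nf:
  assumes "\<And>i. i < n \<Longrightarrow> (\<lambda>y. x y i) \<in> borel_measurable M"
  shows "(\<lambda>y. nf (x y)) \<in> borel_measurable M"
proof -
  have "continuous_on UNIV nf"
    by (rule continuous_on_nf[where x = "\<lambda>x. x"]) (rule continuous_on_product_coordinates)
  then have nf: "nf \<in> borel_measurable borel" by (rule borel_measurable_continuous_onI)
  \<comment> \<open>\<open>nf\<close> ignores the coordinates from n on, so they can be set to 0 to
    obtain a measurable map into the full function space.\<close>
  have "(\<lambda>y i. if i < n then x y i else 0) \<in> borel_measurable M"
  proof (rule measurable_coordinatewise_then_product)
    fix i show "(\<lambda>y. if i < n then x y i else 0) \<in> borel_measurable M"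
      using assms[of i] by (cases "i < n") auto
  qed
  from measurable_compose[OF this nf]
  have "(\<lambda>y. nf (\<lambda>i. if i < n then x y i else 0)) \<in> borel_measurable M" .
  moreover have "nf (\<lambda>i. if i < n then x y i else 0) = nf (x y)" for y by (rule nf_cong) simp
  ultimately show ?thesis by simp
qed

text \<open>Radial projection onto the unit sphere; since \<open>x / 0 = 0\<close>, the value at the origin is \<open>0\<close>.\<close>

definition sphere_nf :: "nat \<Rightarrow> (nat \<Rightarrow> real) \<Rightarrow> real" where
  "sphere_nf k y = nf (\<lambda>i. if i < k then y i / L2_set y {..<k} else 0)"

lemma sphere_nf_measurable: "sphere_nf k \<in> borel_measurable (lborel_PiM k)"
  unfolding sphere_nf_def
proof (rule measurable_nf)
  fix i show "(\<lambda>y. if i < k then y i / L2_set y {..<k} else 0) \<in> borel_measurable (lborel_PiM k)"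
    using coord_measurable[of i k] L2_set_measurable[of k] by (cases "i < k") auto
qed

lemma restr_norm_vec: "k \<le> n \<Longrightarrow> restr_norm n l k (vec k x) = nf (\<lambda>i. if i < k then x i else 0)"
  unfolding restr_norm_def nf_def by (rule arg_cong[where f = l]) (auto intro: eq_vecI)

text \<open>\<open>uniform_sphere\<close> is an image of the uniform law on the ball, so from here
  on every statement about the median is one about Lebesgue measure on the ball.\<close>

lemma uniform_sphere_prob:
  assumes kn: "k \<le> n" and X: "X \<in> sets borel"
  shows "measure (uniform_sphere k) {x \<in> space (uniform_sphere k). restr_norm n l k (vec k x) \<in> X}
    = measure (uniform_ball k) {y \<in> space (lborel_PiM k). sphere_nf k y \<in> X}"
proof -
  let ?f = "\<lambda>y. \<lambda>i\<in>{..<k}. y i / L2_set y {..<k}"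
  let ?N = "\<Pi>\<^sub>M i\<in>{..<k}. borel :: real measure"
  let ?S = "{x \<in> space ?N. restr_norm n l k (vec k x) \<in> X}"
  have us: "uniform_sphere k = distr (uniform_ball k) ?N ?f"
    by (simp add: uniform_sphere_def ball_set_def)
  have f: "?f \<in> measurable (uniform_ball k) ?N"
  proof (rule measurable_restrict)
    fix i assume "i \<in> {..<k}"
    then show "(\<lambda>y. y i / L2_set y {..<k}) \<in> borel_measurable (uniform_ball k)"
      using coord_measurable[of i k] L2_set_measurable[of k] by simp
  qed
  have "(\<lambda>x. nf (\<lambda>i. if i < k then x i else 0)) \<in> borel_measurable ?N"
  proof (rule measurable_nf)
    fix i show "(\<lambda>x. if i < k then x i else 0) \<in> borel_measurable ?N" by (cases "i < k") auto
  qed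
  then have S: "?S \<in> sets ?N"
    using measurable_sets[OF _ X] by (simp add: restr_norm_vec[OF kn] vimage_def Int_def conj_commute)
  have "measure (uniform_sphere k) {x \<in> space (uniform_sphere k). restr_norm n l k (vec k x) \<in> X}
      = measure (distr (uniform_ball k) ?N ?f) ?S" unfolding us by simp
  also have "\<dots> = measure (uniform_ball k) (?f -` ?S \<inter> space (uniform_ball k))"
    by (rule measure_distr[OF f S])
  also have "?f -` ?S \<inter> space (uniform_ball k) = {y \<in> space (lborel_PiM k). sphere_nf k y \<in> X}"
  proof -
    have "restr_norm n l k (vec k (?f y)) = sphere_nf k y" for y
      unfolding restr_norm_vec[OF kn] sphere_nf_def by (rule nf_cong) simp
    then show ?thesis by (auto simp: space_PiM)
  qed
  finally show ?thesis .
qed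

lemma is_median_iff:
  assumes "k \<le> n"
  shows "is_median k (restr_norm n l k) M \<longleftrightarrow>
    1/2 \<le> measure (uniform_ball k) {y \<in> space (lborel_PiM k). M \<le> sphere_nf k y} \<and>
    1/2 \<le> measure (uniform_ball k) {y \<in> space (lborel_PiM k). sphere_nf k y \<le> M}"
  using uniform_sphere_prob[OF assms, of "{M..}"] uniform_sphere_prob[OF assms, of "{..M}"]
  by (simp add: is_median_def)

lemma sphere_nf_set_sets:
  assumes "X \<in> sets borel"
  shows "{y \<in> space (lborel_PiM k). sphere_nf k y \<in> X} \<in> sets (lborel_PiM k)"
  using measurable_sets[OF sphere_nf_measurable assms, of k] by (simp add: vimage_def Int_def conj_commute)

lemma ex_is_median:
  assumes "k \<le> n"
  shows "\<exists>M. is_median k (restr_norm n l k) M"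
proof -
  interpret U: prob_space "uniform_ball k" by (rule prob_space_uniform_ball)
  have m: "sphere_nf k \<in> borel_measurable (uniform_ball k)" using sphere_nf_measurable by simp
  let ?D = "distr (uniform_ball k) borel (sphere_nf k)"
  have "real_distribution ?D" using m by (rule U.real_distribution_distr)
  from median_exists[OF this] obtain M where
    "1/2 \<le> measure ?D {M..}" "1/2 \<le> measure ?D {..M}" by blast
  then have "is_median k (restr_norm n l k) M"
    unfolding is_median_iff[OF assms] by (simp add: measure_distr[OF m] vimage_def Int_def conj_commute)
  then show ?thesis ..
qed

lemma sphere_nf_scale: "0 < c \<Longrightarrow> sphere_nf k (\<lambda>i. c * y i) = sphere_nf k y"
  unfolding sphere_nf_def
  by (rule nf_cong) (simp add: L2_set_right_distrib[symmetric] less_imp_le)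

lemma sphere_nf_cong: "(\<And>i. i < k \<Longrightarrow> x i = y i) \<Longrightarrow> sphere_nf k x = sphere_nf k y"
  unfolding sphere_nf_def by (rule nf_cong) (auto intro!: arg_cong2[where f = "(/)"] L2_set_cong)

lemma sphere_nf_neg: "sphere_nf k (\<lambda>i. - y i) = sphere_nf k y"
proof -
  have "sphere_nf k (\<lambda>i. - y i) = nf (\<lambda>i. - 1 * (if i < k then y i / L2_set y {..<k} else 0))"
    unfolding sphere_nf_def by (rule nf_cong) (simp add: L2_set_def)
  then show ?thesis unfolding nf_scale by (simp add: sphere_nf_def)
qed

lemma continuous_on_L2_set:
  fixes x :: "'b::topological_space \<Rightarrow> nat \<Rightarrow> real"
  assumes "\<And>i. i < k \<Longrightarrow> continuous_on S (\<lambda>t. x t i)"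
  shows "continuous_on S (\<lambda>t. L2_set (x t) {..<k})"
  unfolding L2_set_def using assms by (intro continuous_intros) auto

lemma continuous_on_sphere_nf:
  fixes x :: "'b::topological_space \<Rightarrow> nat \<Rightarrow> real"
  assumes "\<And>i. i < k \<Longrightarrow> continuous_on S (\<lambda>t. x t i)" "\<And>t. t \<in> S \<Longrightarrow> L2_set (x t) {..<k} \<noteq> 0"
  shows "continuous_on S (\<lambda>t. sphere_nf k (x t))"
  unfolding sphere_nf_def
proof (rule continuous_on_nf)
  fix i show "continuous_on S (\<lambda>t. if i < k then x t i / L2_set (x t) {..<k} else 0)"
    using assms continuous_on_L2_set[of k S x] by (cases "i < k") (auto intro!: continuous_on_divide)
qed

lemma L2_set_eq_0: "L2_set y {..<k} = 0 \<longleftrightarrow> (\<forall>i<k. y i = 0)" for y :: "nat \<Rightarrow> real"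
  by (auto simp: L2_set_eq_0_iff)

text \<open>
  Between a point with small and a point with large norm the norm takes every value strictly inside
  the unit ball: the segment joining them avoids the origin, because antipodal points have the same norm.
\<close>

lemma sphere_nf_between:
  assumes "sphere_nf k y1 \<le> a" "b \<le> sphere_nf k y2" "a < b" "L2_set y1 {..<k} \<noteq> 0" "L2_set y2 {..<k} \<noteq> 0"
  shows "\<exists>z. L2_set z {..<k} \<noteq> 0 \<and> L2_set z {..<k} < 1 \<and> a < sphere_nf k z \<and> sphere_nf k z < b"
proof -
  define \<gamma> where "\<gamma> t i = (1 - t) * y1 i + t * y2 i" for t :: real and i
  have nz: "L2_set (\<gamma> t) {..<k} \<noteq> 0" if t: "0 \<le> t" "t \<le> 1" for t
  proof
    assume "L2_set (\<gamma> t) {..<k} = 0"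
    then have 0: "\<gamma> t i = 0" if "i < k" for i using that by (simp add: L2_set_eq_0)
    show False
    proof (cases "t = 0")
      case True
      then have "\<gamma> t = y1" by (simp add: \<gamma>_def fun_eq_iff)
      then show False using 0 assms(4) by (simp add: L2_set_eq_0)
    next
      case False
      show False
      proof (cases "t = 1")
        case True
        then have "\<gamma> t = y2" by (simp add: \<gamma>_def fun_eq_iff)
        then show False using 0 assms(5) by (simp add: L2_set_eq_0)
      next
        case False': False
        define c where "c = (1 - t) / t"
        have c: "0 < c" using t False False' by (simp add: c_def)
        have "y2 i = - (c * y1 i)" if "i < k" for i
          using 0[OF that] False by (simp add: \<gamma>_def c_def field_simps)
        then have "sphere_nf k y2 = sphere_nf k (\<lambda>i. - (c * y1 i))" by (rule sphere_nf_cong)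
        also have "\<dots> = sphere_nf k y1" using c by (simp add: sphere_nf_neg sphere_nf_scale)
        finally show False using assms by simp
      qed
    qed
  qed
  have "continuous_on {0..1} (\<lambda>t. sphere_nf k (\<gamma> t))"
    using nz by (intro continuous_on_sphere_nf) (auto simp: \<gamma>_def intro!: continuous_intros)
  moreover have "\<gamma> 0 = y1" "\<gamma> 1 = y2" by (simp_all add: \<gamma>_def fun_eq_iff)
  ultimately obtain t where t: "0 \<le> t" "t \<le> 1" "sphere_nf k (\<gamma> t) = (a + b) / 2"
    using IVT'[of "\<lambda>t. sphere_nf k (\<gamma> t)" 0 "(a + b) / 2" 1] assms by auto
  define q where "q = L2_set (\<gamma> t) {..<k}"
  have q: "0 < q" using nz[OF t(1,2)] by (simp add: q_def order_le_neq_trans)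
  define z where "z i = (1 / (2 * q)) * \<gamma> t i" for i
  have "L2_set z {..<k} = 1 / 2" unfolding z_def using q
    by (subst L2_set_right_distrib[symmetric]) (simp_all add: q_def)
  moreover have "sphere_nf k z = (a + b) / 2" unfolding z_def using q t(3) by (subst sphere_nf_scale) auto
  ultimately show ?thesis using assms(3) by (intro exI[of _ z]) auto
qed

text \<open>Away from the origin the projected norm is continuous, so the condition is open around z
  and contains a product of open sets, each of positive length. The topology is that of all
  functions on the naturals, whereas the measure lives on the first k coordinates.\<close>

lemma prob_between_pos:
  assumes "L2_set z {..<k} \<noteq> 0" "L2_set z {..<k} < 1" "a < sphere_nf k z" "sphere_nf k z < b"
  shows "0 < measure (uniform_ball k) {y \<in> space (lborel_PiM k). sphere_nf k y \<in> {a<..<b}}"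
proof -
  interpret U: prob_space "uniform_ball k" by (rule prob_space_uniform_ball)
  define W where "W = {y. L2_set y {..<k} \<noteq> 0} \<inter> {y. L2_set y {..<k} < 1}"
  have cL: "continuous_on UNIV (\<lambda>y :: nat \<Rightarrow> real. L2_set y {..<k})"
    by (intro continuous_on_L2_set continuous_on_product_coordinates)
  have openW: "open W"
    unfolding W_def using cL by (intro open_Int open_Collect_neq open_Collect_less continuous_on_const) auto
  have "continuous_on W (sphere_nf k)"
    by (rule continuous_on_sphere_nf[of k W "\<lambda>y. y"])
       (simp_all add: W_def continuous_on_subset[OF continuous_on_product_coordinates])
  then have "open (sphere_nf k -` {a<..<b} \<inter> W)"
    unfolding continuous_on_open_vimage[OF openW] by simp
  then have op: "openin (product_topology (\<lambda>i. euclidean) UNIV) (sphere_nf k -` {a<..<b} \<inter> W)"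
    unfolding open_fun_def .
  have "z \<in> sphere_nf k -` {a<..<b} \<inter> W" using assms by (simp add: W_def)
  from product_topology_open_contains_basis[OF op this]
  obtain X where X: "z \<in> Pi\<^sub>E UNIV X" "\<And>i. open (X i)" "Pi\<^sub>E UNIV X \<subseteq> sphere_nf k -` {a<..<b} \<inter> W"
    unfolding open_openin[symmetric] by blast
  have "Pi\<^sub>E {..<k} X \<subseteq> ball_set k \<inter> {y \<in> space (lborel_PiM k). sphere_nf k y \<in> {a<..<b}}"
  proof
    fix y assume y: "y \<in> Pi\<^sub>E {..<k} X"
    \<comment> \<open>Only the first k factors of the box enter the measure; the other coordinates
      are copied from z.\<close>
    define y' where "y' i = (if i < k then y i else z i)" for i
    have "y' \<in> Pi\<^sub>E UNIV X" using y X(1) by (simp add: y'_def PiE_iff)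
    then have "y' \<in> sphere_nf k -` {a<..<b} \<inter> W" using X(3) by blast
    moreover have "sphere_nf k y' = sphere_nf k y" by (rule sphere_nf_cong) (simp add: y'_def)
    moreover have "L2_set y' {..<k} = L2_set y {..<k}" by (rule L2_set_cong) (simp_all add: y'_def)
    moreover have "y \<in> space (lborel_PiM k)" using y by (simp add: space_PiM PiE_iff)
    ultimately show "y \<in> ball_set k \<inter> {y \<in> space (lborel_PiM k). sphere_nf k y \<in> {a<..<b}}"
      by (simp add: ball_set_def W_def)
  qed
  moreover have sets: "{y \<in> space (lborel_PiM k). sphere_nf k y \<in> {a<..<b}} \<in> sets (lborel_PiM k)"
    by (rule sphere_nf_set_sets) simp
  ultimately have "emeasure (lborel_PiM k) (Pi\<^sub>E {..<k} X)
      \<le> emeasure (lborel_PiM k) (ball_set k \<inter> {y \<in> space (lborel_PiM k). sphere_nf k y \<in> {a<..<b}})"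
    using ball_set_sets by (intro emeasure_mono sets.Int)
  moreover have "emeasure (lborel_PiM k) (Pi\<^sub>E {..<k} X) = (\<Prod>i<k. emeasure lborel (X i))"
    using X(2) by (intro product_sigma_finite.emeasure_PiM[OF product_sigma_finite_lborel]) auto
  moreover have "(\<Prod>i<k. emeasure lborel (X i)) \<noteq> 0"
  proof -
    have "emeasure lborel (X i) \<noteq> 0" for i
    proof -
      have "X i \<noteq> {}" using X(1) by (auto simp: PiE_iff)
      then show ?thesis using emeasure_lborel_open_pos[OF X(2), of i] by simp
    qed
    then show ?thesis by (simp add: prod_zero_iff)
  qed
  ultimately have "emeasure (lborel_PiM k) (ball_set k \<inter> {y \<in> space (lborel_PiM k). sphere_nf k y \<in> {a<..<b}}) \<noteq> 0"
    by (metis le_zero_eq)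
  then have "emeasure (uniform_ball k) {y \<in> space (lborel_PiM k). sphere_nf k y \<in> {a<..<b}} \<noteq> 0"
    unfolding emeasure_uniform_measure[OF ball_set_sets sets] by (simp add: emeasure_ball_set ennreal_divide_eq_0_iff)
  then show ?thesis by (simp add: U.emeasure_eq_measure zero_less_measure_iff)
qed

text \<open>At the origin the projection has an artificial value, which must not influence the
  median.\<close>

lemma null_origin:
  assumes "1 \<le> k"
  shows "measure (uniform_ball k) {y \<in> space (lborel_PiM k). L2_set y {..<k} = 0} = 0"
proof -
  have eq: "{y \<in> space (lborel_PiM k). L2_set y {..<k} = 0} = Pi\<^sub>E {..<k} (\<lambda>_. {0})"
  proof (intro equalityI subsetI)
    fix y assume "y \<in> {y \<in> space (lborel_PiM k). L2_set y {..<k} = 0}"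
    then have "y \<in> extensional {..<k}" "\<forall>i<k. y i = 0" by (simp_all add: space_PiM PiE_def L2_set_eq_0)
    then show "y \<in> Pi\<^sub>E {..<k} (\<lambda>_. {0})" unfolding PiE_iff by simp
  next
    fix y assume "y \<in> Pi\<^sub>E {..<k} (\<lambda>_. {0 :: real})"
    then have "y \<in> extensional {..<k}" "\<forall>i<k. y i = 0" unfolding PiE_iff by simp_all
    then show "y \<in> {y \<in> space (lborel_PiM k). L2_set y {..<k} = 0}"
      by (simp add: space_PiM PiE_iff L2_set_eq_0)
  qed
  have "emeasure (lborel_PiM k) (Pi\<^sub>E {..<k} (\<lambda>_. {0 :: real})) = (\<Prod>i<k. emeasure lborel {0 :: real})"
    by (intro product_sigma_finite.emeasure_PiM[OF product_sigma_finite_lborel]) auto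
  also have "\<dots> = 0" using assms by (simp add: zero_power)
  finally have "Pi\<^sub>E {..<k} (\<lambda>_. {0}) \<in> null_sets (lborel_PiM k)"
    by (rule null_setsI) (rule sets_PiM_I_finite, simp_all)
  then have "ball_set k \<inter> Pi\<^sub>E {..<k} (\<lambda>_. {0}) \<in> null_sets (lborel_PiM k)"
    by (rule null_set_Int1[OF _ ball_set_sets])
  then have "measure (lborel_PiM k) (ball_set k \<inter> Pi\<^sub>E {..<k} (\<lambda>_. {0})) = 0"
    by (simp add: measure_def null_setsD1)
  moreover have "Pi\<^sub>E {..<k} (\<lambda>_. {0 :: real}) \<in> sets (lborel_PiM k)" by (intro sets_PiM_I_finite) auto
  ultimately show ?thesis unfolding eq by (simp add: measure_uniform_ball)
qed

lemma ex_off_origin: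
  assumes "1 \<le> k" "X \<in> sets borel" "1/2 \<le> measure (uniform_ball k) {y \<in> space (lborel_PiM k). sphere_nf k y \<in> X}"
  shows "\<exists>y. sphere_nf k y \<in> X \<and> L2_set y {..<k} \<noteq> 0"
proof (rule ccontr)
  interpret U: prob_space "uniform_ball k" by (rule prob_space_uniform_ball)
  assume "\<nexists>y. sphere_nf k y \<in> X \<and> L2_set y {..<k} \<noteq> 0"
  then have "{y \<in> space (lborel_PiM k). sphere_nf k y \<in> X} \<subseteq> {y \<in> space (lborel_PiM k). L2_set y {..<k} = 0}"
    by blast
  moreover have "{y \<in> space (lborel_PiM k). L2_set y {..<k} = 0} \<in> sets (uniform_ball k)"
    using L2_set_measurable[of k] by simp
  ultimately have "measure (uniform_ball k) {y \<in> space (lborel_PiM k). sphere_nf k y \<in> X}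
      \<le> measure (uniform_ball k) {y \<in> space (lborel_PiM k). L2_set y {..<k} = 0}"
    by (rule U.finite_measure_mono)
  then show False using null_origin[OF assms(1)] assms(3) by simp
qed

text \<open>Two medians a < b put mass at least 1/2 at or below a and at least 1/2 at or above b,
  while a point with value strictly between gives the gap positive mass. Uniqueness is what gives
  the \<open>THE\<close> in \<open>median\<close> its meaning.\<close>

lemma is_median_unique:
  assumes k: "1 \<le> k" "k \<le> n" and M: "is_median k (restr_norm n l k) a" "is_median k (restr_norm n l k) b"
  shows "a = b"
proof -
  interpret U: prob_space "uniform_ball k" by (rule prob_space_uniform_ball)
  have False if ab: "a < b" and a: "is_median k (restr_norm n l k) a" and b: "is_median k (restr_norm n l k) b" for a b
  proof -
    let ?P = "\<lambda>X. measure (uniform_ball k) {y \<in> space (lborel_PiM k). sphere_nf k y \<in> X}"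
    have P: "1/2 \<le> ?P {..a}" "1/2 \<le> ?P {b..}" using a b unfolding is_median_iff[OF k(2)] by simp_all
    obtain y1 y2 where y: "sphere_nf k y1 \<le> a" "L2_set y1 {..<k} \<noteq> 0" "b \<le> sphere_nf k y2" "L2_set y2 {..<k} \<noteq> 0"
      using ex_off_origin[OF k(1) _ P(1)] ex_off_origin[OF k(1) _ P(2)] by auto
    obtain z where "L2_set z {..<k} \<noteq> 0" "L2_set z {..<k} < 1" "a < sphere_nf k z" "sphere_nf k z < b"
      using sphere_nf_between[OF y(1,3) ab y(2,4)] by blast
    then have "0 < ?P {a<..<b}" by (rule prob_between_pos)
    moreover have "?P {..a} + ?P {a<..<b} + ?P {b..} \<le> 1"
    proof -
      have m: "sphere_nf k \<in> borel_measurable (uniform_ball k)" using sphere_nf_measurable by simp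
      define D where "D = distr (uniform_ball k) borel (sphere_nf k)"
      interpret D: prob_space D unfolding D_def using m by (rule U.prob_space_distr)
      have P_D: "?P X = measure D X" if "X \<in> sets borel" for X
        unfolding D_def using that by (simp add: measure_distr[OF m] vimage_def Int_def conj_commute)
      have sets_D: "sets D = sets borel" by (simp add: D_def)
      have "measure D {..a} + measure D {a<..<b} = measure D ({..a} \<union> {a<..<b})"
        by (rule D.finite_measure_Union[symmetric]) (auto simp: sets_D)
      moreover have "measure D ({..a} \<union> {a<..<b}) + measure D {b..} = measure D (({..a} \<union> {a<..<b}) \<union> {b..})"
        using ab by (intro D.finite_measure_Union[symmetric]) (auto simp: sets_D)
      moreover have "measure D (({..a} \<union> {a<..<b}) \<union> {b..}) \<le> 1" by (rule D.prob_le_1)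
      moreover have "?P {..a} = measure D {..a}" by (rule P_D) simp
      moreover have "?P {a<..<b} = measure D {a<..<b}" by (rule P_D) simp
      moreover have "?P {b..} = measure D {b..}" by (rule P_D) simp
      ultimately show ?thesis by linarith
    qed
    ultimately show False using P by linarith
  qed
  from this[of a b] this[of b a] show ?thesis using M by fastforce
qed

lemma is_median_median:
  assumes "1 \<le> k" "k \<le> n"
  shows "is_median k (restr_norm n l k) (median k (restr_norm n l k))"
  unfolding median_def
  by (rule theI') (use ex_is_median[OF assms(2)] is_median_unique[OF assms] in blast)

lemma median_pos:
  assumes "1 \<le> k" "k \<le> n"
  shows "0 < median k (restr_norm n l k)"
proof -
  let ?M = "median k (restr_norm n l k)"
  have "1/2 \<le> measure (uniform_ball k) {y \<in> space (lborel_PiM k). sphere_nf k y \<in> {..?M}}"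
    using is_median_median[OF assms] unfolding is_median_iff[OF assms(2)] by simp
  from ex_off_origin[OF assms(1) _ this] obtain y where
    y: "sphere_nf k y \<le> ?M" "L2_set y {..<k} \<noteq> 0" by auto
  then obtain i where "i < k" "y i \<noteq> 0" by (auto simp: L2_set_eq_0)
  then have "sphere_nf k y \<noteq> 0" using y(2) assms(2) by (auto simp: sphere_nf_def nf_eq_0_iff)
  moreover have "0 \<le> sphere_nf k y" by (simp add: sphere_nf_def nf_nonneg)
  ultimately show ?thesis using y(1) by linarith
qed

section \<open>The median bounds the growth of \<open>phi\<close>\<close>

lemma coord_bound_nonneg: "1 \<le> k \<Longrightarrow> 0 \<le> coord_bound k"
  by (simp add: coord_bound_def)

lemma median_le:
  assumes "1 \<le> k" "k \<le> n"
  shows "median k (restr_norm n l k) \<le> coord_bound k * phi k"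
proof (rule ccontr)
  interpret U: prob_space "uniform_ball k" by (rule prob_space_uniform_ball)
  let ?M = "median k (restr_norm n l k)"
  let ?B = "{y \<in> space (lborel_PiM k). \<exists>i<k. coord_bound k * L2_set y {..<k} < \<bar>y i\<bar>}"
  assume M: "\<not> ?M \<le> coord_bound k * phi k"
  have "{y \<in> space (lborel_PiM k). ?M \<le> sphere_nf k y} \<subseteq> ?B"
  proof (rule subsetI, rule ccontr)
    fix y assume y: "y \<in> {y \<in> space (lborel_PiM k). ?M \<le> sphere_nf k y}" "y \<notin> ?B"
    then have "\<not> (\<exists>i<k. coord_bound k * L2_set y {..<k} < \<bar>y i\<bar>)" by blast
    then have le: "\<bar>y i\<bar> \<le> coord_bound k * L2_set y {..<k}" if "i < k" for i using that by (meson not_less)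
    have "sphere_nf k y \<le> nf (\<lambda>i. coord_bound k * of_bool (i < k))"
      unfolding sphere_nf_def
    proof (rule nf_mono)
      fix i
      have "0 < L2_set y {..<k} \<or> L2_set y {..<k} = 0" using L2_set_nonneg[of y "{..<k}"] by linarith
      then have "\<bar>y i / L2_set y {..<k}\<bar> \<le> coord_bound k" if "i < k"
        using le[OF that] coord_bound_nonneg[OF assms(1)] by (auto simp: abs_divide divide_le_eq)
      then show "\<bar>if i < k then y i / L2_set y {..<k} else 0\<bar> \<le> \<bar>coord_bound k * of_bool (i < k)\<bar>"
        using coord_bound_nonneg[OF assms(1)] by simp
    qed
    also have "\<dots> = coord_bound k * phi k"
      using coord_bound_nonneg[OF assms(1)] by (simp add: nf_scale phi_def)
    finally show False using M y(1) by simp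
  qed
  moreover have "?B \<in> sets (uniform_ball k)"
  proof -
    have "?B = (\<Union>i\<in>{..<k}. {y \<in> space (lborel_PiM k). coord_bound k * L2_set y {..<k} < \<bar>y i\<bar>})" by auto
    also have "\<dots> \<in> sets (lborel_PiM k)"
      using coord_measurable[of _ k] L2_set_measurable[of k] by (intro sets.finite_UN) auto
    finally show ?thesis by simp
  qed
  ultimately have "measure (uniform_ball k) {y \<in> space (lborel_PiM k). ?M \<le> sphere_nf k y} \<le> measure (uniform_ball k) ?B"
    by (rule U.finite_measure_mono)
  then show False
    using prob_large_coord[OF assms(1)] is_median_median[OF assms] unfolding is_median_iff[OF assms(2)] by linarith
qed

text \<open>The witness is the flat unit vector with a equal coordinates. Together with
  \<open>median_le\<close> it turns \<open>mc\<close> in dimension k into a comparison of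
  \<open>phi a\<close> with \<open>phi k\<close>.\<close>

lemma sup_sphere_ge:
  assumes "1 \<le> a" "a \<le> k" "k \<le> n"
  shows "phi a / sqrt (real a) \<le> (SUP x\<in>unit_sphere k. restr_norm n l k x)"
proof -
  let ?x = "vec k (\<lambda>i. of_bool (i < a) / sqrt (real a))"
  \<comment> \<open>A real supremum bounds its members only if the set is bounded above; entries of
    a unit vector have modulus at most 1.\<close>
  have bdd: "bdd_above (restr_norm n l k ` unit_sphere k)"
  proof (rule bdd_aboveI2)
    fix x assume "x \<in> unit_sphere k"
    then have x: "x \<in> carrier_vec k" "L2_set (\<lambda>i. x $ i) {..<k} = 1" by (auto simp: unit_sphere_def)
    have "restr_norm n l k x = nf (\<lambda>i. if i < k then x $ i else 0)" by (simp add: restr_norm_def nf_def)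
    also have "\<dots> \<le> nf (\<lambda>i. 1)"
      using L2_set_ge_abs[of _ k "\<lambda>i. x $ i"] x(2) by (intro nf_mono) auto
    finally show "restr_norm n l k x \<le> nf (\<lambda>i. 1)" .
  qed
  have "(\<Sum>i<k. (of_bool (i < a) / sqrt (real a))\<^sup>2) = (\<Sum>i<k. if i < a then 1 / real a else 0)"
    using assms by (intro sum.cong) (auto simp: power_divide)
  also have "\<dots> = (\<Sum>i\<in>{..<k} \<inter> {i. i < a}. 1 / real a)" by (simp add: sum.If_cases)
  also have "{..<k} \<inter> {i. i < a} = {..<a}" using assms by auto
  finally have "(\<Sum>i<k. (of_bool (i < a) / sqrt (real a))\<^sup>2) = 1" using assms by simp
  then have "L2_set (\<lambda>i. ?x $ i) {..<k} = 1" by (simp add: L2_set_def)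
  then have "?x \<in> unit_sphere k" by (simp add: unit_sphere_def)
  then have "restr_norm n l k ?x \<le> (SUP x\<in>unit_sphere k. restr_norm n l k x)"
    using bdd by (rule cSUP_upper)
  moreover have "restr_norm n l k ?x = nf (\<lambda>i. (1 / sqrt (real a)) * of_bool (i < a))"
    unfolding restr_norm_vec[OF assms(3)] using assms by (intro nf_cong) auto
  moreover have "nf (\<lambda>i. (1 / sqrt (real a)) * of_bool (i < a)) = \<bar>1 / sqrt (real a)\<bar> * nf (\<lambda>i. of_bool (i < a))"
    by (rule nf_scale)
  ultimately show ?thesis by (simp add: phi_def)
qed

lemma mc_nonneg:
  assumes "1 \<le> k" "k \<le> n"
  shows "0 \<le> mc k (restr_norm n l k)"
  using sup_sphere_ge[of 1 k] phi_nonneg[of 1] median_pos[OF assms] assms by (simp add: mc_def)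

lemma mc_le_mmc: "1 \<le> k \<Longrightarrow> k \<le> n \<Longrightarrow> mc k (restr_norm n l k) \<le> mmc n l"
  by (simp add: mmc_def)

lemma mmc_nonneg: "0 \<le> mmc n l"
  using mc_nonneg[of 1] mc_le_mmc[of 1] n_pos by linarith

lemma phi_sqrt_mono:
  assumes "1 \<le> a" "a \<le> k" "k \<le> n"
  shows "phi a * sqrt (real k) \<le> mmc n l * (2 * sqrt (ln (4 * real n + 1))) * phi k * sqrt (real a)"
proof -
  have k: "1 \<le> k" using assms by simp
  let ?M = "median k (restr_norm n l k)"
  have "phi a / sqrt (real a) \<le> (SUP x\<in>unit_sphere k. restr_norm n l k x)" by (rule sup_sphere_ge[OF assms])
  also have "\<dots> = mc k (restr_norm n l k) * ?M"
    using median_pos[OF k assms(3)] by (simp add: mc_def)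
  also have "\<dots> \<le> mmc n l * (coord_bound k * phi k)"
    using mc_le_mmc[OF k assms(3)] median_le[OF k assms(3)] median_pos[OF k assms(3)] mmc_nonneg
    by (intro mult_mono) auto
  finally have *: "phi a / sqrt (real a) \<le> mmc n l * (coord_bound k * phi k)" .
  have "phi a * sqrt (real k) = (phi a / sqrt (real a)) * sqrt (real a) * sqrt (real k)"
    using assms by simp
  also have "\<dots> \<le> (mmc n l * (coord_bound k * phi k)) * sqrt (real a) * sqrt (real k)"
    using * by (intro mult_right_mono) auto
  also have "\<dots> = mmc n l * (2 * sqrt (ln (4 * real k + 1))) * phi k * sqrt (real a)"
    using k by (simp add: coord_bound_def real_sqrt_divide)
  also have "\<dots> \<le> mmc n l * (2 * sqrt (ln (4 * real n + 1))) * phi k * sqrt (real a)"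
    using assms mmc_nonneg phi_nonneg[of k] by (intro mult_right_mono mult_left_mono) auto
  finally show ?thesis .
qed

end

section \<open>Gram-Schmidt and least squares\<close>

definition ip :: "nat \<Rightarrow> (nat \<Rightarrow> real) \<Rightarrow> (nat \<Rightarrow> real) \<Rightarrow> real" where
  "ip m a b = (\<Sum>r<m. a r * b r)"

lemma ip_commute: "ip m a b = ip m b a"
  by (simp add: ip_def mult.commute)

lemma ip_add_left: "ip m (\<lambda>r. a r + b r) c = ip m a c + ip m b c"
  by (simp add: ip_def algebra_simps sum.distrib)

lemma ip_scale_left: "ip m (\<lambda>r. k * a r) c = k * ip m a c"
  by (simp add: ip_def sum_distrib_left mult.assoc)

lemma ip_sum_left: "ip m (\<lambda>r. \<Sum>p\<in>P. a p r) c = (\<Sum>p\<in>P. ip m (a p) c)"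
  unfolding ip_def sum_distrib_right by (rule sum.swap)

lemma ip_sum_right: "ip m c (\<lambda>r. \<Sum>p\<in>P. a p r) = (\<Sum>p\<in>P. ip m c (a p))"
  unfolding ip_commute[of m c] by (rule ip_sum_left)

lemma ip_cong: "(\<And>r. r < m \<Longrightarrow> a r = a' r) \<Longrightarrow> (\<And>r. r < m \<Longrightarrow> b r = b' r) \<Longrightarrow> ip m a b = ip m a' b'"
  by (simp add: ip_def)

lemma ip_self_nonneg: "0 \<le> ip m a a"
  by (simp add: ip_def sum_nonneg)

lemma ip_self_eq_0: "ip m a a = 0 \<longleftrightarrow> (\<forall>r<m. a r = 0)"
  by (auto simp: ip_def sum_nonneg_eq_0_iff)

lemma ip_zero_right: "ip m b b = 0 \<Longrightarrow> ip m a b = 0"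
  unfolding ip_self_eq_0 by (simp add: ip_def)

lemma ip_orthogonal_sum:
  assumes "\<And>p q. p \<in> P \<Longrightarrow> q \<in> P \<Longrightarrow> p \<noteq> q \<Longrightarrow> ip m (a p) (a q) = 0" "finite P"
  shows "ip m (\<lambda>r. \<Sum>p\<in>P. c p * a p r) (\<lambda>r. \<Sum>p\<in>P. c p * a p r) = (\<Sum>p\<in>P. (c p)\<^sup>2 * ip m (a p) (a p))"
proof -
  have "ip m (\<lambda>r. \<Sum>p\<in>P. c p * a p r) (\<lambda>r. \<Sum>p\<in>P. c p * a p r)
      = (\<Sum>p\<in>P. \<Sum>q\<in>P. c p * (c q * ip m (a p) (a q)))"
  proof -
    have "ip m (\<lambda>r. c p * a p r) (\<lambda>r. c q * a q r) = c p * (c q * ip m (a p) (a q))" for p q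
      by (simp add: ip_def sum_distrib_left mult_ac)
    then show ?thesis unfolding ip_sum_left ip_sum_right by simp
  qed
  also have "\<dots> = (\<Sum>p\<in>P. \<Sum>q\<in>P. if q = p then c p * (c p * ip m (a p) (a p)) else 0)"
    using assms(1) by (intro sum.cong) auto
  also have "\<dots> = (\<Sum>p\<in>P. (c p)\<^sup>2 * ip m (a p) (a p))"
    using assms(2) by (simp add: power2_eq_square mult.assoc)
  finally show ?thesis .
qed

text \<open>
  Modified Gram-Schmidt on the columns \<open>0, \<dots>, J\<close>.  Inner products see only the first
  \<open>m\<close> rows.  A zero column contributes nothing, because division by zero yields zero.
\<close>

definition mgs_step :: "nat \<Rightarrow> nat \<Rightarrow> nat \<Rightarrow> (nat \<Rightarrow> nat \<Rightarrow> real) \<Rightarrow> (nat \<Rightarrow> nat \<Rightarrow> real)" where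
  "mgs_step m j i G = G(j := (\<lambda>r. G j r - ip m (G j) (G i) / ip m (G i) (G i) * G i r))"

primrec mgs_col :: "nat \<Rightarrow> nat \<Rightarrow> nat \<Rightarrow> (nat \<Rightarrow> nat \<Rightarrow> real) \<Rightarrow> (nat \<Rightarrow> nat \<Rightarrow> real)" where
  "mgs_col m j 0 G = G"
| "mgs_col m j (Suc i) G = mgs_step m j i (mgs_col m j i G)"

primrec mgs :: "nat \<Rightarrow> nat \<Rightarrow> (nat \<Rightarrow> nat \<Rightarrow> real) \<Rightarrow> (nat \<Rightarrow> nat \<Rightarrow> real)" where
  "mgs m 0 G = G"
| "mgs m (Suc j) G = mgs_col m j j (mgs m j G)"

lemma mgs_col_other: "k \<noteq> j \<Longrightarrow> mgs_col m j i G k = G k"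
  by (induction i) (simp_all add: mgs_step_def)

lemma mgs_other: "j \<le> k \<Longrightarrow> mgs m j G k = G k"
  by (induction j) (simp_all add: mgs_col_other)

text \<open>The expansion is claimed at every row r, although orthogonality concerns the first m
  rows only. The rows from m on are carried along and later record the coefficients.\<close>

lemma mgs_col_self:
  assumes "i \<le> j" "\<And>p q. p < i \<Longrightarrow> q < i \<Longrightarrow> p \<noteq> q \<Longrightarrow> ip m (G p) (G q) = 0"
  shows "(\<exists>\<alpha>. \<forall>r. mgs_col m j i G j r = G j r - (\<Sum>p<i. \<alpha> p * G p r)) \<and>
    (\<forall>p<i. ip m (mgs_col m j i G j) (G p) = 0)"
  using assms
proof (induction i)
  case (Suc i)
  let ?c = "mgs_col m j i G j"
  obtain \<alpha> where \<alpha>: "\<And>r. ?c r = G j r - (\<Sum>p<i. \<alpha> p * G p r)" and orth: "\<And>p. p < i \<Longrightarrow> ip m ?c (G p) = 0"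
    using Suc by auto
  define \<beta> where "\<beta> = ip m ?c (G i) / ip m (G i) (G i)"
  have Gi: "mgs_col m j i G i = G i" using Suc.prems by (intro mgs_col_other) simp
  have new: "mgs_col m j (Suc i) G j = (\<lambda>r. ?c r + (- \<beta>) * G i r)"
    by (simp add: mgs_step_def Gi \<beta>_def)
  have "ip m (mgs_col m j (Suc i) G j) (G p) = 0" if p: "p < Suc i" for p
  proof -
    have eq: "ip m (mgs_col m j (Suc i) G j) (G p) = ip m ?c (G p) - \<beta> * ip m (G i) (G p)"
      unfolding new ip_add_left ip_scale_left by simp
    show ?thesis
    proof (cases "p = i")
      case True
      \<comment> \<open>If column i has norm zero, the quotient is 0, but every inner product with
        that column vanishes as well.\<close>
      then show ?thesis unfolding eq \<beta>_def using ip_zero_right[of m "G i" ?c]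
        by (cases "ip m (G i) (G i) = 0") auto
    next
      case False
      then show ?thesis unfolding eq using orth[of p] p Suc.prems(2)[of i p] by simp
    qed
  qed
  moreover have "\<forall>r. mgs_col m j (Suc i) G j r = G j r - (\<Sum>p<Suc i. (\<alpha>(i := \<beta>)) p * G p r)"
    unfolding new \<alpha> by simp
  ultimately show ?case by blast
qed simp

lemma mgs_orthogonal_expansion:
  "(\<forall>p<J. \<forall>q<J. p \<noteq> q \<longrightarrow> ip m (mgs m J G p) (mgs m J G q) = 0) \<and>
   (\<forall>j<J. \<exists>\<alpha>. \<forall>r. mgs m J G j r = G j r - (\<Sum>p<j. \<alpha> p * mgs m J G p r))"
proof (induction J)
  case (Suc J)
  let ?Q = "mgs m J G" and ?Q' = "mgs m (Suc J) G"
  have orth: "ip m (?Q p) (?Q q) = 0" if "p < J" "q < J" "p \<noteq> q" for p q using Suc that by blast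
  have same: "?Q' p = ?Q p" if "p < J" for p using that by (simp add: mgs_col_other)
  from mgs_col_self[of J J m ?Q] orth obtain \<alpha>
    where \<alpha>: "\<And>r. ?Q' J r = ?Q J r - (\<Sum>p<J. \<alpha> p * ?Q p r)" and o': "\<And>p. p < J \<Longrightarrow> ip m (?Q' J) (?Q p) = 0"
    by auto
  have "\<exists>\<alpha>. \<forall>r. ?Q' j r = G j r - (\<Sum>p<j. \<alpha> p * ?Q' p r)" if j: "j < Suc J" for j
  proof (cases "j = J")
    case True
    have "?Q' J r = G J r - (\<Sum>p<J. \<alpha> p * ?Q' p r)" for r
      unfolding \<alpha> using same by (simp add: mgs_other)
    then show ?thesis using True by blast
  next
    case False
    then have jJ: "j < J" using j by simp
    then obtain \<beta> where "\<And>r. ?Q j r = G j r - (\<Sum>p<j. \<beta> p * ?Q p r)" using Suc by blast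
    then have "?Q' j r = G j r - (\<Sum>p<j. \<beta> p * ?Q' p r)" for r using same jJ by simp
    then show ?thesis by blast
  qed
  moreover have "ip m (?Q' p) (?Q' q) = 0" if pq: "p < Suc J" "q < Suc J" "p \<noteq> q" for p q
  proof -
    consider "p < J" "q < J" | "p = J" "q < J" | "p < J" "q = J" using pq by linarith
    then show ?thesis
    proof cases
      case 1 then show ?thesis unfolding same[OF 1(1)] same[OF 1(2)] using orth pq(3) by blast
    next
      case 2 then show ?thesis using o' same by simp
    next
      case 3 then show ?thesis using o'[of p] same[of p] by (simp add: ip_commute)
    qed
  qed
  ultimately show ?case by blast
qed simp

lemma mgs_span:
  "J \<le> K \<Longrightarrow> \<exists>c. \<forall>r. (\<Sum>j<J. y j * G j r) = (\<Sum>p<J. c p * mgs m K G p r)"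
proof (induction J)
  case (Suc J)
  let ?Q = "mgs m K G"
  obtain c where c: "\<And>r. (\<Sum>j<J. y j * G j r) = (\<Sum>p<J. c p * ?Q p r)" using Suc by auto
  obtain \<alpha> where \<alpha>: "\<And>r. ?Q J r = G J r - (\<Sum>p<J. \<alpha> p * ?Q p r)"
    using mgs_orthogonal_expansion[of K m G] Suc.prems by (auto simp: Suc_le_eq)
  have "(\<Sum>j<Suc J. y j * G j r) = (\<Sum>p<Suc J. (if p = J then y J else c p + y J * \<alpha> p) * ?Q p r)" for r
  proof -
    have "G J r = ?Q J r + (\<Sum>p<J. \<alpha> p * ?Q p r)" using \<alpha>[of r] by simp
    then show ?thesis by (simp add: c algebra_simps sum.distrib sum_distrib_left)
  qed
  then show ?case by (intro exI[of _ "\<lambda>p. if p = J then y J else c p + y J * \<alpha> p"] allI)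
qed simp

text \<open>Again at all rows: if an identity block sits below row m, the last column shows the
  negated coefficients y there, so no triangular system has to be solved.\<close>

lemma mgs_col_span:
  "J < K \<Longrightarrow> \<exists>y. \<forall>r. mgs m K G J r = G J r - (\<Sum>j<J. y j * G j r)"
proof (induction J rule: less_induct)
  case (less J)
  let ?Q = "mgs m K G"
  obtain \<alpha> where \<alpha>: "\<And>r. ?Q J r = G J r - (\<Sum>p<J. \<alpha> p * ?Q p r)"
    using mgs_orthogonal_expansion[of K m G] less.prems by auto
  have "\<exists>y. \<forall>r. ?Q p r = (\<Sum>j<J. y j * G j r)" if p: "p < J" for p
  proof -
    obtain y where y: "\<And>r. ?Q p r = G p r - (\<Sum>j<p. y j * G j r)" using less p by fastforce
    define z where "z j = (if j = p then 1 else if j < p then - y j else 0)" for j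
    have "(\<Sum>j<J. z j * G j r) = (\<Sum>j<Suc p. z j * G j r)" for r
      using p by (intro sum.mono_neutral_right) (auto simp: z_def)
    also have "(\<Sum>j<Suc p. z j * G j r) = ?Q p r" for r by (simp add: y z_def sum_negf)
    finally show ?thesis by metis
  qed
  then obtain Y where Y: "\<And>p r. p < J \<Longrightarrow> ?Q p r = (\<Sum>j<J. Y p j * G j r)" by metis
  have "?Q J r = G J r - (\<Sum>j<J. (\<Sum>p<J. \<alpha> p * Y p j) * G j r)" for r
  proof -
    have "(\<Sum>p<J. \<alpha> p * ?Q p r) = (\<Sum>p<J. \<Sum>j<J. \<alpha> p * Y p j * G j r)"
      by (simp add: Y sum_distrib_left mult.assoc)
    also have "\<dots> = (\<Sum>j<J. \<Sum>p<J. \<alpha> p * Y p j * G j r)" by (rule sum.swap)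
    also have "\<dots> = (\<Sum>j<J. (\<Sum>p<J. \<alpha> p * Y p j) * G j r)" by (simp add: sum_distrib_right)
    finally show ?thesis using \<alpha>[of r] by simp
  qed
  then show ?case by (intro exI[of _ "\<lambda>j. \<Sum>p<J. \<alpha> p * Y p j"] allI)
qed

text \<open>Any residual expands in the orthogonal columns with coefficient 1 at the last one, so by
  Pythagoras it is at least as long as the last column.\<close>

lemma mgs_residual_minimal:
  "ip m (mgs m (Suc J) G J) (mgs m (Suc J) G J)
    \<le> ip m (\<lambda>r. G J r - (\<Sum>j<J. x j * G j r)) (\<lambda>r. G J r - (\<Sum>j<J. x j * G j r))"
proof -
  let ?Q = "mgs m (Suc J) G"
  have orth: "\<And>p q. p < Suc J \<Longrightarrow> q < Suc J \<Longrightarrow> p \<noteq> q \<Longrightarrow> ip m (?Q p) (?Q q) = 0"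
    and ex: "\<exists>\<alpha>. \<forall>r. ?Q J r = G J r - (\<Sum>p<J. \<alpha> p * ?Q p r)"
    using mgs_orthogonal_expansion[of "Suc J" m G] by blast+
  obtain \<alpha> where \<alpha>: "\<And>r. ?Q J r = G J r - (\<Sum>p<J. \<alpha> p * ?Q p r)" using ex by blast
  obtain c where c: "\<And>r. (\<Sum>j<J. x j * G j r) = (\<Sum>p<J. c p * ?Q p r)"
    using mgs_span[of J "Suc J" x G m] by auto
  define e where "e p = (if p = J then 1 else \<alpha> p - c p)" for p
  have eq: "(\<lambda>r. G J r - (\<Sum>j<J. x j * G j r)) = (\<lambda>r. \<Sum>p<Suc J. e p * ?Q p r)"
    using \<alpha> by (auto simp: fun_eq_iff c e_def algebra_simps sum_subtractf)
  have "ip m (?Q J) (?Q J) = (e J)\<^sup>2 * ip m (?Q J) (?Q J)" by (simp add: e_def)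
  also have "\<dots> \<le> (\<Sum>p<Suc J. (e p)\<^sup>2 * ip m (?Q p) (?Q p))"
    by (rule member_le_sum) (simp_all add: ip_self_nonneg)
  also have "\<dots> = ip m (\<lambda>r. \<Sum>p<Suc J. e p * ?Q p r) (\<lambda>r. \<Sum>p<Suc J. e p * ?Q p r)"
    using orth by (intro ip_orthogonal_sum[symmetric]) auto
  finally show ?thesis unfolding eq .
qed

text \<open>Linearly dependent columns leave zero vectors, hence norms in {0, 1}; forcing their
  coefficients to 0 keeps Parseval's identity exact.\<close>

lemma ex_orthonormal:
  fixes G :: "nat \<Rightarrow> nat \<Rightarrow> real"
  shows "\<exists>q. (\<forall>p<J. \<forall>p'<J. p \<noteq> p' \<longrightarrow> ip m (q p) (q p') = 0) \<and> (\<forall>p<J. ip m (q p) (q p) \<in> {0, 1}) \<and>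
    (\<forall>y. \<exists>c. (\<forall>p<J. ip m (q p) (q p) = 0 \<longrightarrow> c p = 0) \<and> (\<forall>r<m. (\<Sum>j<J. y j * G j r) = (\<Sum>p<J. c p * q p r)))"
proof -
  let ?Q = "mgs m J G"
  let ?s = "\<lambda>p. sqrt (ip m (?Q p) (?Q p))"
  define q where "q p r = (1 / ?s p) * ?Q p r" for p r
  have ipq: "ip m (q p) (q p') = (1 / ?s p) * ((1 / ?s p') * ip m (?Q p) (?Q p'))" for p p'
    unfolding q_def ip_scale_left by (subst ip_commute, subst ip_scale_left) (simp add: ip_commute)
  have one: "ip m (q p) (q p) = (if ip m (?Q p) (?Q p) = 0 then 0 else 1)" for p
    unfolding ipq using ip_self_nonneg[of m "?Q p"]
    by (simp add: real_sqrt_mult_self[symmetric] mult.assoc[symmetric] real_div_sqrt field_simps)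
  have "\<exists>c. (\<forall>p<J. ip m (q p) (q p) = 0 \<longrightarrow> c p = 0) \<and> (\<forall>r<m. (\<Sum>j<J. y j * G j r) = (\<Sum>p<J. c p * q p r))" for y
  proof -
    obtain c where c: "\<And>r. (\<Sum>j<J. y j * G j r) = (\<Sum>p<J. c p * ?Q p r)"
      using mgs_span[of J J y G m] by auto
    have "c p * ?Q p r = (c p * ?s p) * q p r" if "r < m" for p r
    proof (cases "ip m (?Q p) (?Q p) = 0")
      case True
      then have "?Q p r = 0" using that by (simp add: ip_self_eq_0)
      then show ?thesis by (simp add: q_def)
    qed (simp add: q_def)
    then have "\<forall>r<m. (\<Sum>j<J. y j * G j r) = (\<Sum>p<J. (c p * ?s p) * q p r)"
      unfolding c by (intro allI impI sum.cong refl) blast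
    moreover have "\<forall>p<J. ip m (q p) (q p) = 0 \<longrightarrow> c p * ?s p = 0" by (simp add: one)
    ultimately show ?thesis by (intro exI[of _ "\<lambda>p. c p * ?s p"]) blast
  qed
  moreover have "\<forall>p<J. \<forall>p'<J. p \<noteq> p' \<longrightarrow> ip m (q p) (q p') = 0"
    using mgs_orthogonal_expansion[of J m G] by (simp add: ipq)
  ultimately show ?thesis using one by (intro exI[of _ q]) auto
qed

section \<open>CountSketch\<close>

text \<open>Expectation over N independent uniform numbers below M, as a plain finite sum. The
  probability estimates for weights and sketch are made in this form; \<open>prob_draws\<close>
  transfers them to coin tosses.\<close>

definition avg :: "nat \<Rightarrow> nat \<Rightarrow> ((nat \<Rightarrow> nat) \<Rightarrow> real) \<Rightarrow> real" where
  "avg M N F = (\<Sum>g\<in>Pi\<^sub>E {..<N} (\<lambda>_. {..<M}). F g) / real M ^ N"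

lemma finite_maps: "finite (Pi\<^sub>E {..<N} (\<lambda>_. {..<M :: nat}))" for N :: nat
  by (intro finite_PiE) auto

lemma avg_cong:
  "(\<And>g. g \<in> Pi\<^sub>E {..<N} (\<lambda>_. {..<M}) \<Longrightarrow> F g = F' g) \<Longrightarrow> avg M N F = avg M N F'"
  by (simp add: avg_def)

lemma avg_mono:
  "(\<And>g. g \<in> Pi\<^sub>E {..<N} (\<lambda>_. {..<M}) \<Longrightarrow> F g \<le> F' g) \<Longrightarrow> avg M N F \<le> avg M N F'"
  unfolding avg_def by (intro divide_right_mono sum_mono) auto

lemma avg_add: "avg M N (\<lambda>g. F g + F' g) = avg M N F + avg M N F'"
  by (simp add: avg_def sum.distrib add_divide_distrib)

lemma avg_cmult: "avg M N (\<lambda>g. c * F g) = c * avg M N F"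
  by (simp add: avg_def sum_distrib_left[symmetric])

lemma avg_sum: "avg M N (\<lambda>g. \<Sum>a\<in>A. F a g) = (\<Sum>a\<in>A. avg M N (F a))"
  unfolding avg_def by (subst sum.swap) (simp add: sum_divide_distrib)

lemma avg_const: "0 < M \<Longrightarrow> avg M N (\<lambda>_. c) = c"
  by (simp add: avg_def card_PiE)

lemma avg_0: "avg M 0 F = F (\<lambda>_. undefined)"
  by (simp add: avg_def)

text \<open>Conditioning on all draws but the last, the form that inductions over the rows
  use.\<close>

lemma avg_Suc:
  "avg M (Suc N) F = avg M N (\<lambda>g. (\<Sum>x<M. F (g(N := x))) / real M)"
proof -
  have "Pi\<^sub>E {..<Suc N} (\<lambda>_. {..<M}) = (\<lambda>(y, g). g(N := y)) ` ({..<M} \<times> Pi\<^sub>E {..<N} (\<lambda>_. {..<M}))"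
    using PiE_insert_eq[of N "{..<N}" "\<lambda>_. {..<M}"] by (simp add: lessThan_Suc)
  then have "(\<Sum>g\<in>Pi\<^sub>E {..<Suc N} (\<lambda>_. {..<M}). F g) = (\<Sum>(y, g)\<in>{..<M} \<times> Pi\<^sub>E {..<N} (\<lambda>_. {..<M}). F (g(N := y)))"
    using inj_combinator[of N "{..<N}" "\<lambda>_. {..<M}"] by (simp add: sum.reindex case_prod_unfold)
  also have "\<dots> = (\<Sum>y<M. \<Sum>g\<in>Pi\<^sub>E {..<N} (\<lambda>_. {..<M}). F (g(N := y)))"
    by (rule sum.cartesian_product[symmetric])
  also have "\<dots> = (\<Sum>g\<in>Pi\<^sub>E {..<N} (\<lambda>_. {..<M}). \<Sum>y<M. F (g(N := y)))" by (rule sum.swap)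
  finally show ?thesis by (simp add: avg_def sum_divide_distrib[symmetric])
qed

lemma avg_prod: "avg M N (\<lambda>g. \<Prod>i<N. f i (g i)) = (\<Prod>i<N. (\<Sum>x<M. f i x) / real M)"
  unfolding avg_def by (subst prod_sum_PiE[symmetric]) (simp_all add: prod_dividef)

lemma avg_marginal:
  assumes "i < N" "0 < M"
  shows "avg M N (\<lambda>g. f (g i)) = (\<Sum>x<M. f x) / real M"
proof -
  let ?f = "\<lambda>j x. if j = i then f x else 1"
  have "(\<Prod>j<N. ?f j (g j)) = f (g i)" for g :: "nat \<Rightarrow> nat" using assms(1) by simp
  then have "avg M N (\<lambda>g. f (g i)) = avg M N (\<lambda>g. \<Prod>j<N. ?f j (g j))" by simp
  also have "\<dots> = (\<Prod>j<N. (\<Sum>x<M. ?f j x) / real M)" by (rule avg_prod)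
  also have "\<dots> = (\<Prod>j<N. if j = i then (\<Sum>x<M. f x) / real M else 1)"
    using assms(2) by (intro prod.cong) auto
  also have "\<dots> = (\<Sum>x<M. f x) / real M" using assms(1) by simp
  finally show ?thesis .
qed

abbreviation pr :: "nat \<Rightarrow> nat \<Rightarrow> ((nat \<Rightarrow> nat) \<Rightarrow> bool) \<Rightarrow> real" where
  "pr M N P \<equiv> avg M N (\<lambda>g. of_bool (P g))"

lemma pr_Un: "pr M N (\<lambda>g. P g \<or> Q g) \<le> pr M N P + pr M N Q"
  unfolding avg_add[symmetric] by (rule avg_mono) auto

lemma pr_Ex: "finite A \<Longrightarrow> pr M N (\<lambda>g. \<exists>a\<in>A. P a g) \<le> (\<Sum>a\<in>A. pr M N (P a))"
  unfolding avg_sum[symmetric]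
proof (rule avg_mono)
  fix g assume A: "finite A"
  show "of_bool (\<exists>a\<in>A. P a g) \<le> (\<Sum>a\<in>A. of_bool (P a g) :: real)"
  proof (cases "\<exists>a\<in>A. P a g")
    case True
    then obtain a where a: "a \<in> A" "P a g" by blast
    have "of_bool (P a g) \<le> (\<Sum>a\<in>A. of_bool (P a g) :: real)" using a A by (intro member_le_sum) auto
    then show ?thesis using a by auto
  qed (simp add: sum_nonneg)
qed

lemma pr_Markov:
  assumes "0 < a" "\<And>g. g \<in> Pi\<^sub>E {..<N} (\<lambda>_. {..<M}) \<Longrightarrow> 0 \<le> F g"
  shows "pr M N (\<lambda>g. a < F g) \<le> avg M N F / a"
proof -
  have "pr M N (\<lambda>g. a < F g) \<le> avg M N (\<lambda>g. (1 / a) * F g)"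
  proof (rule avg_mono)
    fix g assume "g \<in> Pi\<^sub>E {..<N} (\<lambda>_. {..<M})"
    then show "of_bool (a < F g) \<le> (1 / a) * F g" using assms by (auto simp: field_simps)
  qed
  then show ?thesis unfolding avg_cmult by simp
qed

text \<open>
  CountSketch: row \<open>i\<close> is added with a sign to one of \<open>m\<close> buckets; both are encoded
  in the number \<open>g i < 2 * m\<close>.
\<close>

definition bucket :: "nat \<Rightarrow> nat \<Rightarrow> nat" where
  "bucket m x = (if x < m then x else x - m)"

definition sig :: "nat \<Rightarrow> nat \<Rightarrow> real" where
  "sig m x = (if x < m then 1 else -1)"

definition sketch :: "nat \<Rightarrow> nat \<Rightarrow> (nat \<Rightarrow> nat) \<Rightarrow> (nat \<Rightarrow> real) \<Rightarrow> nat \<Rightarrow> real" where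
  "sketch m N g a c = (\<Sum>i<N. if bucket m (g i) = c then sig m (g i) * a i else 0)"

lemma sum_sig_bucket:
  fixes F :: "real \<Rightarrow> nat \<Rightarrow> real"
  shows "(\<Sum>x<2 * m. F (sig m x) (bucket m x)) = (\<Sum>h<m. F 1 h + F (-1) h)"
proof -
  have "(\<Sum>x<2 * m. F (sig m x) (bucket m x))
      = (\<Sum>x<m. F (sig m x) (bucket m x)) + (\<Sum>x=m..<2 * m. F (sig m x) (bucket m x))"
    using sum.atLeastLessThan_concat[of 0 m "2 * m" "\<lambda>x. F (sig m x) (bucket m x)"]
    by (simp add: atLeast0LessThan)
  also have "(\<Sum>x=m..<2 * m. F (sig m x) (bucket m x)) = (\<Sum>h<m. F (-1) h)"
    using sum.shift_bounds_nat_ivl[of "\<lambda>x. F (sig m x) (bucket m x)" 0 m m]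
    by (simp add: mult_2 atLeast0LessThan sig_def bucket_def)
  also have "(\<Sum>x<m. F (sig m x) (bucket m x)) = (\<Sum>h<m. F 1 h)"
    by (rule sum.cong) (simp_all add: sig_def bucket_def)
  finally show ?thesis by (simp add: sum.distrib)
qed

lemma sketch_Suc_upd:
  "sketch m (Suc N) (g(N := x)) a c = sketch m N g a c + (if bucket m x = c then sig m x * a N else 0)"
proof -
  have "(\<Sum>i<N. if bucket m ((g(N := x)) i) = c then sig m ((g(N := x)) i) * a i else 0)
      = (\<Sum>i<N. if bucket m (g i) = c then sig m (g i) * a i else 0)"
    by (intro sum.cong) auto
  then show ?thesis by (simp add: sketch_def)
qed

lemma bucket_less: "x < 2 * m \<Longrightarrow> bucket m x < m"
  by (auto simp: bucket_def)

section \<open>Error of sketched inner products\<close>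

definition sketch_err :: "nat \<Rightarrow> nat \<Rightarrow> (nat \<Rightarrow> real) \<Rightarrow> (nat \<Rightarrow> real) \<Rightarrow> (nat \<Rightarrow> nat) \<Rightarrow> real" where
  "sketch_err m N a b g = ip m (sketch m N g a) (sketch m N g b) - ip N a b"

text \<open>The new row's own contribution a N * b N carries a squared sign 1 and is cancelled by
  the exact inner product, so only a term linear in the sign remains.\<close>

lemma sketch_err_Suc:
  assumes "x < 2 * m"
  shows "sketch_err m (Suc N) a b (g(N := x)) = sketch_err m N a b g
    + sig m x * (a N * sketch m N g b (bucket m x) + b N * sketch m N g a (bucket m x))"
proof -
  let ?h = "bucket m x" and ?s = "sig m x"
  have h: "?h < m" using assms by (rule bucket_less)
  have ss: "?s * ?s = 1" by (simp add: sig_def)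
  have "ip m (sketch m (Suc N) (g(N := x)) a) (sketch m (Suc N) (g(N := x)) b)
      = (\<Sum>c<m. sketch m N g a c * sketch m N g b c
          + (if c = ?h then ?s * (a N * sketch m N g b ?h + b N * sketch m N g a ?h) + (?s * ?s) * (a N * b N) else 0))"
    unfolding ip_def sketch_Suc_upd by (intro sum.cong) (auto simp: algebra_simps)
  also have "\<dots> = ip m (sketch m N g a) (sketch m N g b)
      + (?s * (a N * sketch m N g b ?h + b N * sketch m N g a ?h) + (?s * ?s) * (a N * b N))"
    using h unfolding sum.distrib ip_def by simp
  finally show ?thesis unfolding ss sketch_err_def by (simp add: ip_def)
qed

lemma avg_sketch_err: "avg (2 * m) N (sketch_err m N a b) = 0"
proof (induction N)
  case 0
  then show ?case by (simp add: avg_0 sketch_err_def ip_def sketch_def)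
next
  case (Suc N)
  have "(\<Sum>x<2 * m. sketch_err m (Suc N) a b (g(N := x))) = 2 * real m * sketch_err m N a b g" for g
  proof -
    let ?D = "\<lambda>h. a N * sketch m N g b h + b N * sketch m N g a h"
    have "(\<Sum>x<2 * m. sketch_err m (Suc N) a b (g(N := x)))
        = (\<Sum>x<2 * m. sketch_err m N a b g + sig m x * ?D (bucket m x))"
      by (intro sum.cong) (simp_all add: sketch_err_Suc)
    also have "\<dots> = 2 * real m * sketch_err m N a b g"
      using sum_sig_bucket[of "\<lambda>s h. s * ?D h" m] by (simp add: sum.distrib)
    finally show ?thesis .
  qed
  then have "avg (2 * m) (Suc N) (sketch_err m (Suc N) a b) = avg (2 * m) N (\<lambda>g. (2 * real m / (2 * real m)) * sketch_err m N a b g)"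
    unfolding avg_Suc by simp
  then show ?case unfolding avg_cmult Suc by simp
qed

lemma avg_sketch_norm: "0 < m \<Longrightarrow> avg (2 * m) N (\<lambda>g. ip m (sketch m N g a) (sketch m N g a)) = ip N a a"
proof -
  assume m: "0 < m"
  have "avg (2 * m) N (\<lambda>g. ip m (sketch m N g a) (sketch m N g a)) = avg (2 * m) N (\<lambda>g. sketch_err m N a a g + ip N a a)"
    by (simp add: sketch_err_def)
  also have "\<dots> = ip N a a" unfolding avg_add using m by (simp add: avg_sketch_err avg_const)
  finally show ?thesis .
qed

text \<open>Revealing the rows one at a time, the sign of the newest row kills the cross term.\<close>

lemma avg_sketch_err_sq:
  assumes m: "0 < m"
  shows "avg (2 * m) N (\<lambda>g. (sketch_err m N a b g)\<^sup>2) \<le> 2 / real m * (ip N a a * ip N b b)"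
proof (induction N)
  case 0
  then show ?case by (simp add: avg_0 sketch_err_def ip_def sketch_def)
next
  case (Suc N)
  let ?A = "ip N a a" and ?B = "ip N b b"
  let ?na = "\<lambda>g. ip m (sketch m N g a) (sketch m N g a)" and ?nb = "\<lambda>g. ip m (sketch m N g b) (sketch m N g b)"
  have step: "(\<Sum>x<2 * m. (sketch_err m (Suc N) a b (g(N := x)))\<^sup>2) / real (2 * m)
      \<le> (sketch_err m N a b g)\<^sup>2 + ((2 / real m * (a N)\<^sup>2) * ?nb g + (2 / real m * (b N)\<^sup>2) * ?na g)" for g
  proof -
    let ?D = "\<lambda>h. a N * sketch m N g b h + b N * sketch m N g a h"
    let ?E = "sketch_err m N a b g"
    have "(\<Sum>x<2 * m. (sketch_err m (Suc N) a b (g(N := x)))\<^sup>2) = (\<Sum>x<2 * m. (?E + sig m x * ?D (bucket m x))\<^sup>2)"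
      by (intro sum.cong) (simp_all add: sketch_err_Suc)
    also have "\<dots> = (\<Sum>h<m. (?E + 1 * ?D h)\<^sup>2 + (?E + (-1) * ?D h)\<^sup>2)"
      by (rule sum_sig_bucket)
    also have "\<dots> = (\<Sum>h<m. 2 * ?E\<^sup>2 + 2 * (?D h)\<^sup>2)"
      by (intro sum.cong) (simp_all add: power2_eq_square algebra_simps)
    also have "\<dots> \<le> (\<Sum>h<m. 2 * ?E\<^sup>2 + 4 * ((a N)\<^sup>2 * (sketch m N g b h * sketch m N g b h)
        + (b N)\<^sup>2 * (sketch m N g a h * sketch m N g a h)))"
    proof (intro sum_mono add_left_mono)
      fix h
      have "0 \<le> (a N * sketch m N g b h - b N * sketch m N g a h)\<^sup>2" by simp
      then show "2 * (?D h)\<^sup>2 \<le> 4 * ((a N)\<^sup>2 * (sketch m N g b h * sketch m N g b h)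
        + (b N)\<^sup>2 * (sketch m N g a h * sketch m N g a h))"
        by (simp add: power2_eq_square algebra_simps)
    qed
    also have "\<dots> = 2 * real m * ?E\<^sup>2 + 4 * ((a N)\<^sup>2 * ?nb g + (b N)\<^sup>2 * ?na g)"
      by (simp add: ip_def sum.distrib sum_distrib_left algebra_simps)
    finally show ?thesis using m by (simp add: field_simps)
  qed
  have "avg (2 * m) (Suc N) (\<lambda>g. (sketch_err m (Suc N) a b g)\<^sup>2)
      \<le> avg (2 * m) N (\<lambda>g. (sketch_err m N a b g)\<^sup>2 + ((2 / real m * (a N)\<^sup>2) * ?nb g + (2 / real m * (b N)\<^sup>2) * ?na g))"
    unfolding avg_Suc by (rule avg_mono) (rule step)
  also have "\<dots> = avg (2 * m) N (\<lambda>g. (sketch_err m N a b g)\<^sup>2) + ((2 / real m * (a N)\<^sup>2) * ?B + (2 / real m * (b N)\<^sup>2) * ?A)"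
    unfolding avg_add avg_cmult avg_sketch_norm[OF m] ..
  also have "\<dots> \<le> 2 / real m * (?A * ?B) + ((2 / real m * (a N)\<^sup>2) * ?B + (2 / real m * (b N)\<^sup>2) * ?A)"
    using Suc by simp
  \<comment> \<open>The induction closes because the claim is a product: adding a ^ 2 * b ^ 2 as
    slack completes (A + a ^ 2) * (B + b ^ 2).\<close>
  also have "\<dots> \<le> 2 / real m * (?A * ?B + (a N)\<^sup>2 * ?B + (b N)\<^sup>2 * ?A + (a N)\<^sup>2 * (b N)\<^sup>2)"
    by (simp add: algebra_simps)
  also have "?A * ?B + (a N)\<^sup>2 * ?B + (b N)\<^sup>2 * ?A + (a N)\<^sup>2 * (b N)\<^sup>2 = ip (Suc N) a a * ip (Suc N) b b"
    by (simp add: ip_def power2_eq_square algebra_simps)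
  finally show ?case .
qed

lemma sketch_lincomb:
  "sketch m N g (\<lambda>r. \<Sum>p\<in>P. c p * q p r) = (\<lambda>h. \<Sum>p\<in>P. c p * sketch m N g (q p) h)"
proof
  fix h
  have "sketch m N g (\<lambda>r. \<Sum>p\<in>P. c p * q p r) h
      = (\<Sum>i<N. \<Sum>p\<in>P. c p * (if bucket m (g i) = h then sig m (g i) * q p i else 0))"
    unfolding sketch_def by (intro sum.cong) (auto simp: sum_distrib_left mult_ac)
  also have "\<dots> = (\<Sum>p\<in>P. \<Sum>i<N. c p * (if bucket m (g i) = h then sig m (g i) * q p i else 0))"
    by (rule sum.swap)
  finally show "sketch m N g (\<lambda>r. \<Sum>p\<in>P. c p * q p r) h = (\<Sum>p\<in>P. c p * sketch m N g (q p) h)"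
    by (simp add: sketch_def sum_distrib_left)
qed

lemma sketch_cong: "(\<And>i. i < N \<Longrightarrow> a i = b i) \<Longrightarrow> sketch m N g a = sketch m N g b"
  unfolding sketch_def by (intro ext sum.cong) auto

lemma ip_lincomb:
  "ip m (\<lambda>r. \<Sum>p\<in>P. c p * u p r) (\<lambda>r. \<Sum>p\<in>P. c p * u p r) = (\<Sum>p\<in>P. \<Sum>p'\<in>P. c p * c p' * ip m (u p) (u p'))"
proof -
  have "ip m (\<lambda>r. c p * u p r) (\<lambda>r. c p' * u p' r) = c p * c p' * ip m (u p) (u p')" for p p'
    by (simp add: ip_def sum_distrib_left mult_ac)
  then show ?thesis unfolding ip_sum_left ip_sum_right by simp
qed

text \<open>In an orthonormal basis of the span, the distortion of u is a quadratic form in its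
  coefficients whose matrix holds the sketching errors of pairs of basis vectors. By Cauchy-Schwarz
  it is at most the squared length of u times the Frobenius norm of that matrix, so a single Markov
  bound covers all y, without a net.\<close>

lemma sketch_embedding:
  fixes G :: "nat \<Rightarrow> nat \<Rightarrow> real"
  assumes m: "0 < m"
  shows "pr (2 * m) N (\<lambda>g. \<exists>y. let u = (\<lambda>r. \<Sum>j<D. y j * G j r); S = sketch m N g u in
      ip m S S < ip N u u / 2 \<or> 3 / 2 * ip N u u < ip m S S) \<le> 8 * (real D)\<^sup>2 / real m"
proof -
  from ex_orthonormal[of D N G]
  obtain q where "(\<forall>p<D. \<forall>p'<D. p \<noteq> p' \<longrightarrow> ip N (q p) (q p') = 0) \<and> (\<forall>p<D. ip N (q p) (q p) \<in> {0, 1}) \<and>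
    (\<forall>y. \<exists>c. (\<forall>p<D. ip N (q p) (q p) = 0 \<longrightarrow> c p = 0) \<and> (\<forall>r<N. (\<Sum>j<D. y j * G j r) = (\<Sum>p<D. c p * q p r)))"
    by (rule exE)
  then have orth: "\<And>p p'. p < D \<Longrightarrow> p' < D \<Longrightarrow> p \<noteq> p' \<Longrightarrow> ip N (q p) (q p') = 0"
    and one: "\<And>p. p < D \<Longrightarrow> ip N (q p) (q p) = 0 \<or> ip N (q p) (q p) = 1"
    and span: "\<And>y. \<exists>c. (\<forall>p<D. ip N (q p) (q p) = 0 \<longrightarrow> c p = 0) \<and> (\<forall>r<N. (\<Sum>j<D. y j * G j r) = (\<Sum>p<D. c p * q p r))"
    by simp_all
  \<comment> \<open>The squared Frobenius norm. The threshold 1/4 gives relative distortion 1/2, and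
    the mean 2 * D ^ 2 / m divided by 1/4 is the failure probability.\<close>
  define F where "F g = (\<Sum>p<D. \<Sum>p'<D. (sketch_err m N (q p) (q p') g)\<^sup>2)" for g
  have F0: "0 \<le> F g" for g unfolding F_def by (intro sum_nonneg) simp
  have avgF: "avg (2 * m) N F \<le> 2 * (real D)\<^sup>2 / real m"
  proof -
    have "avg (2 * m) N F = (\<Sum>p<D. \<Sum>p'<D. avg (2 * m) N (\<lambda>g. (sketch_err m N (q p) (q p') g)\<^sup>2))"
      unfolding F_def avg_sum ..
    also have "\<dots> \<le> (\<Sum>p<D. \<Sum>p'<D. 2 / real m)"
    proof (intro sum_mono)
      fix p p' assume p: "p \<in> {..<D}" "p' \<in> {..<D}"
      have "avg (2 * m) N (\<lambda>g. (sketch_err m N (q p) (q p') g)\<^sup>2) \<le> 2 / real m * (ip N (q p) (q p) * ip N (q p') (q p'))"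
        by (rule avg_sketch_err_sq[OF m])
      also have "\<dots> \<le> 2 / real m * (1 * 1)"
        using one[of p] one[of p'] p by (intro mult_left_mono mult_mono) (auto simp: ip_self_nonneg)
      finally show "avg (2 * m) N (\<lambda>g. (sketch_err m N (q p) (q p') g)\<^sup>2) \<le> 2 / real m" by simp
    qed
    also have "\<dots> = 2 * (real D)\<^sup>2 / real m" by (simp add: power2_eq_square)
    finally show ?thesis .
  qed
  have good: "\<not> (\<exists>y. let u = (\<lambda>r. \<Sum>j<D. y j * G j r); S = sketch m N g u in
      ip m S S < ip N u u / 2 \<or> 3 / 2 * ip N u u < ip m S S)" if Fg: "F g \<le> 1/4" for g
  proof -
    have "ip N u u / 2 \<le> ip m (sketch m N g u) (sketch m N g u) \<and> ip m (sketch m N g u) (sketch m N g u) \<le> 3 / 2 * ip N u u"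
      if u: "u = (\<lambda>r. \<Sum>j<D. y j * G j r)" for y u
    proof -
      obtain c where c0: "\<And>p. p < D \<Longrightarrow> ip N (q p) (q p) = 0 \<Longrightarrow> c p = 0"
        and c: "\<And>r. r < N \<Longrightarrow> u r = (\<Sum>p<D. c p * q p r)" using span[of y] u by auto
      let ?v = "\<lambda>r. \<Sum>p<D. c p * q p r"
      have Su: "sketch m N g u = (\<lambda>h. \<Sum>p<D. c p * sketch m N g (q p) h)"
        using sketch_cong[of N u ?v m g] c by (simp add: sketch_lincomb)
      have uu: "ip N u u = ip N ?v ?v" using c by (intro ip_cong) auto
      have "ip N u u = (\<Sum>p<D. (c p)\<^sup>2 * ip N (q p) (q p))"
        unfolding uu using orth by (intro ip_orthogonal_sum) auto
      also have "\<dots> = (\<Sum>p<D. (c p)\<^sup>2)"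
      proof (rule sum.cong)
        fix p assume "p \<in> {..<D}"
        then show "(c p)\<^sup>2 * ip N (q p) (q p) = (c p)\<^sup>2" using one[of p] c0[of p] by auto
      qed simp
      finally have norm_u: "ip N u u = (\<Sum>p<D. (c p)\<^sup>2)" .
      define E where "E = ip m (sketch m N g u) (sketch m N g u) - ip N u u"
      have "E = (\<Sum>p<D. \<Sum>p'<D. (c p * c p') * sketch_err m N (q p) (q p') g)"
        unfolding E_def uu unfolding Su ip_lincomb sketch_err_def
        by (simp add: sum_subtractf right_diff_distrib)
      also have "\<dots> = (\<Sum>(p, p')\<in>{..<D} \<times> {..<D}. (c p * c p') * sketch_err m N (q p) (q p') g)"
        by (rule sum.cartesian_product)
      finally have E: "E = (\<Sum>(p, p')\<in>{..<D} \<times> {..<D}. (c p * c p') * sketch_err m N (q p) (q p') g)" .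
      have "E\<^sup>2 \<le> (\<Sum>(p, p')\<in>{..<D} \<times> {..<D}. (c p * c p')\<^sup>2) * (\<Sum>(p, p')\<in>{..<D} \<times> {..<D}. (sketch_err m N (q p) (q p') g)\<^sup>2)"
        unfolding E case_prod_unfold by (rule Cauchy_Schwarz_ineq_sum)
      also have "(\<Sum>(p, p')\<in>{..<D} \<times> {..<D}. (sketch_err m N (q p) (q p') g)\<^sup>2) = F g"
        unfolding F_def by (rule sum.cartesian_product[symmetric])
      also have "(\<Sum>(p, p')\<in>{..<D} \<times> {..<D}. (c p * c p')\<^sup>2) = (\<Sum>p<D. \<Sum>p'<D. (c p)\<^sup>2 * (c p')\<^sup>2)"
        by (simp add: sum.cartesian_product power_mult_distrib)
      also have "\<dots> = (ip N u u)\<^sup>2" unfolding norm_u by (simp add: power2_eq_square[of "sum _ _"] sum_product)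
      also have "(ip N u u)\<^sup>2 * F g \<le> (ip N u u)\<^sup>2 * (1/4)" using Fg by (intro mult_left_mono) auto
      also have "\<dots> = (ip N u u / 2)\<^sup>2" by (simp add: power2_eq_square)
      finally have "\<bar>E\<bar>\<^sup>2 \<le> (ip N u u / 2)\<^sup>2" by simp
      then have "\<bar>E\<bar> \<le> ip N u u / 2" by (rule power2_le_imp_le) (simp add: ip_self_nonneg)
      then show ?thesis unfolding E_def by linarith
    qed
    then show ?thesis unfolding Let_def not_ex de_Morgan_disj not_less by blast
  qed
  have "pr (2 * m) N (\<lambda>g. \<exists>y. let u = (\<lambda>r. \<Sum>j<D. y j * G j r); S = sketch m N g u in
      ip m S S < ip N u u / 2 \<or> 3 / 2 * ip N u u < ip m S S) \<le> pr (2 * m) N (\<lambda>g. 1/4 < F g)"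
  proof (rule avg_mono)
    fix g
    show "of_bool (\<exists>y. let u = (\<lambda>r. \<Sum>j<D. y j * G j r); S = sketch m N g u in
      ip m S S < ip N u u / 2 \<or> 3 / 2 * ip N u u < ip m S S) \<le> (of_bool (1/4 < F g) :: real)"
      using good[of g] by (cases "1/4 < F g") (simp_all only: of_bool_eq not_less, simp_all)
  qed
  also have "\<dots> \<le> avg (2 * m) N F / (1/4)" using F0 by (intro pr_Markov) auto
  also have "\<dots> \<le> 8 * (real D)\<^sup>2 / real m" using avgF by (simp add: field_simps)
  finally show ?thesis .
qed

section \<open>Random weights hit every level set\<close>

text \<open>Sign patterns on N points of the linear combinations of the functions
  \<open>B q\<close>; counting them is the problem of counting cells of a hyperplane
  arrangement.\<close>

definition patterns :: "nat \<Rightarrow> 'q set \<Rightarrow> ('q \<Rightarrow> nat \<Rightarrow> real) \<Rightarrow> nat set set" where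
  "patterns N Q B = range (\<lambda>c. {i. i < N \<and> 0 \<le> (\<Sum>q\<in>Q. c q * B q i)})"

lemma finite_patterns: "finite (patterns N Q B)"
  by (rule finite_subset[of _ "Pow {..<N}"]) (auto simp: patterns_def)

text \<open>Deleting a maps F onto its traces; a trace P has two preimages exactly when both P and
  insert a P belong to F.\<close>

lemma card_split_last:
  assumes "finite F"
  shows "card F \<le> card ((\<lambda>P. P - {a}) ` F) + card {P \<in> F. a \<notin> P \<and> insert a P \<in> F}"
proof -
  let ?A = "{P \<in> F. a \<notin> P}" and ?A' = "{P \<in> F. a \<in> P}"
  let ?B = "(\<lambda>P. P - {a}) ` ?A'"
  have fin: "finite ?A" "finite ?A'" "finite ?B" using assms by auto
  have "card F = card (?A \<union> ?A')" by (rule arg_cong[where f = card]) auto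
  also have "\<dots> = card ?A + card ?A'" using fin by (intro card_Un_disjoint) auto
  also have "card ?A' = card ?B" by (intro card_image[symmetric] inj_onI) auto
  also have "card ?A + card ?B = card (?A \<union> ?B) + card (?A \<inter> ?B)" using fin by (intro card_Un_Int)
  also have "card (?A \<union> ?B) \<le> card ((\<lambda>P. P - {a}) ` F)"
  proof (intro card_mono subsetI)
    fix P assume "P \<in> ?A \<union> ?B"
    then show "P \<in> (\<lambda>P. P - {a}) ` F" by (force intro: rev_image_eqI)
  qed (use assms in auto)
  also have "card (?A \<inter> ?B) \<le> card {P \<in> F. a \<notin> P \<and> insert a P \<in> F}"
    using assms by (intro card_mono) (auto simp: insert_absorb)
  finally show ?thesis by simp
qed

text \<open>
  A pattern on the first \<open>N\<close> points that extends in both ways to the next point is, by convexity,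
  realised by a function vanishing at that point; those functions span one dimension less.
\<close>

lemma patterns_both:
  fixes B :: "'q \<Rightarrow> nat \<Rightarrow> real"
  assumes Q: "finite Q" "q0 \<in> Q" "B q0 N \<noteq> 0"
  shows "{P \<in> patterns (Suc N) Q B. N \<notin> P \<and> insert N P \<in> patterns (Suc N) Q B}
    \<subseteq> patterns N (Q - {q0}) (\<lambda>q i. B q i - B q N / B q0 N * B q0 i)"
proof
  fix P assume "P \<in> {P \<in> patterns (Suc N) Q B. N \<notin> P \<and> insert N P \<in> patterns (Suc N) Q B}"
  then obtain c1 c2 where P1: "P = {i. i < Suc N \<and> 0 \<le> (\<Sum>q\<in>Q. c1 q * B q i)}"
    and P2: "insert N P = {i. i < Suc N \<and> 0 \<le> (\<Sum>q\<in>Q. c2 q * B q i)}" and NP: "N \<notin> P"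
    by (auto simp: patterns_def)
  define v1 where "v1 i = (\<Sum>q\<in>Q. c1 q * B q i)" for i
  define v2 where "v2 i = (\<Sum>q\<in>Q. c2 q * B q i)" for i
  have P1': "i \<in> P \<longleftrightarrow> 0 \<le> v1 i" if "i \<le> N" for i using P1 that by (auto simp: v1_def)
  have P2': "i \<in> insert N P \<longleftrightarrow> 0 \<le> v2 i" if "i \<le> N" for i using P2 that by (auto simp: v2_def)
  have n1: "v1 N < 0" using P1'[of N] NP by simp
  have n2: "0 \<le> v2 N" using P2'[of N] by simp
  define w where "w i = v2 N * v1 i + (- v1 N) * v2 i" for i
  define c where "c q = v2 N * c1 q + (- v1 N) * c2 q" for q
  have comb: "(\<Sum>q\<in>Q. (a * c1 q + b * c2 q) * B q i) = a * v1 i + b * v2 i" for a b i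
    by (simp add: v1_def v2_def sum_distrib_left distrib_right sum.distrib mult.assoc)
  have w: "w i = (\<Sum>q\<in>Q. c q * B q i)" for i unfolding w_def c_def by (rule comb[symmetric])
  have Pw: "i \<in> P \<longleftrightarrow> 0 \<le> w i" if i: "i < N" for i
  proof (cases "i \<in> P")
    case True
    then have "0 \<le> v1 i" "0 \<le> v2 i" using P1'[of i] P2'[of i] i by auto
    then have "0 \<le> v2 N * v1 i" "0 \<le> (- v1 N) * v2 i" using n1 n2 by (simp_all add: mult_nonpos_nonneg)
    then show ?thesis using True by (simp add: w_def)
  next
    case False
    then have "v1 i < 0" "v2 i < 0" using P1'[of i] P2'[of i] i by auto
    then have "v2 N * v1 i \<le> 0" "(- v1 N) * v2 i < 0" using n1 n2
      by (auto simp: mult_nonneg_nonpos mult_neg_neg)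
    then show ?thesis using False by (simp add: w_def)
  qed
  have "w N = 0" by (simp add: w_def)
  then have "c q0 * B q0 N + (\<Sum>q\<in>Q - {q0}. c q * B q N) = 0" using Q by (simp add: w sum.remove)
  then have c0: "c q0 = - (\<Sum>q\<in>Q - {q0}. c q * B q N) / B q0 N" using Q(3) by (simp add: field_simps)
  have "w i = (\<Sum>q\<in>Q - {q0}. c q * (B q i - B q N / B q0 N * B q0 i))" for i
  proof -
    have "w i = c q0 * B q0 i + (\<Sum>q\<in>Q - {q0}. c q * B q i)" using Q by (simp add: w sum.remove)
    also have "c q0 * B q0 i = - (\<Sum>q\<in>Q - {q0}. c q * (B q N / B q0 N * B q0 i))"
      unfolding c0 by (simp add: sum_distrib_right sum_divide_distrib mult.assoc)
    finally show ?thesis by (simp add: right_diff_distrib sum_subtractf)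
  qed
  moreover have "P = {i. i < N \<and> 0 \<le> w i}"
  proof -
    have "i < N" if "i \<in> P" for i using that P1 NP by (auto simp: less_Suc_eq)
    then show ?thesis using Pw by auto
  qed
  ultimately show "P \<in> patterns N (Q - {q0}) (\<lambda>q i. B q i - B q N / B q0 N * B q0 i)"
    by (auto simp: patterns_def)
qed

text \<open>\<open>card_split_last\<close> and \<open>patterns_both\<close> give the recursion c (N
  + 1) D \<le> c N D + c N (D - 1) for the number of patterns, and the powers (N + 1) ^ D dominate
  its solutions.\<close>

lemma card_patterns:
  "finite Q \<Longrightarrow> card (patterns N Q B) \<le> (N + 1) ^ card Q"
proof (induction N arbitrary: Q B)
  case 0
  have "patterns 0 Q B \<subseteq> {{}}" by (auto simp: patterns_def)
  then show ?case using card_mono[of "{{}}" "patterns 0 Q B"] by simp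
next
  case (Suc N)
  let ?F = "patterns (Suc N) Q B"
  let ?both = "{P \<in> ?F. N \<notin> P \<and> insert N P \<in> ?F}"
  have "(\<lambda>P. P - {N}) ` ?F \<subseteq> patterns N Q B"
  proof
    fix P assume "P \<in> (\<lambda>P. P - {N}) ` ?F"
    then obtain c where "P = {i. i < Suc N \<and> 0 \<le> (\<Sum>q\<in>Q. c q * B q i)} - {N}"
      by (auto simp: patterns_def)
    then have "P = {i. i < N \<and> 0 \<le> (\<Sum>q\<in>Q. c q * B q i)}" by auto
    then show "P \<in> patterns N Q B" by (auto simp: patterns_def)
  qed
  then have "card ((\<lambda>P. P - {N}) ` ?F) \<le> card (patterns N Q B)"
    by (rule card_mono[OF finite_patterns])
  also have "\<dots> \<le> (N + 1) ^ card Q" by (rule Suc.IH[OF Suc.prems])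
  finally have 1: "card ?F \<le> (N + 1) ^ card Q + card ?both"
    using card_split_last[OF finite_patterns, of "Suc N" Q B N] by linarith
  show ?case
  proof (cases "\<forall>q\<in>Q. B q N = 0")
    case True
    \<comment> \<open>If all functions vanish at N, every combination has the value 0 there, which
      counts as nonnegative, so no pattern omits N.\<close>
    then have "N \<in> P" if "P \<in> ?F" for P using that by (auto simp: patterns_def)
    then have "?both = {}" by blast
    then have "card ?F \<le> (N + 1) ^ card Q" using 1 by (simp only: card.empty)
    also have "\<dots> \<le> (Suc N + 1) ^ card Q" by (intro power_mono) auto
    finally show ?thesis .
  next
    case False
    then obtain q0 where q0: "q0 \<in> Q" "B q0 N \<noteq> 0" by blast
    obtain E where E: "card Q = Suc E" using q0 Suc.prems by (metis card_Suc_Diff1)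
    have "card ?both \<le> card (patterns N (Q - {q0}) (\<lambda>q i. B q i - B q N / B q0 N * B q0 i))"
      using Suc.prems q0 by (intro card_mono finite_patterns patterns_both) auto
    also have "\<dots> \<le> (N + 1) ^ card (Q - {q0})" using Suc.prems by (intro Suc.IH) simp
    also have "\<dots> = (N + 1) ^ E" using q0 Suc.prems E by simp
    finally have "card ?F \<le> (N + 1) ^ Suc E + (N + 1) ^ E" using 1 E by simp
    also have "\<dots> = (N + 2) * (N + 1) ^ E" by simp
    also have "\<dots> \<le> (N + 2) * (N + 2) ^ E" by (intro mult_left_mono power_mono) auto
    finally show ?thesis using E by simp
  qed
qed

definition level_sets :: "nat \<Rightarrow> nat \<Rightarrow> (nat \<Rightarrow> nat \<Rightarrow> real) \<Rightarrow> nat set set" where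
  "level_sets N D G = {{i. i < N \<and> t \<le> \<bar>\<Sum>j<D. y j * G j i\<bar>} | t y. True}"

text \<open>A level set of the modulus is the union of two patterns, the threshold being the
  coefficient of an added constant function. Two patterns from D + 1 functions give the exponent 2 *
  (D + 1).\<close>

lemma card_level_sets:
  "finite (level_sets N D G) \<and> card (level_sets N D G) \<le> (N + 1) ^ (2 * (D + 1))"
proof -
  define B where "B q i = (if q = D then 1 else G q i)" for q i
  let ?P = "patterns N {..D} B"
  have half: "{i. i < N \<and> t \<le> (\<Sum>j<D. y j * G j i)} \<in> ?P" for t y
  proof -
    let ?c = "\<lambda>q. if q = D then - t else y q"
    have "(\<Sum>q\<le>D. ?c q * B q i) = (\<Sum>j<D. y j * G j i) - t" for i
      by (simp add: B_def lessThan_Suc_atMost[symmetric])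
    then have "{i. i < N \<and> t \<le> (\<Sum>j<D. y j * G j i)} = {i. i < N \<and> 0 \<le> (\<Sum>q\<le>D. ?c q * B q i)}"
      by auto
    then show ?thesis by (auto simp: patterns_def)
  qed
  have sub: "level_sets N D G \<subseteq> (\<lambda>(P, P'). P \<union> P') ` (?P \<times> ?P)"
  proof
    fix T assume "T \<in> level_sets N D G"
    then obtain t y where T: "T = {i. i < N \<and> t \<le> \<bar>\<Sum>j<D. y j * G j i\<bar>}" by (auto simp: level_sets_def)
    have "T = {i. i < N \<and> t \<le> (\<Sum>j<D. y j * G j i)} \<union> {i. i < N \<and> t \<le> (\<Sum>j<D. - y j * G j i)}"
      unfolding T by (auto simp: sum_negf abs_if)
    then show "T \<in> (\<lambda>(P, P'). P \<union> P') ` (?P \<times> ?P)" using half[of t y] half[of t "\<lambda>j. - y j"]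
      by (intro image_eqI[of _ _ "({i. i < N \<and> t \<le> (\<Sum>j<D. y j * G j i)}, {i. i < N \<and> t \<le> (\<Sum>j<D. - y j * G j i)})"]) simp_all
  qed
  have fin: "finite (?P \<times> ?P)" by (simp add: finite_patterns)
  have "card (level_sets N D G) \<le> card ((\<lambda>(P, P'). P \<union> P') ` (?P \<times> ?P))"
    using fin by (intro card_mono[OF _ sub]) simp
  also have "\<dots> \<le> card (?P \<times> ?P)" using fin by (rule card_image_le)
  also have "\<dots> = card ?P * card ?P" by (rule card_cartesian_product)
  also have "\<dots> \<le> (N + 1) ^ (D + 1) * (N + 1) ^ (D + 1)"
    using card_patterns[of "{..D}" N B] by (intro mult_mono) simp_all
  also have "\<dots> = (N + 1) ^ (2 * (D + 1))" by (simp only: power_add[symmetric] mult_2)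
  finally show ?thesis using finite_subset[OF sub] fin by simp
qed

text \<open>Leading zeros of \<open>u\<close> as a binary number with \<open>q\<close> digits; for uniform \<open>u\<close> they are geometrically distributed.\<close>

primrec lead :: "nat \<Rightarrow> nat \<Rightarrow> nat" where
  "lead 0 u = 0"
| "lead (Suc q) u = (if u = 0 then Suc q else lead q (u div 2))"

lemma lead_le: "lead q u \<le> q"
  by (induction q arbitrary: u) (auto simp: le_SucI)

lemma le_lead_iff: "u < 2 ^ q \<Longrightarrow> j \<le> q \<Longrightarrow> j \<le> lead q u \<longleftrightarrow> u < 2 ^ (q - j)"
proof (induction q arbitrary: u)
  case (Suc q)
  show ?case
  proof (cases "u = 0")
    case False
    have "u div 2 < 2 ^ q" using Suc.prems by (simp add: less_mult_imp_div_less)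
    show ?thesis
    proof (cases "j \<le> q")
      case True
      then have "Suc q - j = Suc (q - j)" by simp
      then show ?thesis using Suc.IH[OF \<open>u div 2 < 2 ^ q\<close> True] False
        by (simp add: less_mult_imp_div_less div_less_iff_less_mult mult.commute)
    next
      case False': False
      then have "j = Suc q" using Suc.prems by simp
      then show ?thesis using False lead_le[of q "u div 2"] by simp
    qed
  qed (use Suc.prems in simp)
qed simp

section \<open>Hits of level sets by large weights\<close>

lemma count_lead:
  assumes "j \<le> L"
  shows "(\<Sum>x<2 ^ L :: nat. if j \<le> lead L x then a else b :: real) / real (2 ^ L) = b + (a - b) / 2 ^ j"
proof -
  have "(\<Sum>x<2 ^ L :: nat. if j \<le> lead L x then a else b) = (\<Sum>x<2 ^ L :: nat. b + (if x \<in> {..<2 ^ (L - j)} then a - b else 0))"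
    using le_lead_iff[OF _ assms] by (intro sum.cong) auto
  also have "\<dots> = 2 ^ L * b + (\<Sum>x\<in>{..<2 ^ L :: nat} \<inter> {..<2 ^ (L - j)}. a - b)"
    unfolding sum.distrib by (subst sum.inter_restrict) simp_all
  also have "{..<2 ^ L} \<inter> {..<2 ^ (L - j)} = {..<2 ^ (L - j) :: nat}"
  proof -
    have "2 ^ (L - j) \<le> (2 :: nat) ^ L" by (intro power_increasing) auto
    then have "{..<2 ^ (L - j)} \<subseteq> {..<2 ^ L :: nat}" by (simp only: lessThan_subset_iff)
    then show ?thesis by (rule Int_absorb1)
  qed
  finally have "(\<Sum>x<2 ^ L :: nat. if j \<le> lead L x then a else b) = 2 ^ L * b + 2 ^ (L - j) * (a - b)" by simp
  moreover have "(2 :: real) ^ L = 2 ^ (L - j) * 2 ^ j" using assms by (simp add: power_add[symmetric])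
  ultimately show ?thesis by (simp add: field_simps)
qed

text \<open>Chernoff bound with the exponential moment of -H for the number H of hits: each row of T
  contributes a factor at most exp (- 1 / (2 * 2 ^ j)), in total at most exp (- s / 2), and the
  threshold s / 4 costs exp (s / 4).\<close>

lemma pr_few_hits:
  assumes j: "j \<le> L" and T: "T \<subseteq> {..<N}" and s: "s * 2 ^ j \<le> real (card T)"
  shows "pr (2 ^ L) N (\<lambda>u. real (card {i \<in> T. j \<le> lead L (u i)}) \<le> s / 4) \<le> exp (- s / 4)"
proof -
  have finT: "finite T" using T finite_subset by blast
  let ?H = "\<lambda>u. card {i \<in> T. j \<le> lead L (u i)}"
  let ?f = "\<lambda>i x. if i \<in> T then if j \<le> lead L x then exp (-1) else 1 else 1 :: real"
  have expH: "exp (- real (?H u)) = (\<Prod>i<N. ?f i (u i))" for u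
  proof -
    have "(\<Prod>i<N. ?f i (u i)) = (\<Prod>i\<in>{i \<in> T. j \<le> lead L (u i)}. exp (-1))"
      using T by (intro prod.mono_neutral_cong_right) (auto split: if_splits)
    also have "\<dots> = exp (- real (?H u))" by (simp add: exp_of_nat_mult[symmetric])
    finally show ?thesis by simp
  qed
  have "pr (2 ^ L) N (\<lambda>u. real (?H u) \<le> s / 4) \<le> avg (2 ^ L) N (\<lambda>u. exp (s / 4) * exp (- real (?H u)))"
  proof (rule avg_mono)
    fix u
    have "1 \<le> exp (s / 4 - real (?H u))" if "real (?H u) \<le> s / 4" using that by simp
    moreover have "exp (s / 4) * exp (- real (?H u)) = exp (s / 4 - real (?H u))" by (simp add: mult_exp_exp)
    ultimately show "of_bool (real (?H u) \<le> s / 4) \<le> exp (s / 4) * exp (- real (?H u))"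
      by (cases "real (?H u) \<le> s / 4") simp_all
  qed
  also have "\<dots> = exp (s / 4) * (\<Prod>i<N. (\<Sum>x<2 ^ L. ?f i x) / real (2 ^ L))"
  proof -
    have "avg (2 ^ L) N (\<lambda>u. \<Prod>i<N. ?f i (u i)) = (\<Prod>i<N. (\<Sum>x<2 ^ L. ?f i x) / real (2 ^ L))" by (rule avg_prod)
    then show ?thesis unfolding avg_cmult expH by simp
  qed
  also have "(\<Prod>i<N. (\<Sum>x<2 ^ L. ?f i x) / real (2 ^ L)) = (\<Prod>i<N. if i \<in> T then 1 + (exp (-1) - 1) / 2 ^ j else 1)"
    using count_lead[OF j, of "exp (-1)" 1] by (intro prod.cong) auto
  also have "\<dots> \<le> (\<Prod>i<N. if i \<in> T then exp (- 1 / (2 * 2 ^ j)) else 1)"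
  proof (intro prod_mono conjI)
    have e: "exp (-1) \<le> (1/2 :: real)" using exp_ge_add_one_self[of 1] by (simp add: exp_minus inverse_eq_divide divide_simps)
    fix i
    have "(exp (-1) - 1) / 2 ^ j \<ge> (- 1 :: real)"
    proof -
      have "(exp (-1) - 1) / 2 ^ j \<ge> (- 1 :: real) / 2 ^ j" by (intro divide_right_mono) auto
      moreover have "(- 1 :: real) / 2 ^ j \<ge> - 1" by simp
      ultimately show ?thesis by linarith
    qed
    then show "0 \<le> (if i \<in> T then 1 + (exp (-1) - 1) / 2 ^ j else (1 :: real))" by simp
    have "(exp (-1) - 1) / 2 ^ j \<le> (- (1/2) :: real) / 2 ^ j" using e by (intro divide_right_mono) auto
    then have "1 + (exp (-1) - 1) / 2 ^ j \<le> 1 + (- 1 / (2 * 2 ^ j) :: real)" by simp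
    also have "\<dots> \<le> exp (- 1 / (2 * 2 ^ j))" by (rule exp_ge_add_one_self)
    finally show "(if i \<in> T then 1 + (exp (-1) - 1) / 2 ^ j else 1) \<le> (if i \<in> T then exp (- 1 / (2 * 2 ^ j)) else (1 :: real))"
      by simp
  qed
  also have "\<dots> = exp (- 1 / (2 * 2 ^ j)) ^ card T"
  proof -
    have "(\<Prod>i<N. if i \<in> T then exp (- 1 / (2 * 2 ^ j)) else 1) = (\<Prod>i\<in>T. exp (- 1 / (2 * 2 ^ j) :: real))"
      using T by (intro prod.mono_neutral_cong_right) auto
    then show ?thesis by simp
  qed
  also have "\<dots> = exp (- (real (card T) / 2 ^ j) / 2)" by (simp add: exp_of_nat_mult[symmetric])
  also have "\<dots> \<le> exp (- s / 2)"
  proof -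
    have "s \<le> real (card T) / 2 ^ j" using s by (simp add: pos_le_divide_eq)
    then show ?thesis by simp
  qed
  also have "exp (s / 4) * exp (- s / 2) = exp (- s / 4)" by (simp add: exp_add[symmetric])
  finally show ?thesis by simp
qed

context sym_norm
begin

definition weight :: "nat \<Rightarrow> nat \<Rightarrow> real" where
  "weight L u = phi (2 ^ lead L u)"

text \<open>Chosen so that exp (- s / 4) equals exp (-5) divided by (N + 1) ^ (2 * (D + 1)), the
  bound on the number of level sets. The union bound then leaves exp (-5) \<le> 1/40.\<close>

definition samples :: "nat \<Rightarrow> nat \<Rightarrow> real" where
  "samples N D = 8 * (real D + 1) * ln (real N + 1) + 20"

lemma samples_ge: "20 \<le> samples N D"
  by (simp add: samples_def)

text \<open>At the scale 2 ^ j with s * 2 ^ j about card T, \<open>phi_ratio\<close> gives phi (card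
  T) \<le> 4 * s * phi (2 ^ j). More than s / 4 squares of size at least phi (2 ^ j) ^ 2 then sum to
  phi (card T) ^ 2 / (64 * s): squared norms lose only a factor s, not s ^ 2.\<close>

lemma weight_large_set:
  assumes T: "T \<subseteq> {..<N}" and N: "N \<le> n" and ne: "1 \<le> card T" and s: "1 \<le> s" and j: "j \<le> L"
    and le: "s * 2 ^ j \<le> real (card T)" and gt: "real (card T) < 2 * (s * 2 ^ j)"
    and hits: "s / 4 < real (card {i \<in> T. j \<le> lead L (u i)})"
  shows "(phi (card T))\<^sup>2 / (64 * s) \<le> (\<Sum>i\<in>T. (weight L (u i))\<^sup>2)"
proof -
  have finT: "finite T" using T finite_subset by blast
  let ?k = "card T" and ?p = "phi (2 ^ j)"
  have kn: "?k \<le> n" using card_mono[OF _ T] N by simp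
  have "(2 :: real) ^ j \<le> s * 2 ^ j" using s by simp
  then have "(2 :: real) ^ j \<le> real ?k" using le by linarith
  then have jk: "2 ^ j \<le> ?k" by (metis of_nat_le_iff of_nat_numeral of_nat_power)
  have "phi ?k * 2 ^ j \<le> 2 * real ?k * ?p" using phi_ratio[of "2 ^ j" ?k] jk kn by simp
  also have "\<dots> \<le> 2 * (2 * (s * 2 ^ j)) * ?p" using gt phi_nonneg by (intro mult_right_mono) auto
  finally have "phi ?k * 2 ^ j \<le> (4 * s * ?p) * 2 ^ j" by (simp add: mult_ac)
  then have "phi ?k \<le> 4 * s * ?p" by (rule mult_right_le_imp_le) simp
  then have "(phi ?k)\<^sup>2 \<le> (4 * s * ?p)\<^sup>2" using phi_nonneg by (intro power_mono) auto
  then have "(phi ?k)\<^sup>2 / (64 * s) \<le> (4 * s * ?p)\<^sup>2 / (64 * s)" using s by (intro divide_right_mono) auto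
  also have "\<dots> = s / 4 * ?p\<^sup>2" using s by (simp add: power2_eq_square field_simps)
  also have "\<dots> \<le> real (card {i \<in> T. j \<le> lead L (u i)}) * ?p\<^sup>2" using hits by (intro mult_right_mono) auto
  also have "\<dots> = (\<Sum>i\<in>{i \<in> T. j \<le> lead L (u i)}. ?p\<^sup>2)" by simp
  also have "\<dots> \<le> (\<Sum>i\<in>{i \<in> T. j \<le> lead L (u i)}. (weight L (u i))\<^sup>2)"
    unfolding weight_def using phi_nonneg by (intro sum_mono power_mono phi_mono power_increasing) auto
  also have "\<dots> \<le> (\<Sum>i\<in>T. (weight L (u i))\<^sup>2)" using finT by (intro sum_mono2) auto
  finally show ?thesis .
qed

text \<open>This case is deterministic: every weight is at least \<open>phi 1\<close>, and phi k
  \<le> 2 * k * phi 1 with k < s.\<close>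

lemma weight_small_set:
  assumes T: "T \<subseteq> {..<N}" and N: "N \<le> n" and ne: "1 \<le> card T" and s: "real (card T) < s"
  shows "(phi (card T))\<^sup>2 / (64 * s) \<le> (\<Sum>i\<in>T. (weight L (u i))\<^sup>2)"
proof -
  let ?k = "card T"
  have kn: "?k \<le> n" using card_mono[OF _ T] N by simp
  have s0: "0 < s" using s by linarith
  have "phi ?k \<le> 2 * real ?k * phi 1" using phi_ratio[of 1 ?k] ne kn by simp
  then have "(phi ?k)\<^sup>2 \<le> (2 * real ?k * phi 1)\<^sup>2" using phi_nonneg by (intro power_mono) auto
  also have "\<dots> = 4 * real ?k * (real ?k * (phi 1)\<^sup>2)" by (simp add: power2_eq_square)
  also have "\<dots> \<le> (64 * s) * (real ?k * (phi 1)\<^sup>2)" using s by (intro mult_right_mono) auto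
  finally have "(phi ?k)\<^sup>2 / (64 * s) \<le> real ?k * (phi 1)\<^sup>2" using s0 by (simp add: pos_divide_le_eq mult.commute)
  also have "\<dots> = (\<Sum>i\<in>T. (phi 1)\<^sup>2)" by simp
  also have "\<dots> \<le> (\<Sum>i\<in>T. (weight L (u i))\<^sup>2)"
    unfolding weight_def using phi_nonneg by (intro sum_mono power_mono phi_mono) auto
  finally show ?thesis .
qed

lemma ex_scale:
  assumes "1 \<le> s" "s \<le> real k" "k < 2 ^ Suc L"
  shows "\<exists>j\<le>L. s * 2 ^ j \<le> real k \<and> real k < 2 * (s * 2 ^ j)"
proof -
  define P where "P j \<longleftrightarrow> real k < s * 2 ^ j" for j
  have "real k < 2 ^ Suc L" using assms(3) by (metis of_nat_less_iff of_nat_numeral of_nat_power)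
  also have "\<dots> \<le> s * 2 ^ Suc L" using assms(1) mult_right_mono[of 1 s "2 ^ Suc L"] by simp
  finally have "P (Suc L)" by (simp add: P_def)
  then have "P (LEAST j. P j)" "(LEAST j. P j) \<le> Suc L" by (rule LeastI, rule Least_le)
  moreover have "\<not> P 0" using assms by (simp add: P_def)
  ultimately obtain j where j: "(LEAST j. P j) = Suc j" by (metis not0_implies_Suc)
  then have "\<not> P j" using not_less_Least[of j P] by simp
  then show ?thesis using j \<open>P (LEAST j. P j)\<close> \<open>(LEAST j. P j) \<le> Suc L\<close>
    by (intro exI[of _ j]) (auto simp: P_def)
qed

lemma pr_sampling:
  fixes G :: "nat \<Rightarrow> nat \<Rightarrow> real"
  assumes N: "N \<le> n" "N < 2 ^ Suc L"
  shows "pr (2 ^ L) N (\<lambda>u. \<exists>T\<in>level_sets N D G. T \<noteq> {} \<and>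
      (\<Sum>i\<in>T. (weight L (u i))\<^sup>2) < (phi (card T))\<^sup>2 / (64 * samples N D)) \<le> 1/40"
proof -
  let ?s = "samples N D" and ?F = "level_sets N D G"
  have fin: "finite ?F" and card: "card ?F \<le> (N + 1) ^ (2 * (D + 1))" using card_level_sets by blast+
  let ?bad = "\<lambda>T u. T \<noteq> {} \<and> (\<Sum>i\<in>T. (weight L (u i))\<^sup>2) < (phi (card T))\<^sup>2 / (64 * ?s)"
  have one: "pr (2 ^ L) N (?bad T) \<le> exp (- ?s / 4)" if "T \<in> ?F" for T
  proof -
    have T: "T \<subseteq> {..<N}" using that by (auto simp: level_sets_def)
    then have finT: "finite T" using finite_subset by blast
    have zero: "pr (2 ^ L) N (?bad T) \<le> exp (- ?s / 4)" if "\<And>u. \<not> ?bad T u"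
    proof -
      have "pr (2 ^ L) N (?bad T) = avg (2 ^ L) N (\<lambda>_. 0)" by (intro avg_cong) (simp only: that of_bool_eq)
      then show ?thesis by (simp add: avg_def)
    qed
    show ?thesis
    proof (cases "T = {} \<or> real (card T) < ?s")
      case True
      then show ?thesis using weight_small_set[OF T N(1), of ?s L] finT
        by (intro zero) (auto simp: not_less Suc_le_eq card_gt_0_iff)
    next
      case False
      then have ne: "1 \<le> card T" using finT by (auto simp: Suc_le_eq card_gt_0_iff)
      have "card T \<le> N" using card_mono[OF _ T] by simp
      then have "card T < 2 ^ Suc L" using N(2) by simp
      moreover have s1: "1 \<le> ?s" using samples_ge[of N D] by simp
      ultimately obtain j where j: "j \<le> L" "?s * 2 ^ j \<le> real (card T)" "real (card T) < 2 * (?s * 2 ^ j)"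
        using ex_scale[of ?s "card T" L] False by auto
      have "pr (2 ^ L) N (?bad T) \<le> pr (2 ^ L) N (\<lambda>u. real (card {i \<in> T. j \<le> lead L (u i)}) \<le> ?s / 4)"
      proof (rule avg_mono)
        fix u
        show "of_bool (?bad T u) \<le> (of_bool (real (card {i \<in> T. j \<le> lead L (u i)}) \<le> ?s / 4) :: real)"
          using weight_large_set[OF T N(1) ne s1 j, of u] by (auto simp: not_less)
      qed
      also have "\<dots> \<le> exp (- ?s / 4)" by (rule pr_few_hits[OF j(1) T j(2)])
      finally show ?thesis .
    qed
  qed
  have "pr (2 ^ L) N (\<lambda>u. \<exists>T\<in>?F. ?bad T u) \<le> (\<Sum>T\<in>?F. pr (2 ^ L) N (?bad T))" by (rule pr_Ex[OF fin])
  also have "\<dots> \<le> (\<Sum>T\<in>?F. exp (- ?s / 4))" by (rule sum_mono[OF one])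
  also have "\<dots> = real (card ?F) * exp (- ?s / 4)" by simp
  also have "\<dots> \<le> real ((N + 1) ^ (2 * (D + 1))) * exp (- ?s / 4)" using card by (intro mult_right_mono of_nat_mono) auto
  also have "real ((N + 1) ^ (2 * (D + 1))) = exp (2 * (real D + 1) * ln (real N + 1))"
  proof -
    have "real ((N + 1) ^ E) = exp (ln (real N + 1)) ^ E" for E by (simp add: add.commute)
    then have "real ((N + 1) ^ (2 * (D + 1))) = exp (ln (real N + 1)) ^ (2 * (D + 1))" .
    also have "\<dots> = exp (real (2 * (D + 1)) * ln (real N + 1))" by (simp only: exp_of_nat_mult)
    finally show ?thesis by (simp add: algebra_simps)
  qed
  also have "exp (2 * (real D + 1) * ln (real N + 1)) * exp (- ?s / 4) = exp (- 5)"
    unfolding exp_add[symmetric] by (simp add: samples_def field_simps)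
  also have "exp (- 5 :: real) \<le> 1/40"
  proof -
    have "(5/2 :: real) ^ 5 \<le> exp 1 ^ 5"
      using exp_lower_Taylor_quadratic[of "1 :: real"] by (intro power_mono) simp_all
    also have "\<dots> = exp 5" using exp_of_nat_mult[of 5 "1 :: real"] by simp
    finally have "40 \<le> exp (5 :: real)" by (simp add: power_divide)
    then show ?thesis by (simp add: exp_minus inverse_eq_divide divide_simps)
  qed
  finally show ?thesis .
qed

end

section \<open>Random weights rarely stretch a fixed vector\<close>

text \<open>Position of \<open>i\<close> when the entries of \<open>w\<close> are sorted by decreasing modulus, ties broken by index.\<close>

definition up_set :: "nat \<Rightarrow> (nat \<Rightarrow> real) \<Rightarrow> nat \<Rightarrow> nat set" where
  "up_set N w i = {j. j < N \<and> (\<bar>w i\<bar> < \<bar>w j\<bar> \<or> \<bar>w j\<bar> = \<bar>w i\<bar> \<and> j \<le> i)}"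

definition pos_rank :: "nat \<Rightarrow> (nat \<Rightarrow> real) \<Rightarrow> nat \<Rightarrow> nat" where
  "pos_rank N w i = card (up_set N w i)"

lemma finite_up_set: "finite (up_set N w i)"
  by (simp add: up_set_def)

lemma rank_pos: "i < N \<Longrightarrow> 1 \<le> pos_rank N w i"
proof -
  assume "i < N"
  then have "i \<in> up_set N w i" by (simp add: up_set_def)
  then show ?thesis using finite_up_set[of N w i] by (auto simp: pos_rank_def Suc_le_eq card_gt_0_iff)
qed

lemma rank_le: "pos_rank N w i \<le> N"
proof -
  have "card (up_set N w i) \<le> card {..<N}" by (intro card_mono) (auto simp: up_set_def)
  then show ?thesis by (simp add: pos_rank_def)
qed

lemma rank_less:
  assumes "i < N" "j < N" "\<bar>w j\<bar> < \<bar>w i\<bar> \<or> \<bar>w j\<bar> = \<bar>w i\<bar> \<and> i < j"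
  shows "pos_rank N w i < pos_rank N w j"
  unfolding pos_rank_def
proof (intro psubset_card_mono finite_up_set psubsetI)
  show "up_set N w i \<subseteq> up_set N w j" using assms by (auto simp: up_set_def)
  have "j \<in> up_set N w j" "j \<notin> up_set N w i" using assms by (auto simp: up_set_def)
  then show "up_set N w i \<noteq> up_set N w j" by blast
qed

lemma rank_inj: "inj_on (pos_rank N w) {..<N}"
proof (rule inj_onI, rule ccontr)
  fix i j assume ij: "i \<in> {..<N}" "j \<in> {..<N}" "pos_rank N w i = pos_rank N w j" "i \<noteq> j"
  then consider "\<bar>w j\<bar> < \<bar>w i\<bar> \<or> \<bar>w j\<bar> = \<bar>w i\<bar> \<and> i < j" | "\<bar>w i\<bar> < \<bar>w j\<bar> \<or> \<bar>w i\<bar> = \<bar>w j\<bar> \<and> j < i"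
    by linarith
  then show False using rank_less[of i N j w] rank_less[of j N i w] ij by cases auto
qed

text \<open>Ranks are distinct numbers between 1 and N.\<close>

lemma sum_inverse_rank: "(\<Sum>i<N. 1 / real (pos_rank N w i)) \<le> harm N"
proof -
  have "(\<Sum>i<N. 1 / real (pos_rank N w i)) = (\<Sum>r\<in>pos_rank N w ` {..<N}. 1 / real r)"
    using rank_inj by (simp add: sum.reindex)
  also have "\<dots> \<le> (\<Sum>r\<in>{1..N}. 1 / real r)"
    using rank_pos rank_le by (intro sum_mono2) auto
  finally show ?thesis by (simp add: harm_def inverse_eq_divide)
qed

text \<open>Bounding f at the number Z of leading zeros by the sum of f j over j \<le> Z lets the
  tail probabilities 2 ^ (-j) stand in for the point masses, at a loss of at most a factor
  2.\<close>

lemma avg_lead_le: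
  assumes i: "i < N" and f: "\<And>j. j \<le> L \<Longrightarrow> 0 \<le> f j"
  shows "avg (2 ^ L) N (\<lambda>u. f (lead L (u i))) \<le> (\<Sum>j\<le>L. f j / 2 ^ j)"
proof -
  have "avg (2 ^ L) N (\<lambda>u. f (lead L (u i))) \<le> avg (2 ^ L) N (\<lambda>u. \<Sum>j\<le>L. f j * (if j \<le> lead L (u i) then 1 else 0))"
  proof (rule avg_mono)
    fix u :: "nat \<Rightarrow> nat"
    have "f (lead L (u i)) * (if lead L (u i) \<le> lead L (u i) then 1 else 0)
        \<le> (\<Sum>j\<le>L. f j * (if j \<le> lead L (u i) then 1 else 0))"
      by (rule member_le_sum) (use f lead_le in auto)
    then show "f (lead L (u i)) \<le> (\<Sum>j\<le>L. f j * (if j \<le> lead L (u i) then 1 else 0))" by simp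
  qed
  also have "\<dots> = (\<Sum>j\<le>L. f j * avg (2 ^ L) N (\<lambda>u. if j \<le> lead L (u i) then 1 else 0))"
    unfolding avg_sum avg_cmult ..
  also have "\<dots> = (\<Sum>j\<le>L. f j / 2 ^ j)"
  proof (rule sum.cong)
    fix j assume "j \<in> {..L}"
    then show "f j * avg (2 ^ L) N (\<lambda>u. if j \<le> lead L (u i) then 1 else 0) = f j / 2 ^ j"
      using avg_marginal[OF i, of "2 ^ L" "\<lambda>x. if j \<le> lead L x then 1 else 0"] count_lead[of j L 1 0]
      by simp
  qed simp
  finally show ?thesis .
qed

lemma pr_lead_large:
  assumes i: "i < N" and x: "0 < x"
  shows "pr (2 ^ L) N (\<lambda>u. x < 2 ^ lead L (u i)) \<le> (real L + 1) / x"
proof -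
  have "pr (2 ^ L) N (\<lambda>u. x < 2 ^ lead L (u i)) \<le> avg (2 ^ L) N (\<lambda>u. 2 ^ lead L (u i)) / x"
    using x by (intro pr_Markov) auto
  also have "avg (2 ^ L) N (\<lambda>u. 2 ^ lead L (u i)) \<le> (\<Sum>j\<le>L. 2 ^ j / 2 ^ j)"
    using avg_lead_le[OF i, of L "\<lambda>j. 2 ^ j"] by simp
  also have "(\<Sum>j\<le>L. 2 ^ j / 2 ^ j :: real) = real L + 1" by simp
  finally show ?thesis using x by (simp add: divide_right_mono)
qed

context sym_norm
begin

definition conc :: real where
  "conc = mmc n l * (2 * sqrt (ln (4 * real n + 1)))"

lemma conc_ge_1: "1 \<le> conc"
proof -
  have "phi 1 * sqrt (real 1) \<le> conc * phi 1 * sqrt (real 1)"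
    unfolding conc_def using phi_sqrt_mono[of 1 1] n_pos by simp
  then show ?thesis using phi_pos[of 1] by simp
qed

text \<open>The left-hand side is what scale k contributes to an expected squared weight. Below the
  rank r the concentration inequality compares it with rank r; above r \<open>phi_ratio\<close> does
  so at the price k / r \<le> \<mu>.\<close>

lemma phi_sq_le:
  assumes r: "1 \<le> r" "r \<le> n" and k: "1 \<le> k" "k \<le> n" and kr: "real k \<le> \<mu> * real r" and \<mu>: "1 \<le> \<mu>"
  shows "(phi k)\<^sup>2 / real k \<le> (conc\<^sup>2 + 4 * \<mu>) * (phi r)\<^sup>2 / real r"
proof (cases "k \<le> r")
  case True
  have "phi k * sqrt (real r) \<le> conc * phi r * sqrt (real k)"
    using phi_sqrt_mono[OF k(1) True r(2)] by (simp add: conc_def)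
  then have "(phi k * sqrt (real r))\<^sup>2 \<le> (conc * phi r * sqrt (real k))\<^sup>2"
    using phi_nonneg by (intro power_mono) auto
  then have "(phi k)\<^sup>2 * real r \<le> conc\<^sup>2 * (phi r)\<^sup>2 * real k" by (simp add: power_mult_distrib)
  then have "(phi k)\<^sup>2 / real k \<le> conc\<^sup>2 * (phi r)\<^sup>2 / real r" using r k by (simp add: field_simps)
  also have "\<dots> \<le> (conc\<^sup>2 + 4 * \<mu>) * (phi r)\<^sup>2 / real r"
    using \<mu> by (intro divide_right_mono mult_right_mono) auto
  finally show ?thesis .
next
  case False
  have "phi k * real r \<le> 2 * real k * phi r" using phi_ratio[of r k] r k False by simp
  then have "(phi k * real r)\<^sup>2 \<le> (2 * real k * phi r)\<^sup>2" using phi_nonneg by (intro power_mono) auto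
  then have "(phi k)\<^sup>2 * (real r)\<^sup>2 \<le> 4 * real k * (phi r)\<^sup>2 * real k"
    by (simp add: power2_eq_square mult_ac)
  also have "\<dots> \<le> 4 * (\<mu> * real r) * (phi r)\<^sup>2 * real k" using kr by (intro mult_right_mono mult_left_mono) auto
  finally have "((phi k)\<^sup>2 * real r) * real r \<le> (4 * \<mu> * (phi r)\<^sup>2 * real k) * real r"
    by (simp add: power2_eq_square mult_ac)
  then have "(phi k)\<^sup>2 * real r \<le> 4 * \<mu> * (phi r)\<^sup>2 * real k" using r by (simp add: mult_le_cancel_right)
  then have "(phi k)\<^sup>2 / real k \<le> 4 * \<mu> * (phi r)\<^sup>2 / real r" using r k by (simp add: field_simps)
  also have "\<dots> \<le> (conc\<^sup>2 + 4 * \<mu>) * (phi r)\<^sup>2 / real r"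
    by (intro divide_right_mono mult_right_mono) auto
  finally show ?thesis .
qed

text \<open>The cut-off \<mu>: by \<open>pr_lead_large\<close> and the union bound over the entries,
  some scale exceeds \<mu> times the rank of its entry with probability at most (L + 1) * harm N /
  \<mu> = 1/40.\<close>

definition trunc :: "nat \<Rightarrow> nat \<Rightarrow> real" where
  "trunc L N = 40 * (real L + 1) * harm N"

text \<open>
  A fixed vector is rarely stretched: outside an unlikely event the entry of rank \<open>r\<close> receives a
  weight at most \<open>phi (\<mu> * r)\<close>, and below this threshold its weight is small on average.
\<close>

lemma pr_dilation:
  assumes N: "1 \<le> N" "N \<le> n" "2 ^ L \<le> N" and \<Lambda>: "0 \<le> \<Lambda>"
    and w: "\<And>T t. T \<subseteq> {..<N} \<Longrightarrow> 0 \<le> t \<Longrightarrow> (\<And>i. i \<in> T \<Longrightarrow> t \<le> \<bar>w i\<bar>) \<Longrightarrow> t * phi (card T) \<le> \<Lambda>"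
  shows "pr (2 ^ L) N (\<lambda>u. 40 * ((real L + 1) * (conc\<^sup>2 + 4 * trunc L N) * harm N * \<Lambda>\<^sup>2)
      < (\<Sum>i<N. (weight L (u i) * w i)\<^sup>2)) \<le> 1/20"
proof -
  let ?r = "pos_rank N w" and ?\<mu> = "trunc L N"
  let ?A = "(real L + 1) * (conc\<^sup>2 + 4 * ?\<mu>) * harm N * \<Lambda>\<^sup>2"
  have harm1: "1 \<le> (harm N :: real)"
  proof -
    have "harm 1 \<le> (harm N :: real)" using N(1) by (intro harm_mono) auto
    then show ?thesis by (simp add: harm_expand)
  qed
  have \<mu>: "1 \<le> ?\<mu>"
    using mult_mono[of 1 "40 * (real L + 1)" 1 "harm N"] harm1 by (simp add: trunc_def)
  \<comment> \<open>\<open>up_set\<close> consists of rank many entries of modulus at least that of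
    entry i, so the hypothesis on w applies to it.\<close>
  have wr: "\<bar>w i\<bar> * phi (?r i) \<le> \<Lambda>" if "i < N" for i
    unfolding pos_rank_def using that by (intro w) (auto simp: up_set_def)
  define F where "F i z = (if real (2 ^ z) \<le> ?\<mu> * real (?r i) then (phi (2 ^ z))\<^sup>2 * (w i)\<^sup>2 else 0)" for i z
  have F0: "0 \<le> F i z" for i z by (simp add: F_def)
  have avgF: "avg (2 ^ L) N (\<lambda>u. F i (lead L (u i))) \<le> (real L + 1) * (conc\<^sup>2 + 4 * ?\<mu>) * \<Lambda>\<^sup>2 * (1 / real (?r i))" if i: "i < N" for i
  proof -
    have "avg (2 ^ L) N (\<lambda>u. F i (lead L (u i))) \<le> (\<Sum>j\<le>L. F i j / 2 ^ j)"
      by (rule avg_lead_le[OF i F0])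
    also have "\<dots> \<le> (\<Sum>j\<le>L. (conc\<^sup>2 + 4 * ?\<mu>) * \<Lambda>\<^sup>2 * (1 / real (?r i)))"
    proof (rule sum_mono)
      fix j assume j: "j \<in> {..L}"
      have r: "1 \<le> ?r i" "?r i \<le> n" using rank_pos[OF i] rank_le[of N w i] N(2) by (auto intro: le_trans)
      have "2 ^ j \<le> (2 :: nat) ^ L" using j by (intro power_increasing) auto
      then have "2 ^ j \<le> n" using N by linarith
      then have k: "1 \<le> (2 :: nat) ^ j" "2 ^ j \<le> n" by simp_all
      show "F i j / 2 ^ j \<le> (conc\<^sup>2 + 4 * ?\<mu>) * \<Lambda>\<^sup>2 * (1 / real (?r i))"
      proof (cases "real (2 ^ j) \<le> ?\<mu> * real (?r i)")
        case True
        have "F i j / 2 ^ j = (phi (2 ^ j))\<^sup>2 / real (2 ^ j) * (w i)\<^sup>2" using True by (simp add: F_def)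
        also have "\<dots> \<le> (conc\<^sup>2 + 4 * ?\<mu>) * (phi (?r i))\<^sup>2 / real (?r i) * (w i)\<^sup>2"
          by (intro mult_right_mono phi_sq_le[OF r k True \<mu>]) simp
        also have "\<dots> = (conc\<^sup>2 + 4 * ?\<mu>) * (\<bar>w i\<bar> * phi (?r i))\<^sup>2 * (1 / real (?r i))"
          by (simp add: power_mult_distrib)
        also have "\<dots> \<le> (conc\<^sup>2 + 4 * ?\<mu>) * \<Lambda>\<^sup>2 * (1 / real (?r i))"
          using wr[OF i] phi_nonneg \<mu> by (intro mult_right_mono mult_left_mono power_mono) auto
        finally show ?thesis .
      next
        case False
        then show ?thesis using \<mu> by (simp add: F_def)
      qed
    qed
    also have "\<dots> = (real L + 1) * (conc\<^sup>2 + 4 * ?\<mu>) * \<Lambda>\<^sup>2 * (1 / real (?r i))" by (simp add: mult.assoc add.commute)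
    finally show ?thesis .
  qed
  have avg_total: "avg (2 ^ L) N (\<lambda>u. \<Sum>i<N. F i (lead L (u i))) \<le> ?A"
  proof -
    have "avg (2 ^ L) N (\<lambda>u. \<Sum>i<N. F i (lead L (u i))) \<le> (\<Sum>i<N. (real L + 1) * (conc\<^sup>2 + 4 * ?\<mu>) * \<Lambda>\<^sup>2 * (1 / real (?r i)))"
      unfolding avg_sum by (rule sum_mono) (use avgF in auto)
    also have "\<dots> = (real L + 1) * (conc\<^sup>2 + 4 * ?\<mu>) * \<Lambda>\<^sup>2 * (\<Sum>i<N. 1 / real (?r i))"
      by (simp add: sum_distrib_left)
    also have "\<dots> \<le> (real L + 1) * (conc\<^sup>2 + 4 * ?\<mu>) * \<Lambda>\<^sup>2 * harm N"
      using \<mu> by (intro mult_left_mono sum_inverse_rank) auto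
    finally show ?thesis by (simp add: mult_ac)
  qed
  have large: "pr (2 ^ L) N (\<lambda>u. \<exists>i\<in>{..<N}. ?\<mu> * real (?r i) < 2 ^ lead L (u i)) \<le> 1/40"
  proof -
    have "pr (2 ^ L) N (\<lambda>u. \<exists>i\<in>{..<N}. ?\<mu> * real (?r i) < 2 ^ lead L (u i))
        \<le> (\<Sum>i<N. pr (2 ^ L) N (\<lambda>u. ?\<mu> * real (?r i) < 2 ^ lead L (u i)))"
      by (rule pr_Ex) simp
    also have "\<dots> \<le> (\<Sum>i<N. (real L + 1) / (?\<mu> * real (?r i)))"
    proof (rule sum_mono)
      fix i assume "i \<in> {..<N}"
      then have "0 < ?\<mu> * real (?r i)" using \<mu> rank_pos[of i N w] by simp
      then show "pr (2 ^ L) N (\<lambda>u. ?\<mu> * real (?r i) < 2 ^ lead L (u i)) \<le> (real L + 1) / (?\<mu> * real (?r i))"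
        using \<open>i \<in> {..<N}\<close> by (intro pr_lead_large) auto
    qed
    also have "\<dots> = (real L + 1) / ?\<mu> * (\<Sum>i<N. 1 / real (?r i))"
      by (simp add: sum_distrib_left)
    also have "\<dots> \<le> (real L + 1) / ?\<mu> * harm N"
      using \<mu> by (intro mult_left_mono sum_inverse_rank) auto
    also have "\<dots> = 1 / 40" using harm1 by (simp add: trunc_def)
    finally show ?thesis .
  qed
  have split: "(\<Sum>i<N. (weight L (u i) * w i)\<^sup>2) = (\<Sum>i<N. F i (lead L (u i)))"
    if "\<not> (\<exists>i\<in>{..<N}. ?\<mu> * real (?r i) < 2 ^ lead L (u i))" for u
  proof (rule sum.cong)
    fix i assume "i \<in> {..<N}"
    then have "real (2 ^ lead L (u i)) \<le> ?\<mu> * real (?r i)" using that by (simp add: not_less)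
    then show "(weight L (u i) * w i)\<^sup>2 = F i (lead L (u i))" by (simp add: F_def weight_def power_mult_distrib)
  qed simp
  show ?thesis
  \<comment> \<open>Markov's inequality requires a positive threshold; for \<Lambda> = 0 the vector
    itself vanishes.\<close>
  proof (cases "\<Lambda> = 0")
    case True
    have "w i = 0" if "i < N" for i
    proof -
      have "0 < phi (?r i)" using rank_pos[OF that] by (rule phi_pos)
      then show ?thesis using wr[OF that] True by (simp add: mult_le_0_iff)
    qed
    then have "(\<Sum>i<N. (weight L (u i) * w i)\<^sup>2) = 0" for u by simp
    then show ?thesis using True by (simp add: avg_def)
  next
    case False
    then have A: "0 < ?A" using \<mu> harm1 \<Lambda> N(1) by (intro mult_pos_pos add_nonneg_pos) auto
    have "pr (2 ^ L) N (\<lambda>u. 40 * ?A < (\<Sum>i<N. (weight L (u i) * w i)\<^sup>2))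
        \<le> pr (2 ^ L) N (\<lambda>u. (\<exists>i\<in>{..<N}. ?\<mu> * real (?r i) < 2 ^ lead L (u i)) \<or> 40 * ?A < (\<Sum>i<N. F i (lead L (u i))))"
    proof (rule avg_mono)
      fix u
      show "of_bool (40 * ?A < (\<Sum>i<N. (weight L (u i) * w i)\<^sup>2))
        \<le> (of_bool ((\<exists>i\<in>{..<N}. ?\<mu> * real (?r i) < 2 ^ lead L (u i)) \<or> 40 * ?A < (\<Sum>i<N. F i (lead L (u i)))) :: real)"
      proof (cases "\<exists>i\<in>{..<N}. ?\<mu> * real (?r i) < 2 ^ lead L (u i)")
        case False
        then show ?thesis unfolding split[OF False] by simp
      qed simp
    qed
    also have "\<dots> \<le> pr (2 ^ L) N (\<lambda>u. \<exists>i\<in>{..<N}. ?\<mu> * real (?r i) < 2 ^ lead L (u i))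
        + pr (2 ^ L) N (\<lambda>u. 40 * ?A < (\<Sum>i<N. F i (lead L (u i))))" by (rule pr_Un)
    also have "\<dots> \<le> 1/40 + ?A / (40 * ?A)"
    proof (intro add_mono large)
      have "pr (2 ^ L) N (\<lambda>u. 40 * ?A < (\<Sum>i<N. F i (lead L (u i))))
          \<le> avg (2 ^ L) N (\<lambda>u. \<Sum>i<N. F i (lead L (u i))) / (40 * ?A)"
        using A F0 by (intro pr_Markov sum_nonneg) auto
      also have "\<dots> \<le> ?A / (40 * ?A)" using A by (intro divide_right_mono avg_total) auto
      finally show "pr (2 ^ L) N (\<lambda>u. 40 * ?A < (\<Sum>i<N. F i (lead L (u i)))) \<le> ?A / (40 * ?A)" .
    qed
    also have "\<dots> = 1/20"
    proof -
      have "a / (40 * a) = 1 / 40" if "0 < a" for a :: real using that by simp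
      from this[OF A] show ?thesis by simp
    qed
    finally show ?thesis .
  qed
qed

end

section \<open>Uniform numbers from coin tosses\<close>

text \<open>Most significant bit first, the order in which the program shifts its coin tosses
  in.\<close>

primrec num :: "nat \<Rightarrow> bool stream \<Rightarrow> nat" where
  "num 0 \<omega> = 0"
| "num (Suc q) \<omega> = 2 * num q \<omega> + of_bool (\<omega> !! q)"

lemma num_less: "num q \<omega> < 2 ^ q"
  by (induction q) (auto simp: of_bool_def)

definition draws :: "nat \<Rightarrow> nat \<Rightarrow> bool stream \<Rightarrow> nat \<Rightarrow> nat" where
  "draws B N \<omega> = (\<lambda>i\<in>{..<N}. num B (sdrop (i * B) \<omega>))"

primrec digits :: "nat \<Rightarrow> nat \<Rightarrow> bool list" where
  "digits 0 x = []"
| "digits (Suc q) x = digits q (x div 2) @ [odd x]"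

lemma length_digits [simp]: "length (digits q x) = q"
  by (induction q arbitrary: x) auto

lemma num_digits: "x < 2 ^ q \<Longrightarrow> stake q \<omega> = digits q x \<Longrightarrow> num q \<omega> = x"
proof (induction q arbitrary: x)
  case (Suc q)
  from Suc.prems(2) have "stake q \<omega> @ [\<omega> !! q] = digits q (x div 2) @ [odd x]"
    by (simp only: stake_Suc digits.simps)
  then have "stake q \<omega> = digits q (x div 2)" "\<omega> !! q = odd x" by simp_all
  moreover have "x div 2 < 2 ^ q" using Suc.prems(1) by (simp add: less_mult_imp_div_less)
  ultimately show ?case using Suc.IH[of "x div 2"] by (cases "odd x") simp_all
qed simp

primrec blocks :: "nat \<Rightarrow> (nat \<Rightarrow> nat) \<Rightarrow> nat \<Rightarrow> bool list" where
  "blocks B f 0 = []"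
| "blocks B f (Suc N) = blocks B f N @ digits B (f N)"

lemma length_blocks [simp]: "length (blocks B f N) = N * B"
  by (induction N) auto

lemma num_blocks:
  "(\<And>i. i < N \<Longrightarrow> f i < 2 ^ B) \<Longrightarrow> stake (N * B) \<omega> = blocks B f N \<Longrightarrow> i < N \<Longrightarrow> num B (sdrop (i * B) \<omega>) = f i"
proof (induction N)
  case (Suc N)
  have eq: "stake (N * B) \<omega> @ stake B (sdrop (N * B) \<omega>) = blocks B f N @ digits B (f N)"
    using Suc.prems(2) by (simp add: stake_add add.commute)
  have "stake (N * B) \<omega> = blocks B f N \<and> stake B (sdrop (N * B) \<omega>) = digits B (f N)"
    by (rule append_eq_append_conv[THEN iffD1, OF disjI1, OF _ eq]) simp
  then show ?case using Suc num_digits[of "f N" B "sdrop (N * B) \<omega>"] by (auto simp: less_Suc_eq)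
qed simp

lemma draws_blocks:
  assumes "f \<in> Pi\<^sub>E {..<N} (\<lambda>_. {..<2 ^ B})" "stake (N * B) \<omega> = blocks B f N"
  shows "draws B N \<omega> = f"
proof
  fix i
  show "draws B N \<omega> i = f i"
    using assms num_blocks[of N f B \<omega> i] by (cases "i < N") (auto simp: draws_def PiE_iff extensional_def)
qed

lemma prob_space_coin_tosses: "prob_space coin_tosses"
  by (rule prob_space.prob_space_stream_space) (rule prob_space_measure_pmf)

lemma space_coin_tosses: "space coin_tosses = UNIV"
  by (simp add: space_stream_space)

lemma prob_prefix: "measure coin_tosses {\<omega>. stake (length bs) \<omega> = bs} = (1/2) ^ length bs"
proof (induction bs)
  case Nil
  then show ?case using prob_space.prob_space[OF prob_space_coin_tosses] by (simp add: space_coin_tosses)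
next
  case (Cons b bs)
  let ?M = "measure_pmf (bernoulli_pmf (1/2))"
  have [measurable]: "{\<omega> \<in> space coin_tosses. stake k \<omega> = cs} \<in> sets coin_tosses" for k cs
    by measurable
  have "ennreal (measure coin_tosses {\<omega> \<in> space coin_tosses. stake (length (b # bs)) \<omega> = b # bs})
      = (\<integral>\<^sup>+x. ennreal (measure coin_tosses {\<omega> \<in> space coin_tosses. stake (length (b # bs)) (x ## \<omega>) = b # bs}) \<partial>?M)"
    by (rule prob_space.prob_stream_space[OF prob_space_measure_pmf]) simp
  also have "\<dots> = (\<integral>\<^sup>+x. ennreal ((1/2) ^ length bs) * indicator {b} x \<partial>?M)"
  proof (rule nn_integral_cong)
    fix x
    show "ennreal (measure coin_tosses {\<omega> \<in> space coin_tosses. stake (length (b # bs)) (x ## \<omega>) = b # bs})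
        = ennreal ((1/2) ^ length bs) * indicator {b} x"
      using Cons by (cases "x = b") (simp_all add: space_coin_tosses)
  qed
  also have "\<dots> = ennreal ((1/2) ^ length bs) * ennreal (1/2)"
  proof -
    have "pmf (bernoulli_pmf (1/2)) b = 1/2" by (cases b) simp_all
    then show ?thesis by (subst nn_integral_cmult_indicator) (simp_all only: emeasure_pmf_single sets_measure_pmf UNIV_I Pow_UNIV)
  qed
  also have "\<dots> = ennreal ((1/2) ^ length bs * (1/2))" by (rule ennreal_mult[symmetric]) simp_all
  also have "(1/2 :: real) ^ length bs * (1/2) = (1/2) ^ length (b # bs)" by simp
  finally show ?case by (simp add: space_coin_tosses)
qed

lemma measurable_stake_coin: "{\<omega>. stake k \<omega> \<in> X} \<in> sets coin_tosses"
proof -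
  have "{\<omega> \<in> space coin_tosses. stake k \<omega> \<in> X} \<in> sets coin_tosses" by measurable
  then show ?thesis by (simp add: space_coin_tosses)
qed

lemma num_stake:
  fixes z :: "bool stream"
  shows "num q (sdrop k \<omega>) = num q (sdrop k (stake (k + q + r) \<omega> @- z))"
proof -
  have "p \<le> q \<Longrightarrow> num p (sdrop k \<omega>) = num p (sdrop k (stake (k + q + r) \<omega> @- z))" for p
  proof (induction p)
    case (Suc p)
    have "sdrop k \<omega> !! p = sdrop k (stake (k + q + r) \<omega> @- z) !! p"
      using Suc.prems by (simp add: sdrop_snth shift_snth_less)
    then show ?case using Suc by simp
  qed simp
  then show ?thesis by simp
qed

text \<open>The draws are functions of the first N * B + N * B' tosses, and every set of prefixes
  yields a measurable event, so Q can be arbitrary.\<close>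

lemma measurable_draws:
  "{\<omega> \<in> space coin_tosses. Q (draws B N \<omega>) (draws B' N (sdrop (N * B) \<omega>))} \<in> sets coin_tosses"
proof -
  let ?T = "N * B + N * B'"
  let ?c = "\<lambda>xs. xs @- (undefined :: bool stream)"
  have "draws B N \<omega> = draws B N (?c (stake ?T \<omega>))" for \<omega>
  proof (rule ext)
    fix i
    have "num B (sdrop (i * B) \<omega>) = num B (sdrop (i * B) (?c (stake ?T \<omega>)))" if "i < N"
    proof -
      have "Suc i * B \<le> N * B" using that by (intro mult_right_mono) auto
      then obtain r where "?T = i * B + B + r" using le_Suc_ex[of "i * B + B" ?T] by auto
      then show ?thesis using num_stake[of B "i * B" \<omega> r] by (simp only:)
    qed
    then show "draws B N \<omega> i = draws B N (?c (stake ?T \<omega>)) i" by (simp add: draws_def)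
  qed
  moreover have "draws B' N (sdrop (N * B) \<omega>) = draws B' N (sdrop (N * B) (?c (stake ?T \<omega>)))" for \<omega>
  proof (rule ext)
    fix i
    have "num B' (sdrop (N * B + i * B') \<omega>) = num B' (sdrop (N * B + i * B') (?c (stake ?T \<omega>)))" if "i < N"
    proof -
      have "Suc i * B' \<le> N * B'" using that by (intro mult_right_mono) auto
      then obtain r where "?T = (N * B + i * B') + B' + r" using le_Suc_ex[of "(N * B + i * B') + B'" ?T] by auto
      then show ?thesis using num_stake[of B' "N * B + i * B'" \<omega> r] by (simp only:)
    qed
    moreover have "draws B' N (sdrop (N * B) x) i = (if i < N then num B' (sdrop (N * B + i * B') x) else undefined)" for x
      by (simp add: draws_def)
    ultimately show "draws B' N (sdrop (N * B) \<omega>) i = draws B' N (sdrop (N * B) (?c (stake ?T \<omega>))) i"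
      by presburger
  qed
  ultimately have eq: "{\<omega> \<in> space coin_tosses. Q (draws B N \<omega>) (draws B' N (sdrop (N * B) \<omega>))}
    = {\<omega>. stake ?T \<omega> \<in> {xs. Q (draws B N (?c xs)) (draws B' N (sdrop (N * B) (?c xs)))}}"
    by (simp add: space_coin_tosses)
  show ?thesis
    unfolding eq by (rule measurable_stake_coin)
qed

text \<open>Each pair (f, g) owns the cylinder of its concatenated binary digits, of probability 2 ^
  (- N * B - N * B'). The cylinders of the good pairs are disjoint and lie in the event.\<close>

lemma prob_draws:
  "avg (2 ^ B) N (\<lambda>f. avg (2 ^ B') N (\<lambda>g. of_bool (Q f g)))
    \<le> measure coin_tosses {\<omega> \<in> space coin_tosses. Q (draws B N \<omega>) (draws B' N (sdrop (N * B) \<omega>))}"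
proof -
  interpret C: prob_space coin_tosses by (rule prob_space_coin_tosses)
  let ?F = "Pi\<^sub>E {..<N} (\<lambda>_. {..<2 ^ B :: nat})" and ?G = "Pi\<^sub>E {..<N} (\<lambda>_. {..<2 ^ B' :: nat})"
  let ?T = "N * B + N * B'"
  let ?bs = "\<lambda>(f, g). blocks B f N @ blocks B' g N"
  let ?E = "\<lambda>p. {\<omega>. stake ?T \<omega> = ?bs p}"
  let ?S = "{(f, g). f \<in> ?F \<and> g \<in> ?G \<and> Q f g}"
  have fin: "finite ?S" by (rule finite_subset[of _ "?F \<times> ?G"]) (auto simp: finite_maps)
  have det: "draws B N \<omega> = f \<and> draws B' N (sdrop (N * B) \<omega>) = g"
    if "f \<in> ?F" "g \<in> ?G" "stake ?T \<omega> = ?bs (f, g)" for f g \<omega>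
  proof -
    have eq: "stake (N * B) \<omega> @ stake (N * B') (sdrop (N * B) \<omega>) = blocks B f N @ blocks B' g N"
      using that(3) by (simp add: stake_add)
    have "stake (N * B) \<omega> = blocks B f N \<and> stake (N * B') (sdrop (N * B) \<omega>) = blocks B' g N"
      by (rule append_eq_append_conv[THEN iffD1, OF disjI1, OF _ eq]) simp
    then show ?thesis using draws_blocks that(1,2) by blast
  qed
  have E_sets: "?E p \<in> sets coin_tosses" for p using measurable_stake_coin[of ?T "{?bs p}"] by simp
  have E_prob: "measure coin_tosses (?E p) = (1/2) ^ ?T" for p
    using prob_prefix[of "?bs p"] by (cases p) simp
  have "avg (2 ^ B) N (\<lambda>f. avg (2 ^ B') N (\<lambda>g. of_bool (Q f g)))
      = (\<Sum>f\<in>?F. \<Sum>g\<in>?G. of_bool (Q f g) * (1/2) ^ ?T)"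
    by (simp add: avg_def sum_divide_distrib power_add power_mult[symmetric] mult.commute power_one_over field_simps)
  also have "\<dots> = (\<Sum>p\<in>?F \<times> ?G. of_bool (Q (fst p) (snd p)) * (1/2) ^ ?T)"
    by (simp add: sum.cartesian_product case_prod_unfold)
  also have "\<dots> = (\<Sum>p\<in>?S. (1/2) ^ ?T)"
    using finite_maps by (intro sum.mono_neutral_cong_right) auto
  also have "\<dots> = (\<Sum>p\<in>?S. measure coin_tosses (?E p))" by (simp only: E_prob)
  also have "\<dots> = measure coin_tosses (\<Union>p\<in>?S. ?E p)"
  proof (rule C.finite_measure_finite_Union[symmetric, OF fin])
    show "?E ` ?S \<subseteq> sets coin_tosses" using E_sets by blast
    show "disjoint_family_on ?E ?S"
      unfolding disjoint_family_on_def
    proof (intro ballI impI)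
      fix p p' assume p: "p \<in> ?S" "p' \<in> ?S" "p \<noteq> p'"
      show "?E p \<inter> ?E p' = {}"
      proof (rule ccontr)
        assume "?E p \<inter> ?E p' \<noteq> {}"
        then obtain \<omega> where "stake ?T \<omega> = ?bs p" "stake ?T \<omega> = ?bs p'" by blast
        then have "p = p'" using det[of "fst p" "snd p" \<omega>] det[of "fst p'" "snd p'" \<omega>] p(1,2)
          by (auto simp: case_prod_unfold prod_eq_iff)
        then show False using p(3) by simp
      qed
    qed
  qed
  also have "\<dots> \<le> measure coin_tosses {\<omega> \<in> space coin_tosses. Q (draws B N \<omega>) (draws B' N (sdrop (N * B) \<omega>))}"
  proof (rule C.finite_measure_mono)
    show "(\<Union>p\<in>?S. ?E p) \<subseteq> {\<omega> \<in> space coin_tosses. Q (draws B N \<omega>) (draws B' N (sdrop (N * B) \<omega>))}"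
      using det by (force simp: space_coin_tosses)
  qed (rule measurable_draws)
  finally show ?thesis .
qed

section \<open>Reasoning about programs\<close>

text \<open>Total correctness with a time bound. Existence of a terminating run suffices, since
  \<open>exec_deterministic\<close> makes it the only one.\<close>

definition wp :: "nat \<Rightarrow> (real vec \<Rightarrow> real) \<Rightarrow> prog \<Rightarrow> nat \<Rightarrow> (state \<Rightarrow> bool stream \<Rightarrow> bool) \<Rightarrow> state \<Rightarrow> bool stream \<Rightarrow> bool" where
  "wp n l P T Post s \<omega> \<longleftrightarrow> (\<exists>t s' \<omega>'. exec n l P (s, \<omega>) t (s', \<omega>') \<and> t \<le> T \<and> Post s' \<omega>')"

lemma wp_mono:
  "wp n l P T Post s \<omega> \<Longrightarrow> T \<le> T' \<Longrightarrow> (\<And>s' \<omega>'. Post s' \<omega>' \<Longrightarrow> Post' s' \<omega>') \<Longrightarrow> wp n l P T' Post' s \<omega>"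
  unfolding wp_def by (meson le_trans)

lemma wp_seq:
  "wp n l P T (\<lambda>s' \<omega>'. wp n l Q T' Post s' \<omega>') s \<omega> \<Longrightarrow> wp n l (Seq P Q) (T + T') Post s \<omega>"
  unfolding wp_def by (meson add_mono exec_Seq)

lemma wp_ifn:
  assumes "0 < nreg s a \<Longrightarrow> wp n l P T Post s \<omega>" "nreg s a = 0 \<Longrightarrow> wp n l Q T Post s \<omega>"
  shows "wp n l (IfNPos a P Q) (T + 1) Post s \<omega>"
proof (cases "0 < nreg s a")
  case True
  then show ?thesis using assms(1) exec_IfN_True[OF True] unfolding wp_def by (meson add_le_mono1)
next
  case False
  then have "nreg s a = 0" by simp
  then show ?thesis using assms(2) exec_IfN_False unfolding wp_def by (meson add_le_mono1)
qed

lemma wp_flip: "1 \<le> T \<Longrightarrow> Post (s\<lparr>nreg := (nreg s)(a := of_bool (shd \<omega>))\<rparr>) (stl \<omega>) \<Longrightarrow> wp n l (Flip a) T Post s \<omega>"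
  unfolding wp_def using exec_Flip by blast

lemma wp_query:
  "nreg s b \<le> n \<Longrightarrow> Post (s\<lparr>rreg := (rreg s)(a := restr_norm n l (nreg s b) (vec (nreg s b) (rarr s j)))\<rparr>) \<omega> \<Longrightarrow>
    wp n l (NormQuery a j b) (nreg s b + 1) Post s \<omega>"
  unfolding wp_def using exec_NormQuery[OF refl] by blast

fun block :: "instr list \<Rightarrow> prog" where
  "block [] = Instr (NConst 29 0)"
| "block [i] = Instr i"
| "block (i # is) = Seq (Instr i) (block is)"

fun run :: "instr list \<Rightarrow> state \<Rightarrow> state" where
  "run [] s = s"
| "run (i # is) s = run is (effect i s)"

lemma exec_block: "is \<noteq> [] \<Longrightarrow> exec n l (block is) (s, \<omega>) (length is) (run is s, \<omega>)"
proof (induction "is" arbitrary: s rule: block.induct)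
  case (2 i)
  then show ?case using exec_Instr[of n l i s \<omega>] by simp
next
  case (3 i j js)
  have "exec n l (Seq (Instr i) (block (j # js))) (s, \<omega>) (1 + length (j # js)) (run (j # js) (effect i s), \<omega>)"
    by (rule exec_Seq[OF exec_Instr 3(1)]) simp
  then show ?case by simp
qed simp

lemma wp_block: "is \<noteq> [] \<Longrightarrow> length is \<le> T \<Longrightarrow> Post (run is s) \<omega> \<Longrightarrow> wp n l (block is) T Post s \<omega>"
  unfolding wp_def using exec_block by blast

text \<open>The language has no empty program; register 29 is a dump that nothing reads.\<close>

abbreviation skip :: prog where
  "skip \<equiv> Instr (NConst 29 0)"

lemma wp_skip: "1 \<le> T \<Longrightarrow> Post (s\<lparr>nreg := (nreg s)(29 := 0)\<rparr>) \<omega> \<Longrightarrow> wp n l skip T Post s \<omega>"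
  unfolding wp_def using exec_Instr[of n l "NConst 29 0" s \<omega>] by auto

text \<open>The time bound may vary with the round, as the doubling query lengths in
  \<open>prog_table\<close> require. The induction is on the number of remaining rounds.\<close>

lemma wp_while:
  assumes inv: "Inv 0 s \<omega>"
    and body: "\<And>j s \<omega>. j < J \<Longrightarrow> Inv j s \<omega> \<Longrightarrow> 0 < nreg s a \<and> wp n l P (T j) (Inv (Suc j)) s \<omega>"
    and exit: "\<And>s \<omega>. Inv J s \<omega> \<Longrightarrow> nreg s a = 0"
    and T: "(\<Sum>j<J. T j + 1) + 1 \<le> T'"
  shows "wp n l (WhileNPos a P) T' (Inv J) s \<omega>"
proof -
  have "k \<le> J \<Longrightarrow> Inv (J - k) s \<omega> \<Longrightarrow> wp n l (WhileNPos a P) ((\<Sum>j=J - k..<J. T j + 1) + 1) (Inv J) s \<omega>" for k s \<omega>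
  proof (induction k arbitrary: s \<omega>)
    case 0
    then have "exec n l (WhileNPos a P) (s, \<omega>) 1 (s, \<omega>)" using exit by (intro exec_While_False) simp
    then show ?case using 0 unfolding wp_def by force
  next
    case (Suc k)
    let ?j = "J - Suc k"
    have j: "?j < J" "Suc ?j = J - k" using Suc.prems(1) by auto
    from body[OF j(1) Suc.prems(2)] have pos: "0 < nreg s a" and "wp n l P (T ?j) (Inv (Suc ?j)) s \<omega>" by auto
    then obtain t s1 \<omega>1 where 1: "exec n l P (s, \<omega>) t (s1, \<omega>1)" "t \<le> T ?j" "Inv (Suc ?j) s1 \<omega>1"
      unfolding wp_def by blast
    have "wp n l (WhileNPos a P) ((\<Sum>j=J - k..<J. T j + 1) + 1) (Inv J) s1 \<omega>1"
      using Suc.IH[of s1 \<omega>1] Suc.prems(1) 1(3) j(2) by simp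
    then obtain t' s2 \<omega>2 where 2: "exec n l (WhileNPos a P) (s1, \<omega>1) t' (s2, \<omega>2)"
      "t' \<le> (\<Sum>j=J - k..<J. T j + 1) + 1" "Inv J s2 \<omega>2" unfolding wp_def by blast
    have "exec n l (WhileNPos a P) (s, \<omega>) (t + t' + 1) (s2, \<omega>2)" by (rule exec_While_True[OF pos 1(1) 2(1)])
    moreover have "(\<Sum>i=?j..<J. T i + 1) = (T ?j + 1) + (\<Sum>i=J - k..<J. T i + 1)"
      using sum.atLeast_Suc_lessThan[OF j(1), of "\<lambda>i. T i + 1"] j(2) by simp
    ultimately show ?case unfolding wp_def using 1(2) 2(2,3) by (intro exI[of _ "t + t' + 1"]) auto
  qed
  from this[of J s \<omega>] inv have "wp n l (WhileNPos a P) ((\<Sum>j<J. T j + 1) + 1) (Inv J) s \<omega>"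
    by (simp add: atLeast0LessThan)
  then show ?thesis using T wp_mono by blast
qed

text \<open>
  \<open>For i b c P\<close> runs \<open>P\<close> with natural register \<open>i\<close> counting from \<open>0\<close> up to the content of
  \<open>b\<close>; register \<open>c\<close> holds the number of remaining rounds and register 3 the constant 1.
\<close>

definition For :: "nat \<Rightarrow> nat \<Rightarrow> nat \<Rightarrow> prog \<Rightarrow> prog" where
  "For i b c P = Seq (block [NConst i 0, NSub c b i])
     (WhileNPos c (Seq P (block [NAdd i i 3, NSub c b i])))"

text \<open>\<open>stable\<close> makes the invariant survive changes of the two loop registers. The
  body has to preserve the counter, but may overwrite c, which is recomputed after each
  round.\<close>

lemma wp_for:
  assumes pre: "Inv 0 s \<omega>" "nreg s b = K" "nreg s 3 = 1"
    and regs: "i \<noteq> b" "i \<noteq> c" "c \<noteq> b" "i \<noteq> 3" "c \<noteq> 3"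
    and stable: "\<And>k s \<omega> x y. Inv k s \<omega> \<Longrightarrow> Inv k (s\<lparr>nreg := (nreg s)(i := x, c := y)\<rparr>) \<omega>"
    and body: "\<And>k s \<omega>. k < K \<Longrightarrow> Inv k s \<omega> \<Longrightarrow> nreg s i = k \<Longrightarrow> nreg s b = K \<Longrightarrow> nreg s 3 = 1 \<Longrightarrow>
      wp n l P T (\<lambda>s' \<omega>'. Inv (Suc k) s' \<omega>' \<and> nreg s' i = k \<and> nreg s' b = K \<and> nreg s' 3 = 1) s \<omega>"
    and post: "\<And>s \<omega>. Inv K s \<omega> \<Longrightarrow> nreg s b = K \<Longrightarrow> nreg s 3 = 1 \<Longrightarrow> Post s \<omega>"
    and time: "K * (T + 3) + 3 \<le> T'"
  shows "wp n l (For i b c P) T' Post s \<omega>"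
proof -
  define I where "I k s \<omega> \<longleftrightarrow> Inv k s \<omega> \<and> nreg s i = k \<and> nreg s c = K - k \<and> nreg s b = K \<and> nreg s 3 = 1" for k s \<omega>
  have "wp n l (For i b c P) (2 + (K * (T + 3) + 1)) (I K) s \<omega>"
    unfolding For_def
  proof (rule wp_seq)
    show "wp n l (block [NConst i 0, NSub c b i]) 2
      (wp n l (WhileNPos c (Seq P (block [NAdd i i 3, NSub c b i]))) (K * (T + 3) + 1) (I K)) s \<omega>"
    proof (rule wp_block)
      show "wp n l (WhileNPos c (Seq P (block [NAdd i i 3, NSub c b i]))) (K * (T + 3) + 1) (I K)
          (run [NConst i 0, NSub c b i] s) \<omega>"
      proof (rule wp_while[where T = "\<lambda>_. T + 2"])
        have "run [NConst i 0, NSub c b i] s = s\<lparr>nreg := (nreg s)(i := 0, c := K)\<rparr>"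
          using regs pre by simp
        then show "I 0 (run [NConst i 0, NSub c b i] s) \<omega>"
          using stable[OF pre(1), of 0 K] regs pre by (simp add: I_def)
      next
        fix k s \<omega> assume k: "k < K" and I: "I k s \<omega>"
        have "wp n l (Seq P (block [NAdd i i 3, NSub c b i])) (T + 2) (I (Suc k)) s \<omega>"
        proof (rule wp_seq, rule wp_mono)
          show "wp n l P T (\<lambda>s' \<omega>'. Inv (Suc k) s' \<omega>' \<and> nreg s' i = k \<and> nreg s' b = K \<and> nreg s' 3 = 1) s \<omega>"
            using body[OF k] I by (simp add: I_def)
          fix s' \<omega>' assume 1: "Inv (Suc k) s' \<omega>' \<and> nreg s' i = k \<and> nreg s' b = K \<and> nreg s' 3 = 1"
          have "run [NAdd i i 3, NSub c b i] s' = s'\<lparr>nreg := (nreg s')(i := Suc k, c := K - Suc k)\<rparr>"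
            using regs 1 by simp
          then have "I (Suc k) (run [NAdd i i 3, NSub c b i] s') \<omega>'"
            using stable[of "Suc k" s' \<omega>' "Suc k" "K - Suc k"] regs 1 by (simp add: I_def)
          then show "wp n l (block [NAdd i i 3, NSub c b i]) 2 (I (Suc k)) s' \<omega>'" by (intro wp_block) auto
        qed simp
        then show "0 < nreg s c \<and> wp n l (Seq P (block [NAdd i i 3, NSub c b i])) (T + 2) (I (Suc k)) s \<omega>"
          using k I by (simp add: I_def)
      qed (simp_all add: I_def algebra_simps)
    qed simp_all
  qed
  then show ?thesis by (rule wp_mono) (use time post in \<open>auto simp: I_def\<close>)
qed

section \<open>The regression program\<close>

text \<open>Numbers the distinct rows in order of first appearance. The second component lists them;
  the third maps a row to its number plus one, so that 0, the initial memory content, means not yet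
  met. This keeps the work proportional to the number of entries instead of n.\<close>

primrec ded :: "(nat \<Rightarrow> nat) \<Rightarrow> nat \<Rightarrow> nat \<times> (nat \<Rightarrow> nat) \<times> (nat \<Rightarrow> nat)" where
  "ded row_of 0 = (0, \<lambda>_. 0, \<lambda>_. 0)"
| "ded row_of (Suc e) = (case ded row_of e of (N, rl, seen) \<Rightarrow>
     if seen (row_of e) > 0 then (N, rl, seen) else (Suc N, rl(N := row_of e), seen(row_of e := Suc N)))"

lemma ded_props:
  assumes "ded row_of k = (N, rl, seen)"
  shows "N \<le> k \<and> (\<forall>i<N. seen (rl i) = Suc i \<and> rl i \<in> row_of ` {..<k}) \<and>
    (\<forall>r. 0 < seen r \<longrightarrow> seen r \<le> N \<and> rl (seen r - 1) = r) \<and> (\<forall>e<k. 0 < seen (row_of e))"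
  using assms
proof (induction k arbitrary: N rl seen)
  case (Suc k)
  obtain N0 rl0 seen0 where 0: "ded row_of k = (N0, rl0, seen0)" by (cases "ded row_of k") auto
  note IH = Suc.IH[OF 0]
  show ?case
  proof (cases "0 < seen0 (row_of k)")
    case True
    then have "N = N0" "rl = rl0" "seen = seen0" using Suc.prems 0 by auto
    then show ?thesis using IH True by (auto simp: less_Suc_eq)
  next
    case False
    then have eq: "N = Suc N0" "rl = rl0(N0 := row_of k)" "seen = seen0(row_of k := Suc N0)"
      using Suc.prems 0 by auto
    have "seen (rl i) = Suc i \<and> rl i \<in> row_of ` {..<Suc k}" if "i < N" for i
    proof (cases "i = N0")
      case True
      then show ?thesis by (simp add: eq)
    next
      case i: False
      then have "i < N0" using that eq by simp
      then have "seen0 (rl0 i) = Suc i" "rl0 i \<in> row_of ` {..<k}" using IH by auto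
      moreover from this have "rl0 i \<noteq> row_of k" using False by auto
      ultimately show ?thesis using i by (auto simp: eq)
    qed
    moreover have "seen r \<le> N \<and> rl (seen r - 1) = r" if "0 < seen r" for r
    proof (cases "r = row_of k")
      case True
      then show ?thesis by (simp add: eq)
    next
      case r: False
      then have "0 < seen0 r" using that eq by simp
      then have "seen0 r \<le> N0" "rl0 (seen0 r - 1) = r" using IH by auto
      moreover from this \<open>0 < seen0 r\<close> have "seen0 r - 1 \<noteq> N0" by linarith
      ultimately show ?thesis using r by (simp add: eq)
    qed
    moreover have "0 < seen (row_of e)" if "e < Suc k" for e
      using that IH by (auto simp: eq less_Suc_eq)
    ultimately show ?thesis using IH eq by auto
  qed
qed auto

definition bitlen :: "nat \<Rightarrow> nat" where
  "bitlen N = (LEAST j. N < 2 ^ j)"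

lemma bitlen: "N < 2 ^ bitlen N" "j < bitlen N \<Longrightarrow> 2 ^ j \<le> N"
proof -
  have "N < 2 ^ N" by (rule less_exp)
  then show "N < 2 ^ bitlen N" unfolding bitlen_def by (rule LeastI)
  show "2 ^ j \<le> N" if "j < bitlen N" using not_less_Least[of j "\<lambda>j. N < 2 ^ j"] that
    by (simp add: bitlen_def not_less)
qed

text \<open>Bookkeeping of the memory of the program below; scratch registers are not mentioned.\<close>

record mem =
  mN :: nat
  mm :: nat
  mM :: nat
  mseen :: "nat \<Rightarrow> nat"
  mrl :: "nat \<Rightarrow> nat"
  mH :: "nat \<Rightarrow> nat"
  moff :: "nat \<Rightarrow> nat"
  mones :: "nat \<Rightarrow> real"
  mT :: "nat \<Rightarrow> real"
  mW :: "nat \<Rightarrow> real"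
  mG :: "nat \<Rightarrow> real"

section \<open>Memory layout\<close>

locale input = sym_norm +
  fixes d :: nat and es :: "(nat \<times> nat \<times> real) list" and b :: "real vec"
begin

abbreviation "z \<equiv> length es"

definition row_of :: "nat \<Rightarrow> nat" where "row_of e = (if e < z then fst (es ! e) else 0)"
definition col_of :: "nat \<Rightarrow> nat" where "col_of e = (if e < z then fst (snd (es ! e)) else 0)"
definition val_of :: "nat \<Rightarrow> real" where "val_of e = (if e < z then snd (snd (es ! e)) else 0)"
definition bv :: "nat \<Rightarrow> real" where "bv i = (if i < n then b $ i else 0)"

text \<open>Natural registers 3 and 4 serve as the constants 1 and 0; 5 to 8 hold the number of
  nonzero rows, the sketch size, the column length (sketch size plus d) and the number of columns.
  Natural arrays 4 and 5 hold the buckets and the column addresses; real arrays 3 to 6 hold a vector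
  of ones, the values of \<open>phi\<close> at powers of two, the weights and the matrix stored
  column by column. Natural registers from 20 on are scratch.\<close>

definition st :: "mem \<Rightarrow> state \<Rightarrow> bool" where
  "st x s \<longleftrightarrow> nreg s 0 = n \<and> nreg s 1 = d \<and> nreg s 2 = z \<and> nreg s 3 = 1 \<and> nreg s 4 = 0 \<and>
     nreg s 5 = mN x \<and> nreg s 6 = mm x \<and> nreg s 7 = mM x \<and> nreg s 8 = Suc d \<and>
     narr s 0 = row_of \<and> narr s 1 = col_of \<and> narr s 2 = mseen x \<and> narr s 3 = mrl x \<and>
     narr s 4 = mH x \<and> narr s 5 = moff x \<and>
     rarr s 0 = val_of \<and> rarr s 1 = bv \<and> rarr s 3 = mones x \<and> rarr s 4 = mT x \<and>
     rarr s 5 = mW x \<and> rarr s 6 = mG x"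

definition empty_mem :: mem where
  "empty_mem = \<lparr>mN = 0, mm = 0, mM = 0, mseen = \<lambda>_. 0, mrl = \<lambda>_. 0, mH = \<lambda>_. 0, moff = \<lambda>_. 0,
     mones = \<lambda>_. 0, mT = \<lambda>_. 0, mW = \<lambda>_. 0, mG = \<lambda>_. 0\<rparr>"

end

section \<open>The phases of the program\<close>

definition prog_start :: prog where
  "prog_start = block [NConst 3 1, NAdd 8 1 3]"

definition prog_rows :: prog where
  "prog_rows = For 20 2 30 (Seq (block [NLoad 21 0 20, NLoad 22 2 21])
     (IfNPos 22 skip (block [NStore 3 5 21, NAdd 5 5 3, NStore 2 21 5])))"

definition prog_ones :: prog where
  "prog_ones = For 20 5 30 (block [ROfNat 0 3, RStore 3 20 0])"

text \<open>Only lengths that are powers of two are queried, so the query times form a geometric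
  series and stay linear in the number of nonzero rows.\<close>

definition prog_table :: prog where
  "prog_table = Seq (block [NConst 20 1, NAdd 21 5 3, NSub 30 21 20])
     (WhileNPos 30 (Seq (NormQuery 0 3 20) (block [RStore 4 20 0, NAdd 20 20 20, NAdd 21 5 3, NSub 30 21 20])))"

text \<open>The machine cannot multiply naturals: register 20 doubles until it reaches d + 1 while
  register 6 quadruples, so the sketch size becomes a power of two of order d ^ 2.\<close>

definition prog_size :: prog where
  "prog_size = Seq (block [NConst 20 1, NConst 6 512, NSub 30 8 20])
     (WhileNPos 30 (block [NAdd 20 20 20, NAdd 6 6 6, NAdd 6 6 6, NSub 30 8 20]))"

definition prog_offsets :: prog where
  "prog_offsets = Seq (block [NAdd 7 6 1, NConst 21 0]) (For 20 8 30 (block [NStore 5 20 21, NAdd 21 21 7]))"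

text \<open>Register 22 doubles as long as only zero bits have been read and so holds 2 ^
  \<open>lead\<close>; register 23 is 2 ^ q after q rounds. The loop test 2 * 2 ^ q \<le> N stops
  after as many bits as the floor of the binary logarithm of N.\<close>

definition prog_weights :: prog where
  "prog_weights = For 20 5 30 (Seq (block [NConst 21 0, NConst 22 1, NConst 23 1, NAdd 24 23 23, NAdd 25 5 3, NSub 31 25 24])
     (Seq (WhileNPos 31 (Seq (Flip 26) (Seq (block [NAdd 21 21 21, NAdd 21 21 26])
       (Seq (IfNPos 21 skip (block [NAdd 22 22 22])) (block [NAdd 23 23 23, NAdd 24 23 23, NAdd 25 5 3, NSub 31 25 24])))))
     (block [RLoad 0 4 22, RStore 5 20 0])))"

text \<open>A number below 2 * m is read bit by bit; its upper half stands for a negative sign. The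
  same pass adds the weighted right-hand side to column d, so b is read at the numbered rows
  only.\<close>

definition prog_hash :: prog where
  "prog_hash = For 20 5 30 (Seq (block [NConst 21 0, NConst 23 1, NAdd 25 6 6, NSub 31 25 23])
     (Seq (WhileNPos 31 (Seq (Flip 26) (block [NAdd 21 21 21, NAdd 21 21 26, NAdd 23 23 23, NAdd 25 6 6, NSub 31 25 23])))
     (Seq (block [NSub 27 6 3, NSub 27 21 27, RLoad 0 5 20])
     (Seq (IfNPos 27 (block [NSub 21 21 6, ROfNat 1 4, RSub 0 1 0]) skip)
     (block [RStore 5 20 0, NStore 4 20 21, NLoad 22 3 20, RLoad 1 1 22, RMul 1 1 0, NLoad 22 5 1, NAdd 22 22 21,
       RLoad 2 6 22, RAdd 2 2 1, RStore 6 22 2])))))"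

definition prog_entries :: prog where
  "prog_entries = For 20 2 30 (block [NLoad 21 0 20, NLoad 21 2 21, NSub 21 21 3, NLoad 22 4 21, NLoad 23 1 20, NLoad 23 5 23,
     NAdd 23 23 22, RLoad 0 5 21, RLoad 1 0 20, RMul 1 1 0, RLoad 2 6 23, RAdd 2 2 1, RStore 6 23 2])"

text \<open>Below the m sketched rows every matrix column gets its unit vector. Gram-Schmidt leaves
  these rows out of the inner products but updates them, so that column d ends up with the negated
  solution there.\<close>

definition prog_identity :: prog where
  "prog_identity = For 20 1 30 (block [NLoad 21 5 20, NAdd 21 21 6, NAdd 21 21 20, ROfNat 0 3, RStore 6 21 0])"

definition prog_mgs :: prog where
  "prog_mgs = For 20 8 30 (Seq (block [NLoad 21 5 20]) (For 40 20 31
     (Seq (block [NLoad 22 5 40, ROfNat 0 4, ROfNat 1 4])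
     (Seq (For 41 6 32 (block [NAdd 23 22 41, RLoad 2 6 23, NAdd 24 21 41, RLoad 3 6 24, RMul 3 3 2, RAdd 0 0 3, RMul 2 2 2, RAdd 1 1 2]))
     (Seq (block [RDiv 0 0 1])
     (For 41 7 32 (block [NAdd 23 22 41, RLoad 2 6 23, RMul 2 2 0, NAdd 24 21 41, RLoad 3 6 24, RSub 3 3 2, RStore 6 24 3])))))))"

definition prog_output :: prog where
  "prog_output = For 20 1 30 (block [NLoad 21 5 1, NAdd 21 21 6, NAdd 21 21 20, RLoad 0 6 21, ROfNat 1 4, RSub 0 1 0, RStore 2 20 0])"

section \<open>Correctness and running time of the phases\<close>

context input
begin

lemma wp_start:
  "wp n l prog_start 2 (\<lambda>s' \<omega>'. st empty_mem s' \<and> \<omega>' = \<omega>) (init_state n d es b) \<omega>"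
  unfolding prog_start_def
  by (rule wp_block) (auto simp: init_state_def st_def empty_mem_def row_of_def col_of_def val_of_def bv_def fun_eq_iff)

definition rows_mem :: "nat \<Rightarrow> mem \<Rightarrow> mem" where
  "rows_mem k x = x\<lparr>mN := fst (ded row_of k), mrl := fst (snd (ded row_of k)), mseen := snd (snd (ded row_of k))\<rparr>"

lemma wp_rows:
  assumes "st x s" "mN x = 0" "mrl x = (\<lambda>_. 0)" "mseen x = (\<lambda>_. 0)"
  shows "wp n l prog_rows (z * 9 + 3) (\<lambda>s' \<omega>'. st (rows_mem z x) s' \<and> \<omega>' = \<omega>) s \<omega>"
  unfolding prog_rows_def
proof (rule wp_for[where Inv = "\<lambda>k s' \<omega>'. st (rows_mem k x) s' \<and> \<omega>' = \<omega>" and K = z and T = "2 + (3 + 1)"])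
  show "st (rows_mem 0 x) s \<and> \<omega> = \<omega>" using assms by (simp add: rows_mem_def st_def)
  show "nreg s 2 = z" "nreg s 3 = 1" using assms by (simp_all add: st_def)
  fix k s' \<omega>' assume k: "k < z" "st (rows_mem k x) s' \<and> \<omega>' = \<omega>" "nreg s' 20 = k" "nreg s' 2 = z" "nreg s' 3 = 1"
  obtain N rl seen where D: "ded row_of k = (N, rl, seen)" by (cases "ded row_of k") auto
  show "wp n l (Seq (block [NLoad 21 0 20, NLoad 22 2 21]) (IfNPos 22 skip (block [NStore 3 5 21, NAdd 5 5 3, NStore 2 21 5])))
    (2 + (3 + 1)) (\<lambda>s'' \<omega>''. (st (rows_mem (Suc k) x) s'' \<and> \<omega>'' = \<omega>) \<and> nreg s'' 20 = k \<and> nreg s'' 2 = z \<and> nreg s'' 3 = 1) s' \<omega>'"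
    apply (rule wp_seq, rule wp_block, simp, simp)
    apply (rule wp_ifn)
     apply (rule wp_skip, simp)
     apply (use k D in \<open>simp add: st_def rows_mem_def\<close>)
    apply (rule wp_block, simp, simp)
    apply (use k D in \<open>simp add: st_def rows_mem_def\<close>)
    done
qed (auto simp: st_def)

lemma wp_ones:
  assumes "st x s" "mones x = (\<lambda>_. 0)"
  shows "wp n l prog_ones (mN x * 5 + 3) (\<lambda>s' \<omega>'. st (x\<lparr>mones := (\<lambda>i. of_bool (i < mN x))\<rparr>) s' \<and> \<omega>' = \<omega>) s \<omega>"
  unfolding prog_ones_def
proof (rule wp_for[where Inv = "\<lambda>k s' \<omega>'. st (x\<lparr>mones := (\<lambda>i. of_bool (i < k))\<rparr>) s' \<and> \<omega>' = \<omega>" and K = "mN x" and T = 2])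
  show "st (x\<lparr>mones := (\<lambda>i. of_bool (i < 0))\<rparr>) s \<and> \<omega> = \<omega>" using assms by (simp add: st_def)
  show "nreg s 5 = mN x" "nreg s 3 = 1" using assms by (simp_all add: st_def)
  fix k s' \<omega>' assume k: "k < mN x" "st (x\<lparr>mones := (\<lambda>i. of_bool (i < k))\<rparr>) s' \<and> \<omega>' = \<omega>" "nreg s' 20 = k"
  have "(\<lambda>i. of_bool (i < k) :: real)(k := 1) = (\<lambda>i. of_bool (i < Suc k))" by (auto simp: fun_eq_iff)
  then show "wp n l (block [ROfNat 0 3, RStore 3 20 0]) 2
    (\<lambda>s'' \<omega>''. (st (x\<lparr>mones := (\<lambda>i. of_bool (i < Suc k))\<rparr>) s'' \<and> \<omega>'' = \<omega>) \<and> nreg s'' 20 = k \<and> nreg s'' 5 = mN x \<and> nreg s'' 3 = 1) s' \<omega>'"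
    apply (intro wp_block)
      apply simp
     apply simp
    apply (use k in \<open>simp add: st_def\<close>)
    done
qed (auto simp: st_def)

definition table :: "nat \<Rightarrow> nat \<Rightarrow> real" where
  "table k p = (if \<exists>j<k. p = 2 ^ j then phi p else 0)"

lemma table_pow: "j < k \<Longrightarrow> table k (2 ^ j) = phi (2 ^ j)"
  by (auto simp: table_def)

lemma table_Suc: "(table k)(2 ^ k := phi (2 ^ k)) = table (Suc k)"
  by (auto simp: fun_eq_iff table_def less_Suc_eq)

lemma wp_table:
  assumes "st x s" "mT x = (\<lambda>_. 0)" "mones x = (\<lambda>i. of_bool (i < mN x))" "mN x \<le> n"
  shows "wp n l prog_table (2 * mN x + 6 * bitlen (mN x) + 4)
    (\<lambda>s' \<omega>'. st (x\<lparr>mT := table (bitlen (mN x))\<rparr>) s' \<and> \<omega>' = \<omega>) s \<omega>"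
proof -
  let ?N = "mN x"
  let ?J = "bitlen ?N"
  define I where "I j s' \<omega>' \<longleftrightarrow> st (x\<lparr>mT := table j\<rparr>) s' \<and> nreg s' 20 = 2 ^ j \<and> nreg s' 30 = Suc ?N - 2 ^ j \<and> \<omega>' = \<omega>" for j s' \<omega>'
  have T: "(\<Sum>j<?J. ((2 ^ j + 1) + 4) + 1) + 1 \<le> 2 * ?N + 6 * ?J + 1"
  proof -
    have "(\<Sum>j<k. 2 ^ j) = (2 :: nat) ^ k - 1" for k by (induction k) auto
    moreover have "(2 :: nat) ^ ?J - 1 \<le> 2 * ?N"
    proof (cases ?J)
      case (Suc j)
      then have "2 ^ j \<le> ?N" using bitlen(2)[of j ?N] by simp
      then show ?thesis using Suc by simp
    qed simp
    ultimately show ?thesis by (simp add: sum.distrib)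
  qed
  have "wp n l prog_table (3 + (2 * ?N + 6 * ?J + 1)) (I ?J) s \<omega>"
    unfolding prog_table_def
  proof (rule wp_seq, rule wp_block)
    show "wp n l (WhileNPos 30 (Seq (NormQuery 0 3 20) (block [RStore 4 20 0, NAdd 20 20 20, NAdd 21 5 3, NSub 30 21 20])))
      (2 * ?N + 6 * ?J + 1) (I ?J) (run [NConst 20 1, NAdd 21 5 3, NSub 30 21 20] s) \<omega>"
    proof (rule wp_while[where Inv = I and T = "\<lambda>j. (2 ^ j + 1) + 4"])
      have "(\<lambda>p. table 0 p) = (\<lambda>_. 0)" by (simp add: table_def fun_eq_iff)
      then show "I 0 (run [NConst 20 1, NAdd 21 5 3, NSub 30 21 20] s) \<omega>"
        using assms by (simp add: I_def st_def)
    next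
      fix j s' \<omega>' assume j: "j < ?J" "I j s' \<omega>'"
      have p: "2 ^ j \<le> ?N" using bitlen(2)[OF j(1)] .
      have r: "nreg s' 20 = 2 ^ j" "rarr s' 3 = (\<lambda>i. of_bool (i < ?N))" using j(2) assms(3) by (simp_all add: I_def st_def)
      have q: "restr_norm n l (nreg s' 20) (vec (nreg s' 20) (rarr s' 3)) = phi (2 ^ j)"
        unfolding r using p assms(4) by (subst restr_norm_vec) (auto simp: phi_def intro!: nf_cong)
      have "wp n l (Seq (NormQuery 0 3 20) (block [RStore 4 20 0, NAdd 20 20 20, NAdd 21 5 3, NSub 30 21 20]))
        ((nreg s' 20 + 1) + 4) (I (Suc j)) s' \<omega>'"
      proof (rule wp_seq, rule wp_query, unfold q, goal_cases)
        case 1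
        then show ?case using r p assms(4) by simp
      next
        case 2
        show ?case
          apply (rule wp_block, simp, simp)
          apply (use j r p table_Suc[of j] in \<open>simp add: I_def st_def\<close>)
          done
      qed
      moreover have "0 < nreg s' 30" using j(2) p by (simp add: I_def)
      ultimately show "0 < nreg s' 30 \<and> wp n l (Seq (NormQuery 0 3 20) (block [RStore 4 20 0, NAdd 20 20 20, NAdd 21 5 3, NSub 30 21 20]))
        ((2 ^ j + 1) + 4) (I (Suc j)) s' \<omega>'" unfolding r by simp
    next
      fix s' \<omega>' assume "I ?J s' \<omega>'"
      then show "nreg s' 30 = 0" using bitlen(1)[of ?N] by (simp add: I_def)
    qed (rule T)
  qed simp_all
  then show ?thesis by (rule wp_mono) (auto simp: I_def)
qed

definition dlen :: nat where
  "dlen = (LEAST j. Suc d \<le> 2 ^ j)"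

lemma dlen: "Suc d \<le> 2 ^ dlen" "j < dlen \<Longrightarrow> 2 ^ j < Suc d"
proof -
  have "Suc d \<le> 2 ^ Suc d" using less_exp[of "Suc d"] by simp
  then show "Suc d \<le> 2 ^ dlen" unfolding dlen_def by (rule LeastI)
  show "2 ^ j < Suc d" if "j < dlen" using not_less_Least[of j "\<lambda>j. Suc d \<le> 2 ^ j"] that
    by (simp add: dlen_def not_le)
qed

definition size_bits :: nat where
  "size_bits = 9 + 2 * dlen"

lemma wp_size:
  assumes "st x s"
  shows "wp n l prog_size (5 * dlen + 4) (\<lambda>s' \<omega>'. st (x\<lparr>mm := 2 ^ size_bits\<rparr>) s' \<and> \<omega>' = \<omega>) s \<omega>"
proof -
  define I where "I j s' \<omega>' \<longleftrightarrow> st (x\<lparr>mm := 2 ^ (9 + 2 * j)\<rparr>) s' \<and> nreg s' 20 = 2 ^ j \<and> nreg s' 30 = Suc d - 2 ^ j \<and> \<omega>' = \<omega>" for j s' \<omega>'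
  have "wp n l prog_size (3 + (5 * dlen + 1)) (I dlen) s \<omega>"
    unfolding prog_size_def
  proof (rule wp_seq, rule wp_block)
    show "wp n l (WhileNPos 30 (block [NAdd 20 20 20, NAdd 6 6 6, NAdd 6 6 6, NSub 30 8 20])) (5 * dlen + 1)
      (I dlen) (run [NConst 20 1, NConst 6 512, NSub 30 8 20] s) \<omega>"
    proof (rule wp_while[where Inv = I and T = "\<lambda>j. 4"])
      show "I 0 (run [NConst 20 1, NConst 6 512, NSub 30 8 20] s) \<omega>"
        using assms by (simp add: I_def st_def)
    next
      fix j s' \<omega>' assume j: "j < dlen" "I j s' \<omega>'"
      have p: "(2 :: nat) ^ (9 + 2 * Suc j) = 4 * 2 ^ (9 + 2 * j)" by (simp add: power_add)
      have "wp n l (block [NAdd 20 20 20, NAdd 6 6 6, NAdd 6 6 6, NSub 30 8 20]) 4 (I (Suc j)) s' \<omega>'"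
        apply (rule wp_block, simp, simp)
        apply (use j p in \<open>simp add: I_def st_def\<close>)
        done
      then show "0 < nreg s' 30 \<and> wp n l (block [NAdd 20 20 20, NAdd 6 6 6, NAdd 6 6 6, NSub 30 8 20]) 4 (I (Suc j)) s' \<omega>'"
        using j dlen(2)[OF j(1)] by (simp add: I_def)
    next
      fix s' \<omega>' assume "I dlen s' \<omega>'"
      then show "nreg s' 30 = 0" using dlen(1) by (simp add: I_def)
    qed simp
  qed simp_all
  then show ?thesis by (rule wp_mono) (auto simp: I_def size_bits_def)
qed

lemma wp_offsets:
  assumes "st x s" "moff x = (\<lambda>_. 0)"
  shows "wp n l prog_offsets (5 * Suc d + 5)
    (\<lambda>s' \<omega>'. st (x\<lparr>mM := mm x + d, moff := (\<lambda>c. if c < Suc d then c * (mm x + d) else 0)\<rparr>) s' \<and> \<omega>' = \<omega>) s \<omega>"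
proof -
  let ?M = "mm x + d"
  let ?x = "\<lambda>k. x\<lparr>mM := ?M, moff := (\<lambda>c. if c < k then c * ?M else 0)\<rparr>"
  have "wp n l prog_offsets (2 + (5 * Suc d + 3)) (\<lambda>s' \<omega>'. st (?x (Suc d)) s' \<and> \<omega>' = \<omega>) s \<omega>"
    unfolding prog_offsets_def
  proof (rule wp_seq, rule wp_block)
    show "wp n l (For 20 8 30 (block [NStore 5 20 21, NAdd 21 21 7])) (5 * Suc d + 3)
      (\<lambda>s' \<omega>'. st (?x (Suc d)) s' \<and> \<omega>' = \<omega>) (run [NAdd 7 6 1, NConst 21 0] s) \<omega>"
    proof (rule wp_for[where Inv = "\<lambda>k s' \<omega>'. st (?x k) s' \<and> nreg s' 21 = k * ?M \<and> \<omega>' = \<omega>" and K = "Suc d" and T = 2])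
      show "st (?x 0) (run [NAdd 7 6 1, NConst 21 0] s) \<and> nreg (run [NAdd 7 6 1, NConst 21 0] s) 21 = 0 * ?M \<and> \<omega> = \<omega>"
        using assms by (simp add: st_def)
      fix k s' \<omega>' assume k: "k < Suc d" "st (?x k) s' \<and> nreg s' 21 = k * ?M \<and> \<omega>' = \<omega>" "nreg s' 20 = k"
      have "(\<lambda>c. if c < k then c * ?M else 0)(k := k * ?M) = (\<lambda>c. if c < Suc k then c * ?M else 0)"
        by (auto simp: fun_eq_iff)
      then show "wp n l (block [NStore 5 20 21, NAdd 21 21 7]) 2
        (\<lambda>s'' \<omega>''. (st (?x (Suc k)) s'' \<and> nreg s'' 21 = Suc k * ?M \<and> \<omega>'' = \<omega>) \<and> nreg s'' 20 = k \<and> nreg s'' 8 = Suc d \<and> nreg s'' 3 = 1) s' \<omega>'"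
        apply (intro wp_block)
          apply simp
         apply simp
        apply (use k in \<open>simp add: st_def\<close>)
        done
    qed (use assms in \<open>auto simp: st_def\<close>)
  qed simp_all
  then show ?thesis by (rule wp_mono) auto
qed

end

text \<open>A further low-order bit lengthens the run of leading zeros only if every bit so far is
  zero, which is the update of register 22.\<close>

lemma lead_step: "lead (Suc q) (2 * u + of_bool c) = (if 2 * u + of_bool c = 0 then Suc (lead q u) else lead q u)"
proof -
  have "lead q 0 = q" by (cases q) auto
  then show ?thesis by (cases c) auto
qed

context input
begin

text \<open>The floor of the binary logarithm of the number of rows; without rows the truncated
  subtraction yields 0.\<close>

definition wbits :: "mem \<Rightarrow> nat" where
  "wbits x = bitlen (mN x) - 1"

lemma wbits: "1 \<le> mN x \<Longrightarrow> 2 ^ wbits x \<le> mN x" "mN x < 2 ^ Suc (wbits x)"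
proof -
  show "2 ^ wbits x \<le> mN x" if "1 \<le> mN x"
  proof (cases "bitlen (mN x)")
    case 0
    then show ?thesis using bitlen(1)[of "mN x"] that by simp
  next
    case (Suc j)
    then show ?thesis using bitlen(2)[of j "mN x"] by (simp add: wbits_def)
  qed
  have "mN x < 2 ^ bitlen (mN x)" by (rule bitlen)
  also have "\<dots> \<le> 2 ^ Suc (wbits x)" unfolding wbits_def by (intro power_increasing) auto
  finally show "mN x < 2 ^ Suc (wbits x)" .
qed

lemma wp_weights:
  assumes "st x s"
  shows "wp n l prog_weights (mN x * (10 * wbits x + 12) + 3)
    (\<lambda>s' \<omega>'. st (x\<lparr>mW := (\<lambda>i. if i < mN x then mT x (2 ^ lead (wbits x) (num (wbits x) (sdrop (i * wbits x) \<omega>))) else mW x i)\<rparr>) s'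
      \<and> \<omega>' = sdrop (mN x * wbits x) \<omega>) s \<omega>"
proof -
  let ?N = "mN x" and ?L = "wbits x"
  let ?x = "\<lambda>k. x\<lparr>mW := (\<lambda>i. if i < k then mT x (2 ^ lead ?L (num ?L (sdrop (i * ?L) \<omega>))) else mW x i)\<rparr>"
  let ?body = "Seq (Flip 26) (Seq (block [NAdd 21 21 21, NAdd 21 21 26])
       (Seq (IfNPos 21 skip (block [NAdd 22 22 22])) (block [NAdd 23 23 23, NAdd 24 23 23, NAdd 25 5 3, NSub 31 25 24])))"
  show ?thesis
    unfolding prog_weights_def
  proof (rule wp_for[where Inv = "\<lambda>k s' \<omega>'. st (?x k) s' \<and> \<omega>' = sdrop (k * ?L) \<omega>" and K = ?N and T = "6 + ((?L * 10 + 1) + 2)"])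
    show "st (?x 0) s \<and> \<omega> = sdrop (0 * ?L) \<omega>" "nreg s 5 = ?N" "nreg s 3 = 1" using assms by (simp_all add: st_def)
    fix k s' \<omega>' assume k: "k < ?N" "st (?x k) s' \<and> \<omega>' = sdrop (k * ?L) \<omega>" "nreg s' 20 = k"
    define I where "I q s2 \<omega>2 \<longleftrightarrow> st (?x k) s2 \<and> nreg s2 20 = k \<and> nreg s2 21 = num q \<omega>' \<and>
      nreg s2 22 = 2 ^ lead q (num q \<omega>') \<and> nreg s2 23 = 2 ^ q \<and> nreg s2 31 = Suc ?N - 2 * 2 ^ q \<and> \<omega>2 = sdrop q \<omega>'" for q s2 \<omega>2
    show "wp n l (Seq (block [NConst 21 0, NConst 22 1, NConst 23 1, NAdd 24 23 23, NAdd 25 5 3, NSub 31 25 24])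
      (Seq (WhileNPos 31 ?body) (block [RLoad 0 4 22, RStore 5 20 0]))) (6 + ((?L * 10 + 1) + 2))
      (\<lambda>s'' \<omega>''. (st (?x (Suc k)) s'' \<and> \<omega>'' = sdrop (Suc k * ?L) \<omega>) \<and> nreg s'' 20 = k \<and> nreg s'' 5 = ?N \<and> nreg s'' 3 = 1) s' \<omega>'"
    proof (rule wp_seq, rule wp_block)
      show "wp n l (Seq (WhileNPos 31 ?body) (block [RLoad 0 4 22, RStore 5 20 0])) ((?L * 10 + 1) + 2)
        (\<lambda>s'' \<omega>''. (st (?x (Suc k)) s'' \<and> \<omega>'' = sdrop (Suc k * ?L) \<omega>) \<and> nreg s'' 20 = k \<and> nreg s'' 5 = ?N \<and> nreg s'' 3 = 1)
        (run [NConst 21 0, NConst 22 1, NConst 23 1, NAdd 24 23 23, NAdd 25 5 3, NSub 31 25 24] s') \<omega>'"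
      proof (rule wp_seq, rule wp_mono)
        show "wp n l (WhileNPos 31 ?body) (?L * 10 + 1) (I ?L)
          (run [NConst 21 0, NConst 22 1, NConst 23 1, NAdd 24 23 23, NAdd 25 5 3, NSub 31 25 24] s') \<omega>'"
        proof (rule wp_while[where Inv = I and T = "\<lambda>_. 1 + (2 + ((1 + 1) + 4))"])
          show "I 0 (run [NConst 21 0, NConst 22 1, NConst 23 1, NAdd 24 23 23, NAdd 25 5 3, NSub 31 25 24] s') \<omega>'"
            using k by (simp add: I_def st_def)
        next
          fix q s2 \<omega>2 assume q: "q < ?L" "I q s2 \<omega>2"
          have "2 ^ Suc q \<le> (2 :: nat) ^ ?L" using q(1) by (intro power_increasing) auto
          then have "2 ^ Suc q \<le> ?N" using wbits(1)[of x] k(1) by linarith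
          then have "0 < nreg s2 31" using q(2) by (simp add: I_def)
          moreover have "wp n l ?body (1 + (2 + ((1 + 1) + 4))) (I (Suc q)) s2 \<omega>2"
            apply (rule wp_seq, rule wp_flip, simp)
            apply (rule wp_seq, rule wp_block, simp, simp)
            apply (rule wp_seq, rule wp_ifn)
             apply (rule wp_skip, simp)
             apply (rule wp_block, simp, simp)
             apply (use q(2) lead_step[of q "num q \<omega>'" "\<omega>' !! q"] in \<open>simp add: I_def st_def mult_2 del: lead.simps\<close>)
            apply (rule wp_block, simp, simp)
            apply (rule wp_block, simp, simp)
            apply (use q(2) lead_step[of q "num q \<omega>'" "\<omega>' !! q"] in \<open>simp add: I_def st_def mult_2 del: lead.simps\<close>)
            done
          ultimately show "0 < nreg s2 31 \<and> wp n l ?body (1 + (2 + ((1 + 1) + 4))) (I (Suc q)) s2 \<omega>2" by blast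
        next
          fix s2 \<omega>2 assume "I ?L s2 \<omega>2"
          then show "nreg s2 31 = 0" using wbits(2)[of x] by (simp add: I_def)
        qed simp
        fix s2 \<omega>2 assume I: "I ?L s2 \<omega>2"
        have x: "(\<lambda>i. if i < k then mT x (2 ^ lead ?L (num ?L (sdrop (i * ?L) \<omega>))) else mW x i)(k := mT x (2 ^ lead ?L (num ?L (sdrop (k * ?L) \<omega>))))
          = (\<lambda>i. if i < Suc k then mT x (2 ^ lead ?L (num ?L (sdrop (i * ?L) \<omega>))) else mW x i)" by (auto simp: fun_eq_iff)
        show "wp n l (block [RLoad 0 4 22, RStore 5 20 0]) 2
          (\<lambda>s'' \<omega>''. (st (?x (Suc k)) s'' \<and> \<omega>'' = sdrop (Suc k * ?L) \<omega>) \<and> nreg s'' 20 = k \<and> nreg s'' 5 = ?N \<and> nreg s'' 3 = 1) s2 \<omega>2"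
          apply (rule wp_block, simp, simp)
          apply (use I k(2) x in \<open>simp add: I_def st_def sdrop_add add.commute\<close>)
          done
      qed simp
    qed simp_all
  qed (auto simp: st_def)
qed

definition hashed :: "nat \<Rightarrow> mem \<Rightarrow> (nat \<Rightarrow> nat) \<Rightarrow> mem" where
  "hashed k x g = x\<lparr>mW := (\<lambda>i. if i < k then sig (mm x) (g i) * mW x i else mW x i),
     mH := (\<lambda>i. if i < k then bucket (mm x) (g i) else mH x i),
     mG := (\<lambda>a. \<Sum>i<k. if moff x d + bucket (mm x) (g i) = a then bv (mrl x i) * (sig (mm x) (g i) * mW x i) else 0)\<rparr>"

lemma wp_hash:
  assumes "st x s" "mm x = 2 ^ \<mu>" "mG x = (\<lambda>_. 0)"
  shows "wp n l prog_hash (mN x * (7 * Suc \<mu> + 25) + 3)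
    (\<lambda>s' \<omega>'. st (hashed (mN x) x (\<lambda>i. num (Suc \<mu>) (sdrop (i * Suc \<mu>) \<omega>))) s' \<and> \<omega>' = sdrop (mN x * Suc \<mu>) \<omega>) s \<omega>"
proof -
  let ?N = "mN x" and ?m = "mm x"
  define B where "B = Suc \<mu>"
  have mB: "2 ^ B = 2 * ?m" using assms(2) by (simp add: B_def)
  define g where "g = (\<lambda>i. num B (sdrop (i * B) \<omega>))"
  let ?x = "\<lambda>k. hashed k x g"
  let ?body = "Seq (Flip 26) (block [NAdd 21 21 21, NAdd 21 21 26, NAdd 23 23 23, NAdd 25 6 6, NSub 31 25 23])"
  let ?tail = "Seq (block [NSub 27 6 3, NSub 27 21 27, RLoad 0 5 20])
     (Seq (IfNPos 27 (block [NSub 21 21 6, ROfNat 1 4, RSub 0 1 0]) skip)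
     (block [RStore 5 20 0, NStore 4 20 21, NLoad 22 3 20, RLoad 1 1 22, RMul 1 1 0, NLoad 22 5 1, NAdd 22 22 21,
       RLoad 2 6 22, RAdd 2 2 1, RStore 6 22 2]))"
  have "wp n l prog_hash (?N * (7 * B + 25) + 3) (\<lambda>s' \<omega>'. st (hashed ?N x g) s' \<and> \<omega>' = sdrop (?N * B) \<omega>) s \<omega>"
    unfolding prog_hash_def
  proof (rule wp_for[where Inv = "\<lambda>k s' \<omega>'. st (?x k) s' \<and> \<omega>' = sdrop (k * B) \<omega>" and K = ?N and T = "4 + ((B * 7 + 1) + (3 + ((3 + 1) + 10)))"])
    show "st (?x 0) s \<and> \<omega> = sdrop (0 * B) \<omega>" "nreg s 5 = ?N" "nreg s 3 = 1" using assms by (simp_all add: st_def hashed_def)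
    fix k s' \<omega>' assume k: "k < ?N" "st (?x k) s' \<and> \<omega>' = sdrop (k * B) \<omega>" "nreg s' 20 = k"
    define I where "I q s2 \<omega>2 \<longleftrightarrow> st (?x k) s2 \<and> nreg s2 20 = k \<and> nreg s2 21 = num q \<omega>' \<and>
      nreg s2 23 = 2 ^ q \<and> nreg s2 31 = 2 ^ B - 2 ^ q \<and> \<omega>2 = sdrop q \<omega>'" for q s2 \<omega>2
    show "wp n l (Seq (block [NConst 21 0, NConst 23 1, NAdd 25 6 6, NSub 31 25 23]) (Seq (WhileNPos 31 ?body) ?tail))
      (4 + ((B * 7 + 1) + (3 + ((3 + 1) + 10))))
      (\<lambda>s'' \<omega>''. (st (?x (Suc k)) s'' \<and> \<omega>'' = sdrop (Suc k * B) \<omega>) \<and> nreg s'' 20 = k \<and> nreg s'' 5 = ?N \<and> nreg s'' 3 = 1) s' \<omega>'"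
    proof (rule wp_seq, rule wp_block)
      show "wp n l (Seq (WhileNPos 31 ?body) ?tail) ((B * 7 + 1) + (3 + ((3 + 1) + 10)))
        (\<lambda>s'' \<omega>''. (st (?x (Suc k)) s'' \<and> \<omega>'' = sdrop (Suc k * B) \<omega>) \<and> nreg s'' 20 = k \<and> nreg s'' 5 = ?N \<and> nreg s'' 3 = 1)
        (run [NConst 21 0, NConst 23 1, NAdd 25 6 6, NSub 31 25 23] s') \<omega>'"
      proof (rule wp_seq, rule wp_mono)
        show "wp n l (WhileNPos 31 ?body) (B * 7 + 1) (I B) (run [NConst 21 0, NConst 23 1, NAdd 25 6 6, NSub 31 25 23] s') \<omega>'"
        proof (rule wp_while[where Inv = I and T = "\<lambda>_. 1 + 5"])
          show "I 0 (run [NConst 21 0, NConst 23 1, NAdd 25 6 6, NSub 31 25 23] s') \<omega>'"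
            using k mB by (simp add: I_def st_def hashed_def mult_2)
        next
          fix q s2 \<omega>2 assume q: "q < B" "I q s2 \<omega>2"
          have "(2 :: nat) ^ q < 2 ^ B" using q(1) by (intro power_strict_increasing) auto
          then have "0 < nreg s2 31" using q(2) by (simp add: I_def)
          moreover have "wp n l ?body (1 + 5) (I (Suc q)) s2 \<omega>2"
            apply (rule wp_seq, rule wp_flip, simp)
            apply (rule wp_block, simp, simp)
            apply (use q(2) mB in \<open>simp add: I_def st_def mult_2 hashed_def\<close>)
            done
          ultimately show "0 < nreg s2 31 \<and> wp n l ?body (1 + 5) (I (Suc q)) s2 \<omega>2" by blast
        qed (simp_all add: I_def)
        fix s2 \<omega>2 assume I: "I B s2 \<omega>2"
        have g: "nreg s2 21 = g k" using I k(2) by (simp add: I_def g_def)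
        \<comment> \<open>Register 27 becomes g k - (m - 1) in truncated arithmetic, which for m > 0
          is positive exactly if g k \<ge> m, that is, for a negative sign.\<close>
        have m0: "0 < ?m" using assms(2) by simp
        have W: "(\<lambda>i. if i < k then sig ?m (g i) * mW x i else mW x i)(k := sig ?m (g k) * mW x k)
            = (\<lambda>i. if i < Suc k then sig ?m (g i) * mW x i else mW x i)" by (auto simp: fun_eq_iff)
        have H: "(\<lambda>i. if i < k then bucket ?m (g i) else mH x i)(k := bucket ?m (g k))
            = (\<lambda>i. if i < Suc k then bucket ?m (g i) else mH x i)" by (auto simp: fun_eq_iff)
        let ?G = "\<lambda>k a. \<Sum>i<k. if moff x d + bucket ?m (g i) = a then bv (mrl x i) * (sig ?m (g i) * mW x i) else 0"
        have G: "(?G k)(moff x d + bucket ?m (g k) := ?G k (moff x d + bucket ?m (g k)) + bv (mrl x k) * (sig ?m (g k) * mW x k)) = ?G (Suc k)"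
          by (auto simp: fun_eq_iff)
        let ?Q = "\<lambda>s'' \<omega>''. (st (?x (Suc k)) s'' \<and> \<omega>'' = sdrop (Suc k * B) \<omega>) \<and> nreg s'' 20 = k \<and> nreg s'' 5 = ?N \<and> nreg s'' 3 = 1"
        have fin: "wp n l (block [RStore 5 20 0, NStore 4 20 21, NLoad 22 3 20, RLoad 1 1 22, RMul 1 1 0, NLoad 22 5 1, NAdd 22 22 21,
            RLoad 2 6 22, RAdd 2 2 1, RStore 6 22 2]) 10 ?Q s3 \<omega>3"
          if "st (?x k) s3" "nreg s3 20 = k" "nreg s3 21 = bucket ?m (g k)" "rreg s3 0 = sig ?m (g k) * mW x k" "\<omega>3 = sdrop B \<omega>'" for s3 \<omega>3
          apply (rule wp_block, simp, simp)
          using that k(2) W H G by (simp add: st_def hashed_def sdrop_add add.commute del: sum.lessThan_Suc)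
        show "wp n l ?tail (3 + ((3 + 1) + 10)) ?Q s2 \<omega>2"
          apply (rule wp_seq, rule wp_block, simp, simp)
          apply (rule wp_seq, rule wp_ifn)
           apply (rule wp_block, simp, simp)
           apply (rule fin)
               apply (use I in \<open>simp add: I_def st_def hashed_def\<close>)
              apply (use I in \<open>simp add: I_def st_def hashed_def\<close>)
             apply (use I g m0 in \<open>simp add: I_def st_def hashed_def bucket_def\<close>)
            apply (use I g m0 in \<open>simp add: I_def st_def hashed_def sig_def\<close>)
           apply (use I in \<open>simp add: I_def\<close>)
          apply (rule wp_skip, simp)
          apply (rule fin)
              apply (use I in \<open>simp add: I_def st_def hashed_def\<close>)
             apply (use I in \<open>simp add: I_def st_def hashed_def\<close>)
            apply (use I g m0 in \<open>simp add: I_def st_def hashed_def bucket_def\<close>)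
           apply (use I g m0 in \<open>simp add: I_def st_def hashed_def sig_def\<close>)
          apply (use I in \<open>simp add: I_def\<close>)
          done
      qed simp
    qed simp_all
  qed (auto simp: st_def)
  then show ?thesis unfolding g_def B_def .
qed

definition with_entries :: "nat \<Rightarrow> mem \<Rightarrow> mem" where
  "with_entries k x = x\<lparr>mG := (\<lambda>a. mG x a + (\<Sum>e<k. if moff x (col_of e) + mH x (mseen x (row_of e) - 1) = a
     then val_of e * mW x (mseen x (row_of e) - 1) else 0))\<rparr>"

lemma wp_entries:
  assumes "st x s"
  shows "wp n l prog_entries (z * 16 + 3) (\<lambda>s' \<omega>'. st (with_entries z x) s' \<and> \<omega>' = \<omega>) s \<omega>"
  unfolding prog_entries_def
proof (rule wp_for[where Inv = "\<lambda>k s' \<omega>'. st (with_entries k x) s' \<and> \<omega>' = \<omega>" and K = z and T = 13])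
  show "st (with_entries 0 x) s \<and> \<omega> = \<omega>" "nreg s 2 = z" "nreg s 3 = 1" using assms by (simp_all add: st_def with_entries_def)
  fix k s' \<omega>' assume k: "k < z" "st (with_entries k x) s' \<and> \<omega>' = \<omega>" "nreg s' 20 = k"
  let ?a = "\<lambda>e. moff x (col_of e) + mH x (mseen x (row_of e) - 1)"
  let ?v = "\<lambda>e. val_of e * mW x (mseen x (row_of e) - 1)"
  let ?G = "\<lambda>k a. mG x a + (\<Sum>e<k. if ?a e = a then ?v e else 0)"
  have G: "(?G k)(?a k := ?G k (?a k) + ?v k) = ?G (Suc k)" by (auto simp: fun_eq_iff)
  show "wp n l (block [NLoad 21 0 20, NLoad 21 2 21, NSub 21 21 3, NLoad 22 4 21, NLoad 23 1 20, NLoad 23 5 23,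
     NAdd 23 23 22, RLoad 0 5 21, RLoad 1 0 20, RMul 1 1 0, RLoad 2 6 23, RAdd 2 2 1, RStore 6 23 2]) 13
    (\<lambda>s'' \<omega>''. (st (with_entries (Suc k) x) s'' \<and> \<omega>'' = \<omega>) \<and> nreg s'' 20 = k \<and> nreg s'' 2 = z \<and> nreg s'' 3 = 1) s' \<omega>'"
    apply (rule wp_block, simp, simp)
    using k G by (simp add: st_def with_entries_def del: sum.lessThan_Suc)
qed (auto simp: st_def)

definition with_identity :: "nat \<Rightarrow> mem \<Rightarrow> mem" where
  "with_identity k x = x\<lparr>mG := (\<lambda>a. if \<exists>j<k. a = moff x j + mm x + j then 1 else mG x a)\<rparr>"

lemma wp_identity:
  assumes "st x s"
  shows "wp n l prog_identity (d * 8 + 3) (\<lambda>s' \<omega>'. st (with_identity d x) s' \<and> \<omega>' = \<omega>) s \<omega>"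
  unfolding prog_identity_def
proof (rule wp_for[where Inv = "\<lambda>k s' \<omega>'. st (with_identity k x) s' \<and> \<omega>' = \<omega>" and K = d and T = 5])
  show "st (with_identity 0 x) s \<and> \<omega> = \<omega>" "nreg s 1 = d" "nreg s 3 = 1" using assms by (simp_all add: st_def with_identity_def)
  fix k s' \<omega>' assume k: "k < d" "st (with_identity k x) s' \<and> \<omega>' = \<omega>" "nreg s' 20 = k"
  let ?G = "\<lambda>k a. if \<exists>j<k. a = moff x j + mm x + j then 1 else mG x a"
  have G: "(?G k)(moff x k + mm x + k := 1) = ?G (Suc k)" by (auto simp: fun_eq_iff less_Suc_eq)
  show "wp n l (block [NLoad 21 5 20, NAdd 21 21 6, NAdd 21 21 20, ROfNat 0 3, RStore 6 21 0]) 5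
    (\<lambda>s'' \<omega>''. (st (with_identity (Suc k) x) s'' \<and> \<omega>'' = \<omega>) \<and> nreg s'' 20 = k \<and> nreg s'' 1 = d \<and> nreg s'' 3 = 1) s' \<omega>'"
    apply (rule wp_block, simp, simp)
    using k G by (simp add: st_def with_identity_def)
qed (auto simp: st_def)

end

section \<open>Gram-Schmidt on columns stored consecutively\<close>

context input
begin

lemma wp_ip:
  assumes "st x s" "nreg s 20 = j" "nreg s 40 = i" "nreg s 21 = a" "nreg s 22 = a'" "rreg s 0 = 0" "rreg s 1 = 0"
  shows "wp n l (For 41 6 32 (block [NAdd 23 22 41, RLoad 2 6 23, NAdd 24 21 41, RLoad 3 6 24, RMul 3 3 2, RAdd 0 0 3, RMul 2 2 2, RAdd 1 1 2]))
    (mm x * 11 + 3)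
    (\<lambda>s' \<omega>'. st x s' \<and> nreg s' 20 = j \<and> nreg s' 40 = i \<and> nreg s' 21 = a \<and> nreg s' 22 = a' \<and>
      rreg s' 0 = (\<Sum>r<mm x. mG x (a + r) * mG x (a' + r)) \<and> rreg s' 1 = (\<Sum>r<mm x. mG x (a' + r) * mG x (a' + r)) \<and> \<omega>' = \<omega>) s \<omega>"
proof (rule wp_for[where Inv = "\<lambda>k s' \<omega>'. st x s' \<and> nreg s' 20 = j \<and> nreg s' 40 = i \<and> nreg s' 21 = a \<and> nreg s' 22 = a' \<and>
      rreg s' 0 = (\<Sum>r<k. mG x (a + r) * mG x (a' + r)) \<and> rreg s' 1 = (\<Sum>r<k. mG x (a' + r) * mG x (a' + r)) \<and> \<omega>' = \<omega>"
    and K = "mm x" and T = 8])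
  fix k s' \<omega>' assume k: "st x s' \<and> nreg s' 20 = j \<and> nreg s' 40 = i \<and> nreg s' 21 = a \<and> nreg s' 22 = a' \<and>
      rreg s' 0 = (\<Sum>r<k. mG x (a + r) * mG x (a' + r)) \<and> rreg s' 1 = (\<Sum>r<k. mG x (a' + r) * mG x (a' + r)) \<and> \<omega>' = \<omega>"
    "nreg s' 41 = k"
  show "wp n l (block [NAdd 23 22 41, RLoad 2 6 23, NAdd 24 21 41, RLoad 3 6 24, RMul 3 3 2, RAdd 0 0 3, RMul 2 2 2, RAdd 1 1 2]) 8
    (\<lambda>s'' \<omega>''. (st x s'' \<and> nreg s'' 20 = j \<and> nreg s'' 40 = i \<and> nreg s'' 21 = a \<and> nreg s'' 22 = a' \<and>
      rreg s'' 0 = (\<Sum>r<Suc k. mG x (a + r) * mG x (a' + r)) \<and> rreg s'' 1 = (\<Sum>r<Suc k. mG x (a' + r) * mG x (a' + r)) \<and> \<omega>'' = \<omega>)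
      \<and> nreg s'' 41 = k \<and> nreg s'' 6 = mm x \<and> nreg s'' 3 = 1) s' \<omega>'"
    apply (rule wp_block, simp, simp)
    using k by (simp add: st_def)
qed (use assms in \<open>auto simp: st_def\<close>)

lemma wp_axpy:
  assumes "st x s" "nreg s 20 = j" "nreg s 40 = i" "nreg s 21 = a" "nreg s 22 = a'" "a' + mM x \<le> a"
  shows "wp n l (For 41 7 32 (block [NAdd 23 22 41, RLoad 2 6 23, RMul 2 2 0, NAdd 24 21 41, RLoad 3 6 24, RSub 3 3 2, RStore 6 24 3]))
    (mM x * 10 + 3)
    (\<lambda>s' \<omega>'. st (x\<lparr>mG := (\<lambda>p. if a \<le> p \<and> p < a + mM x then mG x p - mG x (a' + (p - a)) * rreg s 0 else mG x p)\<rparr>) s' \<and>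
      nreg s' 20 = j \<and> nreg s' 40 = i \<and> nreg s' 21 = a \<and> \<omega>' = \<omega>) s \<omega>"
proof -
  let ?G = "\<lambda>k p. if a \<le> p \<and> p < a + k then mG x p - mG x (a' + (p - a)) * rreg s 0 else mG x p"
  let ?I = "\<lambda>k s' \<omega>'. st (x\<lparr>mG := ?G k\<rparr>) s' \<and> nreg s' 20 = j \<and> nreg s' 40 = i \<and> nreg s' 21 = a \<and> nreg s' 22 = a' \<and>
    rreg s' 0 = rreg s 0 \<and> \<omega>' = \<omega>"
  show ?thesis
  proof (rule wp_for[where Inv = ?I and K = "mM x" and T = 7])
    have "?G 0 = mG x" by (auto simp: fun_eq_iff)
    then show "?I 0 s \<omega>" using assms by (simp add: st_def)
    fix k s' \<omega>' assume k: "k < mM x" "?I k s' \<omega>'" "nreg s' 41 = k"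
    \<comment> \<open>The column at a' ends before the one at a starts, so the updates made so far
      have not changed the cell that is read.\<close>
    have 1: "?G k (a' + k) = mG x (a' + k)" "?G k (a + k) = mG x (a + k)" using k(1) assms(6) by auto
    have 2: "(?G k)(a + k := mG x (a + k) - mG x (a' + k) * rreg s 0) = ?G (Suc k)" by (auto simp: fun_eq_iff)
    show "wp n l (block [NAdd 23 22 41, RLoad 2 6 23, RMul 2 2 0, NAdd 24 21 41, RLoad 3 6 24, RSub 3 3 2, RStore 6 24 3]) 7
      (\<lambda>s'' \<omega>''. ?I (Suc k) s'' \<omega>'' \<and> nreg s'' 41 = k \<and> nreg s'' 7 = mM x \<and> nreg s'' 3 = 1) s' \<omega>'"
      apply (rule wp_block, simp, simp)
      using k(2,3) 1 2 by (simp add: st_def)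
  qed (use assms in \<open>auto simp: st_def\<close>)
qed

definition view :: "mem \<Rightarrow> nat \<Rightarrow> nat \<Rightarrow> real" where
  "view x c r = mG x (c * mM x + r)"

text \<open>Restricted to r below the column length: for larger r the address of \<open>view\<close>
  runs into the next column, and the first update would destroy the equality.\<close>

definition matches :: "mem \<Rightarrow> (nat \<Rightarrow> nat \<Rightarrow> real) \<Rightarrow> bool" where
  "matches x F \<longleftrightarrow> (\<forall>c\<le>d. \<forall>r<mM x. view x c r = F c r)"

lemma address_range:
  assumes "r < M" shows "j * M \<le> c * M + r \<and> c * M + r < j * M + M \<longleftrightarrow> c = (j :: nat)"
proof -
  have "c * M + r < j * M" if "c < j"
  proof -
    have "Suc c * M \<le> j * M" using that by (intro mult_right_mono) auto
    then show ?thesis using assms by simp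
  qed
  moreover have "j * M + M \<le> c * M + r" if "j < c"
  proof -
    have "Suc j * M \<le> c * M" using that by (intro mult_right_mono) auto
    then show ?thesis by simp
  qed
  ultimately show ?thesis using assms by (cases c j rule: linorder_cases) fastforce+
qed

lemma matches_step:
  assumes F: "matches x F" and ij: "i < j" "j \<le> d" and m: "mm x \<le> mM x"
    and \<beta>: "\<beta> = (\<Sum>r<mm x. mG x (j * mM x + r) * mG x (i * mM x + r)) / (\<Sum>r<mm x. mG x (i * mM x + r) * mG x (i * mM x + r))"
  shows "matches (x\<lparr>mG := (\<lambda>p. if j * mM x \<le> p \<and> p < j * mM x + mM x
    then mG x p - mG x (i * mM x + (p - j * mM x)) * \<beta> else mG x p)\<rparr>) (mgs_step (mm x) j i F)"
proof -
  have v: "mG x (c * mM x + r) = F c r" if "c \<le> d" "r < mM x" for c r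
    using F that by (simp add: matches_def view_def)
  have \<beta>': "\<beta> = ip (mm x) (F j) (F i) / ip (mm x) (F i) (F i)"
    unfolding \<beta> ip_def using ij m by (intro arg_cong2[where f = "(/)"] sum.cong) (simp_all add: v)
  show ?thesis
    unfolding matches_def view_def
  proof (intro allI impI)
    fix c r assume "c \<le> d" "r < mM (x\<lparr>mG := (\<lambda>p. if j * mM x \<le> p \<and> p < j * mM x + mM x
      then mG x p - mG x (i * mM x + (p - j * mM x)) * \<beta> else mG x p)\<rparr>)"
    then have c: "c \<le> d" "r < mM x" by simp_all
    show "mG (x\<lparr>mG := (\<lambda>p. if j * mM x \<le> p \<and> p < j * mM x + mM x
      then mG x p - mG x (i * mM x + (p - j * mM x)) * \<beta> else mG x p)\<rparr>)
      (c * mM (x\<lparr>mG := (\<lambda>p. if j * mM x \<le> p \<and> p < j * mM x + mM x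
      then mG x p - mG x (i * mM x + (p - j * mM x)) * \<beta> else mG x p)\<rparr>) + r) = mgs_step (mm x) j i F c r"
    proof (cases "c = j")
      case True
      then show ?thesis using c ij by (simp add: mgs_step_def v \<beta>')
    next
      case False
      then have "\<not> (j * mM x \<le> c * mM x + r \<and> c * mM x + r < j * mM x + mM x)"
        using address_range[OF c(2), of j c] by simp
      then show ?thesis using False v[OF c] by (auto simp: mgs_step_def)
    qed
  qed
qed

lemma wp_mgs:
  assumes "st x s" "mM x = mm x + d" "\<And>c. c \<le> d \<Longrightarrow> moff x c = c * mM x"
  shows "wp n l prog_mgs (Suc d * (Suc d * (13 + 11 * mm x + 10 * mM x) + 7) + 3)
    (\<lambda>s' \<omega>'. \<exists>A. st (x\<lparr>mG := A\<rparr>) s' \<and> matches (x\<lparr>mG := A\<rparr>) (mgs (mm x) (Suc d) (view x)) \<and> \<omega>' = \<omega>) s \<omega>"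
proof -
  let ?m = "mm x" and ?M = "mM x"
  let ?T = "13 + 11 * ?m + 10 * ?M"
  let ?I = "\<lambda>j s' \<omega>'. \<exists>A. st (x\<lparr>mG := A\<rparr>) s' \<and> matches (x\<lparr>mG := A\<rparr>) (mgs ?m j (view x)) \<and> \<omega>' = \<omega>"
  show ?thesis
    unfolding prog_mgs_def
  proof (rule wp_for[where Inv = ?I and K = "Suc d" and T = "1 + (Suc d * ?T + 3)"])
    have "matches x (view x)" by (simp add: matches_def)
    then show "?I 0 s \<omega>" using assms(1) by (intro exI[of _ "mG x"]) simp
    show "nreg s 8 = Suc d" "nreg s 3 = 1" using assms(1) by (simp_all add: st_def)
    show "?I k (s\<lparr>nreg := (nreg s)(20 := p, 30 := q)\<rparr>) \<omega>'" if "?I k s \<omega>'" for k s \<omega>' p q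
      using that by (auto simp: st_def)
    fix j s' \<omega>' assume j: "j < Suc d" "?I j s' \<omega>'" "nreg s' 20 = j"
    let ?F = "mgs ?m j (view x)"
    let ?I' = "\<lambda>i s2 \<omega>2. \<exists>A. st (x\<lparr>mG := A\<rparr>) s2 \<and> matches (x\<lparr>mG := A\<rparr>) (mgs_col ?m j i ?F) \<and>
      nreg s2 20 = j \<and> nreg s2 21 = j * ?M \<and> \<omega>2 = \<omega>"
    let ?Post = "\<lambda>s'' \<omega>''. ?I (Suc j) s'' \<omega>'' \<and> nreg s'' 20 = j \<and> nreg s'' 8 = Suc d \<and> nreg s'' 3 = 1"
    show "wp n l (Seq (block [NLoad 21 5 20]) (For 40 20 31
       (Seq (block [NLoad 22 5 40, ROfNat 0 4, ROfNat 1 4])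
       (Seq (For 41 6 32 (block [NAdd 23 22 41, RLoad 2 6 23, NAdd 24 21 41, RLoad 3 6 24, RMul 3 3 2, RAdd 0 0 3, RMul 2 2 2, RAdd 1 1 2]))
       (Seq (block [RDiv 0 0 1])
       (For 41 7 32 (block [NAdd 23 22 41, RLoad 2 6 23, RMul 2 2 0, NAdd 24 21 41, RLoad 3 6 24, RSub 3 3 2, RStore 6 24 3])))))))
      (1 + (Suc d * ?T + 3)) ?Post s' \<omega>'"
    proof (rule wp_seq, rule wp_block, simp, simp,
        rule wp_for[where Inv = ?I' and K = j and T = "3 + ((?m * 11 + 3) + (1 + (?M * 10 + 3)))"])
      show "?I' 0 (run [NLoad 21 5 20] s') \<omega>'" using j assms(3)[of j] by (auto simp: st_def)
      show "nreg (run [NLoad 21 5 20] s') 20 = j" "nreg (run [NLoad 21 5 20] s') 3 = 1"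
        using j by (auto simp: st_def)
      show "?I' k (s\<lparr>nreg := (nreg s)(40 := p, 31 := q)\<rparr>) \<omega>'" if "?I' k s \<omega>'" for k s \<omega>' p q
        using that by (auto simp: st_def)
      show "?Post s2 \<omega>2" if "?I' j s2 \<omega>2" for s2 \<omega>2 using that by (auto simp: st_def)
      have "j * ?T \<le> Suc d * ?T" using j(1) by (intro mult_right_mono) auto
      then show "j * (3 + ((?m * 11 + 3) + (1 + (?M * 10 + 3))) + 3) + 3 \<le> Suc d * ?T + 3"
        by (simp add: algebra_simps)
      fix i s2 \<omega>2 assume i: "i < j" "?I' i s2 \<omega>2" "nreg s2 40 = i"
      then obtain A where A: "st (x\<lparr>mG := A\<rparr>) s2" "matches (x\<lparr>mG := A\<rparr>) (mgs_col ?m j i ?F)"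
        "nreg s2 20 = j" "nreg s2 21 = j * ?M" "\<omega>2 = \<omega>" by blast
      let ?s3 = "run [NLoad 22 5 40, ROfNat 0 4, ROfNat 1 4] s2"
      let ?Post' = "\<lambda>s'' \<omega>''. ?I' (Suc i) s'' \<omega>'' \<and> nreg s'' 40 = i \<and> nreg s'' 20 = j \<and> nreg s'' 3 = 1"
      let ?\<beta> = "(\<Sum>r<?m. A (j * ?M + r) * A (i * ?M + r)) / (\<Sum>r<?m. A (i * ?M + r) * A (i * ?M + r))"
      let ?A' = "\<lambda>p. if j * ?M \<le> p \<and> p < j * ?M + ?M then A p - A (i * ?M + (p - j * ?M)) * ?\<beta> else A p"
      have s3: "st (x\<lparr>mG := A\<rparr>) ?s3" "nreg ?s3 20 = j" "nreg ?s3 40 = i" "nreg ?s3 21 = j * ?M" "nreg ?s3 22 = i * ?M"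
        "rreg ?s3 0 = 0" "rreg ?s3 1 = 0"
        using A i j(1) assms(3)[of i] by (simp_all add: st_def)
      show "wp n l (Seq (block [NLoad 22 5 40, ROfNat 0 4, ROfNat 1 4])
         (Seq (For 41 6 32 (block [NAdd 23 22 41, RLoad 2 6 23, NAdd 24 21 41, RLoad 3 6 24, RMul 3 3 2, RAdd 0 0 3, RMul 2 2 2, RAdd 1 1 2]))
         (Seq (block [RDiv 0 0 1])
         (For 41 7 32 (block [NAdd 23 22 41, RLoad 2 6 23, RMul 2 2 0, NAdd 24 21 41, RLoad 3 6 24, RSub 3 3 2, RStore 6 24 3])))))
        (3 + ((?m * 11 + 3) + (1 + (?M * 10 + 3)))) ?Post' s2 \<omega>2"
      proof (rule wp_seq, rule wp_block, simp, simp, rule wp_seq, rule wp_mono[OF wp_ip[OF s3]])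
        show "mm (x\<lparr>mG := A\<rparr>) * 11 + 3 \<le> ?m * 11 + 3" by simp
        fix s4 \<omega>4 assume 4: "st (x\<lparr>mG := A\<rparr>) s4 \<and> nreg s4 20 = j \<and> nreg s4 40 = i \<and> nreg s4 21 = j * ?M \<and> nreg s4 22 = i * ?M \<and>
          rreg s4 0 = (\<Sum>r<mm (x\<lparr>mG := A\<rparr>). mG (x\<lparr>mG := A\<rparr>) (j * ?M + r) * mG (x\<lparr>mG := A\<rparr>) (i * ?M + r)) \<and>
          rreg s4 1 = (\<Sum>r<mm (x\<lparr>mG := A\<rparr>). mG (x\<lparr>mG := A\<rparr>) (i * ?M + r) * mG (x\<lparr>mG := A\<rparr>) (i * ?M + r)) \<and> \<omega>4 = \<omega>2"
        let ?s5 = "run [RDiv 0 0 1] s4"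
        have ij: "i * ?M + mM (x\<lparr>mG := A\<rparr>) \<le> j * ?M"
        proof -
          have "Suc i * ?M \<le> j * ?M" using i(1) by (intro mult_right_mono) auto
          then show ?thesis by simp
        qed
        have s5: "st (x\<lparr>mG := A\<rparr>) ?s5" "nreg ?s5 20 = j" "nreg ?s5 40 = i" "nreg ?s5 21 = j * ?M" "nreg ?s5 22 = i * ?M"
          using 4 by (simp_all add: st_def)
        have r5: "rreg ?s5 0 = ?\<beta>" using 4 by simp
        show "wp n l (Seq (block [RDiv 0 0 1])
          (For 41 7 32 (block [NAdd 23 22 41, RLoad 2 6 23, RMul 2 2 0, NAdd 24 21 41, RLoad 3 6 24, RSub 3 3 2, RStore 6 24 3])))
          (1 + (?M * 10 + 3)) ?Post' s4 \<omega>4"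
        proof (rule wp_seq, rule wp_block, simp, simp, rule wp_mono[OF wp_axpy[OF s5 ij]])
          show "mM (x\<lparr>mG := A\<rparr>) * 10 + 3 \<le> ?M * 10 + 3" by simp
          fix s6 \<omega>6 assume 6: "st (x\<lparr>mG := A\<rparr>\<lparr>mG := (\<lambda>p. if j * ?M \<le> p \<and> p < j * ?M + mM (x\<lparr>mG := A\<rparr>)
            then mG (x\<lparr>mG := A\<rparr>) p - mG (x\<lparr>mG := A\<rparr>) (i * ?M + (p - j * ?M)) * rreg ?s5 0 else mG (x\<lparr>mG := A\<rparr>) p)\<rparr>) s6 \<and>
            nreg s6 20 = j \<and> nreg s6 40 = i \<and> nreg s6 21 = j * ?M \<and> \<omega>6 = \<omega>4"
          have st6: "st (x\<lparr>mG := ?A'\<rparr>) s6" using 6 unfolding r5 by (simp cong: if_cong)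
          have "matches (x\<lparr>mG := ?A'\<rparr>) (mgs_col ?m j (Suc i) ?F)"
            using matches_step[OF A(2) i(1), of ?\<beta>] j(1) assms(2) by (simp cong: if_cong)
          then have "?I' (Suc i) s6 \<omega>6" using st6 6 4 A(5) by (intro exI[of _ ?A']) simp
          then show "?Post' s6 \<omega>6" using 6 by (auto simp: st_def)
        qed
      qed
    qed simp_all
  qed (use assms in \<open>auto simp: algebra_simps\<close>)
qed

lemma wp_output:
  assumes "st x s"
  shows "wp n l prog_output (d * 10 + 3)
    (\<lambda>s' \<omega>'. (\<forall>j<d. rarr s' 2 j = - mG x (moff x d + mm x + j)) \<and> \<omega>' = \<omega>) s \<omega>"
  unfolding prog_output_def
proof (rule wp_for[where Inv = "\<lambda>k s' \<omega>'. st x s' \<and> (\<forall>j<k. rarr s' 2 j = - mG x (moff x d + mm x + j)) \<and> \<omega>' = \<omega>" and K = d and T = 7])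
  fix k s' \<omega>' assume k: "k < d" "st x s' \<and> (\<forall>j<k. rarr s' 2 j = - mG x (moff x d + mm x + j)) \<and> \<omega>' = \<omega>" "nreg s' 20 = k"
  show "wp n l (block [NLoad 21 5 1, NAdd 21 21 6, NAdd 21 21 20, RLoad 0 6 21, ROfNat 1 4, RSub 0 1 0, RStore 2 20 0]) 7
    (\<lambda>s'' \<omega>''. (st x s'' \<and> (\<forall>j<Suc k. rarr s'' 2 j = - mG x (moff x d + mm x + j)) \<and> \<omega>'' = \<omega>) \<and> nreg s'' 20 = k \<and> nreg s'' 1 = d \<and> nreg s'' 3 = 1) s' \<omega>'"
    apply (rule wp_block, simp, simp)
    using k by (simp add: st_def less_Suc_eq)
qed (use assms in \<open>auto simp: st_def\<close>)

end

section \<open>The assembled program and the memory it produces\<close>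

definition regression_prog :: prog where
  "regression_prog = Seq prog_start (Seq prog_rows (Seq prog_ones (Seq prog_table (Seq prog_size (Seq prog_offsets
     (Seq prog_weights (Seq prog_hash (Seq prog_entries (Seq prog_identity (Seq prog_mgs prog_output))))))))))"

context input
begin

definition N :: nat where "N = fst (ded row_of z)"
definition rl :: "nat \<Rightarrow> nat" where "rl = fst (snd (ded row_of z))"
definition seen :: "nat \<Rightarrow> nat" where "seen = snd (snd (ded row_of z))"
definition L :: nat where "L = bitlen N - 1"
definition msk :: nat where "msk = 2 ^ size_bits"

lemma N_le_z: "N \<le> z"
  using ded_props[of row_of z N rl seen] by (simp add: N_def rl_def seen_def)

definition us :: "bool stream \<Rightarrow> nat \<Rightarrow> nat" where "us \<omega> i = num L (sdrop (i * L) \<omega>)"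
definition gs :: "bool stream \<Rightarrow> nat \<Rightarrow> nat" where "gs \<omega> i = num (Suc size_bits) (sdrop (i * Suc size_bits) (sdrop (N * L) \<omega>))"

text \<open>The memory once the weights are drawn; \<open>mem2\<close> is the input of Gram-Schmidt.
  Both depend on the coin tosses only through \<open>us\<close> and \<open>gs\<close>.\<close>

definition mem1 :: "bool stream \<Rightarrow> mem" where
  "mem1 \<omega> = \<lparr>mN = N, mm = msk, mM = msk + d, mseen = seen, mrl = rl, mH = \<lambda>_. 0,
     moff = \<lambda>c. if c < Suc d then c * (msk + d) else 0, mones = \<lambda>i. of_bool (i < N), mT = table (bitlen N),
     mW = \<lambda>i. if i < N then table (bitlen N) (2 ^ lead L (us \<omega> i)) else 0, mG = \<lambda>_. 0\<rparr>"

definition mem2 :: "bool stream \<Rightarrow> mem" where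
  "mem2 \<omega> = with_identity d (with_entries z (hashed N (mem1 \<omega>) (gs \<omega>)))"

definition time_bound :: nat where
  "time_bound = 2 + ((z * 9 + 3) + ((N * 5 + 3) + ((2 * N + 6 * bitlen N + 4) + ((5 * dlen + 4) + ((5 * Suc d + 5)
     + ((N * (10 * L + 12) + 3) + ((N * (7 * Suc size_bits + 25) + 3) + ((z * 16 + 3) + ((d * 8 + 3)
     + ((Suc d * (Suc d * (13 + 11 * msk + 10 * (msk + d)) + 7) + 3) + (d * 10 + 3)))))))))))"

lemma wp_regression:
  assumes "N \<le> n"
  shows "wp n l regression_prog time_bound
    (\<lambda>s' \<omega>'. \<forall>j<d. rarr s' 2 j = - mgs msk (Suc d) (view (mem2 \<omega>)) d (msk + j)) (init_state n d es b) \<omega>"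
  unfolding regression_prog_def time_bound_def
proof (rule wp_seq, rule wp_mono[OF wp_start, OF order_refl], elim conjE)
  fix s \<omega>' assume 1: "st empty_mem s" "\<omega>' = \<omega>"
  let ?x2 = "rows_mem z empty_mem"
  let ?x3 = "?x2\<lparr>mones := (\<lambda>i. of_bool (i < mN ?x2))\<rparr>"
  let ?x4 = "?x3\<lparr>mT := table (bitlen (mN ?x3))\<rparr>"
  let ?x5 = "?x4\<lparr>mm := 2 ^ size_bits\<rparr>"
  let ?x6 = "?x5\<lparr>mM := mm ?x5 + d, moff := (\<lambda>c. if c < Suc d then c * (mm ?x5 + d) else 0)\<rparr>"
  have N2: "mN ?x2 = N" by (simp add: rows_mem_def N_def)
  have x7: "?x6\<lparr>mW := (\<lambda>i. if i < mN ?x6 then mT ?x6 (2 ^ lead (wbits ?x6) (num (wbits ?x6) (sdrop (i * wbits ?x6) \<omega>))) else mW ?x6 i)\<rparr> = mem1 \<omega>"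
    by (simp add: rows_mem_def empty_mem_def mem1_def N_def[symmetric] rl_def[symmetric] seen_def[symmetric] msk_def wbits_def L_def us_def cong: if_cong)
  have w6: "wbits ?x6 = L" "mN ?x6 = N" by (simp_all add: wbits_def L_def N2)
  show "wp n l (Seq prog_rows (Seq prog_ones (Seq prog_table (Seq prog_size (Seq prog_offsets
     (Seq prog_weights (Seq prog_hash (Seq prog_entries (Seq prog_identity (Seq prog_mgs prog_output))))))))))
    ((z * 9 + 3) + ((N * 5 + 3) + ((2 * N + 6 * bitlen N + 4) + ((5 * dlen + 4) + ((5 * Suc d + 5)
     + ((N * (10 * L + 12) + 3) + ((N * (7 * Suc size_bits + 25) + 3) + ((z * 16 + 3) + ((d * 8 + 3)
     + ((Suc d * (Suc d * (13 + 11 * msk + 10 * (msk + d)) + 7) + 3) + (d * 10 + 3)))))))))))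
    (\<lambda>s' \<omega>'. \<forall>j<d. rarr s' 2 j = - mgs msk (Suc d) (view (mem2 \<omega>)) d (msk + j)) s \<omega>'"
    unfolding 1(2)
  proof (rule wp_seq, rule wp_mono[OF wp_rows[OF 1(1)], rotated 3, OF order_refl], simp_all only: empty_mem_def mem.select_convs, fold empty_mem_def, elim conjE)
    fix s \<omega>' assume 2: "st ?x2 s" "\<omega>' = \<omega>"
    have e3: "mones ?x2 = (\<lambda>_. 0)" by (simp add: rows_mem_def empty_mem_def)
    show "wp n l (Seq prog_ones (Seq prog_table (Seq prog_size (Seq prog_offsets
     (Seq prog_weights (Seq prog_hash (Seq prog_entries (Seq prog_identity (Seq prog_mgs prog_output)))))))))
    ((N * 5 + 3) + ((2 * N + 6 * bitlen N + 4) + ((5 * dlen + 4) + ((5 * Suc d + 5)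
     + ((N * (10 * L + 12) + 3) + ((N * (7 * Suc size_bits + 25) + 3) + ((z * 16 + 3) + ((d * 8 + 3)
     + ((Suc d * (Suc d * (13 + 11 * msk + 10 * (msk + d)) + 7) + 3) + (d * 10 + 3))))))))))
    (\<lambda>s' \<omega>'. \<forall>j<d. rarr s' 2 j = - mgs msk (Suc d) (view (mem2 \<omega>)) d (msk + j)) s \<omega>"
    proof (rule wp_seq, rule wp_mono[OF wp_ones[OF 2(1) e3]], goal_cases)
      case 1 then show ?case by (simp add: N2)
    next
      case (2 s \<omega>')
      then have 3: "st ?x3 s" "\<omega>' = \<omega>" by auto
      have e4: "mT ?x3 = (\<lambda>_. 0)" "mones ?x3 = (\<lambda>i. of_bool (i < mN ?x3))" "mN ?x3 \<le> n"
        using assms by (simp_all add: rows_mem_def empty_mem_def N_def)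
      show ?case unfolding 3(2)
      proof (rule wp_seq, rule wp_mono[OF wp_table[OF 3(1) e4]], goal_cases)
        case 1 then show ?case by (simp add: N2)
      next
        case (2 s \<omega>')
        then have 4: "st ?x4 s" "\<omega>' = \<omega>" by auto
        show ?case unfolding 4(2)
        proof (rule wp_seq, rule wp_mono[OF wp_size[OF 4(1)] order_refl], goal_cases)
          case (1 s \<omega>')
          then have 5: "st ?x5 s" "\<omega>' = \<omega>" by auto
          have e6: "moff ?x5 = (\<lambda>_. 0)" by (simp add: rows_mem_def empty_mem_def)
          show ?case unfolding 5(2)
          proof (rule wp_seq, rule wp_mono[OF wp_offsets[OF 5(1) e6] order_refl], goal_cases)
            case (1 s \<omega>')
            then have 6: "st ?x6 s" "\<omega>' = \<omega>" by auto
            show ?case unfolding 6(2)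
            proof (rule wp_seq, rule wp_mono[OF wp_weights[OF 6(1)]], goal_cases)
              case 1 then show ?case unfolding w6 by (rule order_refl)
            next
              case (2 s \<omega>')
              then have 7: "st (mem1 \<omega>) s" "\<omega>' = sdrop (N * L) \<omega>" unfolding x7 unfolding w6 by auto
              have e8: "mm (mem1 \<omega>) = 2 ^ size_bits" "mG (mem1 \<omega>) = (\<lambda>_. 0)" by (simp_all add: mem1_def msk_def)
              have N7: "mN (mem1 \<omega>) = N" by (simp add: mem1_def)
              have g: "(\<lambda>i. num (Suc size_bits) (sdrop (i * Suc size_bits) (sdrop (N * L) \<omega>))) = gs \<omega>"
                by (simp add: gs_def fun_eq_iff)
              show ?case unfolding 7(2)
              proof (rule wp_seq, rule wp_mono[OF wp_hash[OF 7(1) e8]], goal_cases)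
                case 1 then show ?case by (simp add: N7)
              next
                case (2 s \<omega>')
                let ?x8 = "hashed N (mem1 \<omega>) (gs \<omega>)"
                from 2 have 8: "st ?x8 s" unfolding g N7 by auto
                show ?case
                proof (rule wp_seq, rule wp_mono[OF wp_entries[OF 8] order_refl], goal_cases)
                  case (1 s \<omega>')
                  then have 9: "st (with_entries z ?x8) s" by auto
                  show ?case
                  proof (rule wp_seq, rule wp_mono[OF wp_identity[OF 9] order_refl], goal_cases)
                    case (1 s \<omega>')
                    then have 10: "st (mem2 \<omega>) s" by (auto simp: mem2_def)
                    have m2: "mm (mem2 \<omega>) = msk" "mM (mem2 \<omega>) = msk + d" "\<And>c. c \<le> d \<Longrightarrow> moff (mem2 \<omega>) c = c * mM (mem2 \<omega>)"
                      by (simp_all add: mem2_def with_identity_def with_entries_def hashed_def mem1_def)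
                    have e11: "mM (mem2 \<omega>) = mm (mem2 \<omega>) + d" by (simp add: m2)
                    show ?case
                    proof (rule wp_seq, rule wp_mono[OF wp_mgs[OF 10 e11 m2(3)]], goal_cases)
                      case (3 s \<omega>')
                      then obtain A where A: "st ((mem2 \<omega>)\<lparr>mG := A\<rparr>) s"
                        "matches ((mem2 \<omega>)\<lparr>mG := A\<rparr>) (mgs msk (Suc d) (view (mem2 \<omega>)))" unfolding m2 by blast
                      show ?case
                      proof (rule wp_mono[OF wp_output[OF A(1)] order_refl], elim conjE, intro allI impI)
                        fix s' \<omega>'' j assume out: "\<forall>j<d. rarr s' 2 j = - mG ((mem2 \<omega>)\<lparr>mG := A\<rparr>) (moff ((mem2 \<omega>)\<lparr>mG := A\<rparr>) d + mm ((mem2 \<omega>)\<lparr>mG := A\<rparr>) + j)" and j: "j < d"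
                        have "A (d * (msk + d) + (msk + j)) = mgs msk (Suc d) (view (mem2 \<omega>)) d (msk + j)"
                          using A(2) j by (simp add: matches_def view_def m2)
                        then show "rarr s' 2 j = - mgs msk (Suc d) (view (mem2 \<omega>)) d (msk + j)"
                          using out j by (simp add: m2 add.assoc)
                      qed
                    qed (simp_all add: m2)
                  qed
                qed
              qed
            qed
          qed
        qed
      qed
    qed
  qed
qed

end

section \<open>Analysis of the output\<close>

lemma harm_le_ln: "1 \<le> k \<Longrightarrow> harm k \<le> 1 + ln (real k)"
proof (induction k rule: dec_induct)
  case base
  then show ?case by (simp add: harm_expand)
next
  case (step k)
  have "ln (real k / real (Suc k)) \<le> real k / real (Suc k) - 1" using step by (intro ln_le_minus_one) simp
  also have "real k / real (Suc k) - 1 = - inverse (real (Suc k))" by (simp add: field_simps)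
  finally have "inverse (real (Suc k)) \<le> ln (real (Suc k)) - ln (real k)" using step by (simp add: ln_div)
  then show ?case using step.IH by (simp add: harm_Suc)
qed

text \<open>Turns bit lengths into natural logarithms; the constant 2 comes from exp (1/2) \<le>
  2.\<close>

lemma two_power_le_imp_le_ln:
  assumes "2 ^ k \<le> f"
  shows "real k \<le> 2 * ln f"
proof -
  have "0 < f" using assms by (meson order_less_le_trans zero_less_numeral zero_less_power)
  have "exp (real k / 2) = exp (1/2) ^ k" by (simp add: exp_of_nat_mult[symmetric])
  also have "\<dots> \<le> 2 ^ k" by (intro power_mono exp_half_le2) simp
  finally have "exp (real k / 2) \<le> f" using assms by linarith
  then have "real k / 2 \<le> ln f" by (subst ln_ge_iff[OF \<open>0 < f\<close>])
  then show ?thesis by simp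
qed

context sym_norm
begin

lemma l_eq_nf: "v \<in> carrier_vec n \<Longrightarrow> l v = nf (\<lambda>i. v $ i)"
  unfolding nf_def by (rule arg_cong[where f = l]) (auto intro: eq_vecI)

lemma nf_ge_coord: "i < n \<Longrightarrow> \<bar>v i\<bar> * phi 1 \<le> nf v"
  using nf_lower[of "{i}" "\<bar>v i\<bar>" v] by simp

end

section \<open>The entry list and the nonzero rows\<close>

locale regression = input +
  fixes A :: "real mat"
  assumes d_pos: "1 \<le> d" and A: "A \<in> carrier_mat n d" and b: "b \<in> carrier_vec n" and sparse: "sparse_repr A es"
begin

lemma entry:
  assumes "e < z"
  shows "row_of e < n" "col_of e < d" "val_of e = A $$ (row_of e, col_of e)"
proof -
  have "es ! e \<in> set es" using assms by simp
  then have "es ! e \<in> {(i, j, A $$ (i, j)) | i j. i < dim_row A \<and> j < dim_col A \<and> A $$ (i, j) \<noteq> 0}"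
    using sparse by (simp add: sparse_repr_def)
  then show "row_of e < n" "col_of e < d" "val_of e = A $$ (row_of e, col_of e)"
    using A assms by (auto simp: row_of_def col_of_def val_of_def)
qed

text \<open>Ensures that no matrix entry is added to the sketch twice.\<close>

lemma entry_unique:
  assumes "e < z" "e' < z" "row_of e = row_of e'" "col_of e = col_of e'"
  shows "e = e'"
proof -
  have "es ! e = (row_of e, col_of e, val_of e)" if "e < z" for e
    using that by (simp add: row_of_def col_of_def val_of_def)
  then have "es ! e = es ! e'" using assms entry(3)[OF assms(1)] entry(3)[OF assms(2)] by simp
  then show ?thesis using sparse assms(1,2) by (simp add: sparse_repr_def nth_eq_iff_index_eq)
qed

lemma entry_exists:
  assumes "i < n" "j < d" "A $$ (i, j) \<noteq> 0"
  shows "\<exists>e<z. row_of e = i \<and> col_of e = j"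
proof -
  have "(i, j, A $$ (i, j)) \<in> set es" using sparse assms A by (auto simp: sparse_repr_def)
  then obtain e where "e < z" "es ! e = (i, j, A $$ (i, j))" by (auto simp: in_set_conv_nth)
  then show ?thesis by (intro exI[of _ e]) (simp add: row_of_def col_of_def)
qed

lemma nnz_eq: "nnz A = z"
proof -
  let ?S = "{(i, j). i < dim_row A \<and> j < dim_col A \<and> A $$ (i, j) \<noteq> 0}"
  have "set es = (\<lambda>(i, j). (i, j, A $$ (i, j))) ` ?S" using sparse by (auto simp: sparse_repr_def)
  then have "card (set es) = card ?S" by (simp add: card_image inj_on_def case_prod_unfold prod_eq_iff)
  moreover have "distinct es" using sparse by (simp add: sparse_repr_def)
  then have "card (set es) = z" by (rule distinct_card)
  ultimately show ?thesis by (simp add: nnz_def)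
qed

lemma ded_facts:
  "i < N \<Longrightarrow> seen (rl i) = Suc i" "i < N \<Longrightarrow> rl i \<in> row_of ` {..<z}"
  "e < z \<Longrightarrow> seen (row_of e) - 1 < N" "e < z \<Longrightarrow> rl (seen (row_of e) - 1) = row_of e"
proof -
  have P: "(\<forall>i<N. seen (rl i) = Suc i \<and> rl i \<in> row_of ` {..<z}) \<and>
    (\<forall>r. 0 < seen r \<longrightarrow> seen r \<le> N \<and> rl (seen r - 1) = r) \<and> (\<forall>e<z. 0 < seen (row_of e))"
    using ded_props[of row_of z N rl seen] by (simp add: N_def rl_def seen_def)
  show "i < N \<Longrightarrow> seen (rl i) = Suc i" "i < N \<Longrightarrow> rl i \<in> row_of ` {..<z}" using P by auto
  show "e < z \<Longrightarrow> seen (row_of e) - 1 < N" using P by (metis Suc_diff_1 Suc_le_eq)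
  show "e < z \<Longrightarrow> rl (seen (row_of e) - 1) = row_of e" using P by blast
qed

lemma rl_less: "i < N \<Longrightarrow> rl i < n"
  using ded_facts(2)[of i] entry(1) by auto

lemma rl_inj: "inj_on rl {..<N}"
  by (rule inj_onI) (metis ded_facts(1) lessThan_iff nat.inject)

lemma N_le_n: "N \<le> n"
proof -
  have "card (rl ` {..<N}) \<le> card {..<n}" using rl_less by (intro card_mono) auto
  then show ?thesis using rl_inj by (simp add: card_image)
qed

lemma zero_row: "r < n \<Longrightarrow> r \<notin> rl ` {..<N} \<Longrightarrow> j < d \<Longrightarrow> A $$ (r, j) = 0"
  using entry_exists[of r j] ded_facts(3,4) by (metis image_eqI lessThan_iff)

lemma L_facts: "1 \<le> N \<Longrightarrow> 2 ^ L \<le> N" "N < 2 ^ Suc L"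
  using wbits[of "empty_mem\<lparr>mN := N\<rparr>"] by (simp_all add: wbits_def L_def)

text \<open>Column \<open>j < d\<close> of the matrix and, as column \<open>d\<close>, the right-hand side, on the nonzero rows.\<close>

definition colv :: "nat \<Rightarrow> nat \<Rightarrow> real" where
  "colv j i = (if j < d then A $$ (rl i, j) else b $ rl i)"

definition wcol :: "(nat \<Rightarrow> nat) \<Rightarrow> nat \<Rightarrow> nat \<Rightarrow> real" where
  "wcol u j i = weight L (u i) * colv j i"

section \<open>The stored matrix is the sketch of the weighted matrix\<close>

lemma addr_eq: "r < M \<Longrightarrow> r' < M \<Longrightarrow> c * M + r = c' * M + r' \<longleftrightarrow> c = (c' :: nat) \<and> r = r'"
  using address_range[of r M c' c] address_range[of r' M c c'] by fastforce

lemma mem2_fields: "mM (mem2 \<omega>) = msk + d" "mm (mem2 \<omega>) = msk"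
  by (simp_all add: mem2_def with_identity_def with_entries_def hashed_def mem1_def)

lemma gs_less: "gs \<omega> i < 2 * msk"
  using num_less[of "Suc size_bits"] by (simp add: gs_def msk_def)

lemma mG_with_identity: "mG (with_identity k x) a = (if \<exists>j<k. a = moff x j + mm x + j then 1 else mG x a)"
  by (simp add: with_identity_def)

lemma mG_with_entries: "mG (with_entries k x) a = mG x a + (\<Sum>e<k. if moff x (col_of e) + mH x (mseen x (row_of e) - 1) = a
     then val_of e * mW x (mseen x (row_of e) - 1) else 0)"
  by (simp add: with_entries_def)

lemma moff_with_entries: "moff (with_entries k x) = moff x" "mm (with_entries k x) = mm x"
  by (simp_all add: with_entries_def)

lemma hashed_fields:
  "mW (hashed k x g) i = (if i < k then sig (mm x) (g i) * mW x i else mW x i)"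
  "mH (hashed k x g) i = (if i < k then bucket (mm x) (g i) else mH x i)"
  "mG (hashed k x g) a = (\<Sum>i<k. if moff x d + bucket (mm x) (g i) = a then bv (mrl x i) * (sig (mm x) (g i) * mW x i) else 0)"
  "moff (hashed k x g) = moff x" "mm (hashed k x g) = mm x" "mseen (hashed k x g) = mseen x"
  by (simp_all add: hashed_def)

lemma mem2_G:
  "mG (mem2 \<omega>) a = (if \<exists>j<d. a = j * (msk + d) + msk + j then 1 else
     (\<Sum>i<N. if d * (msk + d) + bucket msk (gs \<omega> i) = a then bv (rl i) * (sig msk (gs \<omega> i) * mW (mem1 \<omega>) i) else 0) +
     (\<Sum>e<z. if col_of e * (msk + d) + bucket msk (gs \<omega> (seen (row_of e) - 1)) = a
       then val_of e * (sig msk (gs \<omega> (seen (row_of e) - 1)) * mW (mem1 \<omega>) (seen (row_of e) - 1)) else 0))"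
proof -
  have off: "moff (mem1 \<omega>) c = c * (msk + d)" if "c \<le> d" for c using that by (simp add: mem1_def)
  have "(\<exists>j<d. a = moff (mem1 \<omega>) j + msk + j) \<longleftrightarrow> (\<exists>j<d. a = j * (msk + d) + msk + j)"
    using off less_imp_le by metis
  moreover have "(\<Sum>e<z. if moff (mem1 \<omega>) (col_of e) + (if seen (row_of e) - 1 < N then bucket msk (gs \<omega> (seen (row_of e) - 1)) else 0) = a
      then val_of e * (if seen (row_of e) - 1 < N then sig msk (gs \<omega> (seen (row_of e) - 1)) * mW (mem1 \<omega>) (seen (row_of e) - 1) else mW (mem1 \<omega>) (seen (row_of e) - 1)) else 0)
    = (\<Sum>e<z. if col_of e * (msk + d) + bucket msk (gs \<omega> (seen (row_of e) - 1)) = a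
       then val_of e * (sig msk (gs \<omega> (seen (row_of e) - 1)) * mW (mem1 \<omega>) (seen (row_of e) - 1)) else 0)"
  proof (rule sum.cong)
    fix e assume "e \<in> {..<z}"
    then have "col_of e < Suc d" "seen (row_of e) - 1 < N" using entry(2)[of e] ded_facts(3)[of e] by auto
    then show "(if moff (mem1 \<omega>) (col_of e) + (if seen (row_of e) - 1 < N then bucket msk (gs \<omega> (seen (row_of e) - 1)) else 0) = a
      then val_of e * (if seen (row_of e) - 1 < N then sig msk (gs \<omega> (seen (row_of e) - 1)) * mW (mem1 \<omega>) (seen (row_of e) - 1) else mW (mem1 \<omega>) (seen (row_of e) - 1)) else 0)
      = (if col_of e * (msk + d) + bucket msk (gs \<omega> (seen (row_of e) - 1)) = a
       then val_of e * (sig msk (gs \<omega> (seen (row_of e) - 1)) * mW (mem1 \<omega>) (seen (row_of e) - 1)) else 0)"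
      by (simp add: mem1_def)
  qed simp
  moreover have "mm (mem1 \<omega>) = msk" "mrl (mem1 \<omega>) = rl" "mseen (mem1 \<omega>) = seen" "mH (mem1 \<omega>) = (\<lambda>_. 0)" "moff (mem1 \<omega>) d = d * (msk + d)"
    by (simp_all add: mem1_def)
  ultimately show ?thesis
    unfolding mem2_def mG_with_identity mG_with_entries hashed_fields
    unfolding moff_with_entries hashed_fields by (simp only:)
qed

lemma mW_mem1: "i < N \<Longrightarrow> mW (mem1 \<omega>) i = weight L (us \<omega> i)"
proof -
  assume i: "i < N"
  then have "bitlen N \<noteq> 0" using bitlen(1)[of N] by (intro notI) simp
  then have "lead L (us \<omega> i) < bitlen N" using lead_le[of L "us \<omega> i"] by (simp add: L_def)
  then show ?thesis using i by (simp add: mem1_def table_pow weight_def)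
qed

lemma view_bottom:
  assumes "c \<le> d" "j < d"
  shows "view (mem2 \<omega>) c (msk + j) = of_bool (c = j)"
proof -
  let ?M = "msk + d"
  have ex: "(\<exists>j'<d. c * ?M + (msk + j) = j' * ?M + msk + j') \<longleftrightarrow> c = j"
  proof
    assume "\<exists>j'<d. c * ?M + (msk + j) = j' * ?M + msk + j'"
    then obtain j' where "j' < d" "c * ?M + (msk + j) = j' * ?M + (msk + j')" by (auto simp: add.assoc)
    then show "c = j" using addr_eq[of "msk + j" ?M "msk + j'" c j'] assms(2) by simp
  next
    assume "c = j"
    then show "\<exists>j'<d. c * ?M + (msk + j) = j' * ?M + msk + j'" using assms(2) by (intro exI[of _ j]) simp
  qed
  have no: "c' * ?M + bucket msk (gs \<omega> i) \<noteq> c * ?M + (msk + j)" for c' i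
    using addr_eq[of "bucket msk (gs \<omega> i)" ?M "msk + j" c' c] assms(2) bucket_less[OF gs_less[of \<omega> i]] by simp
  show ?thesis
    unfolding view_def mem2_fields mem2_G ex using no by simp
qed

text \<open>Reindexing the entries of a column by their row numbers turns the sum over the list into
  the sum over all numbered rows, since rows missing from the column have entry 0 there.\<close>

lemma view_top:
  assumes "c \<le> d" "r < msk"
  shows "view (mem2 \<omega>) c r = sketch msk N (gs \<omega>) (wcol (us \<omega>) c) r"
proof -
  let ?M = "msk + d"
  have r: "r < ?M" using assms(2) by simp
  have ex: "\<not> (\<exists>j'<d. c * ?M + r = j' * ?M + msk + j')"
  proof
    assume "\<exists>j'<d. c * ?M + r = j' * ?M + msk + j'"
    then obtain j' where "j' < d" "c * ?M + r = j' * ?M + (msk + j')" by (auto simp: add.assoc)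
    then show False using addr_eq[OF r, of "msk + j'" c j'] assms(2) by simp
  qed
  have addr: "c' * ?M + bucket msk (gs \<omega> i) = c * ?M + r \<longleftrightarrow> c' = c \<and> bucket msk (gs \<omega> i) = r" for c' i
    using addr_eq[of "bucket msk (gs \<omega> i)" ?M r c' c] r bucket_less[OF gs_less[of \<omega> i]] by simp
  let ?idx = "\<lambda>e. seen (row_of e) - 1"
  have eq: "view (mem2 \<omega>) c r =
     (\<Sum>i<N. if d = c \<and> bucket msk (gs \<omega> i) = r then bv (rl i) * (sig msk (gs \<omega> i) * mW (mem1 \<omega>) i) else 0) +
     (\<Sum>e<z. if col_of e = c \<and> bucket msk (gs \<omega> (?idx e)) = r then val_of e * (sig msk (gs \<omega> (?idx e)) * mW (mem1 \<omega>) (?idx e)) else 0)"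
    unfolding view_def mem2_fields mem2_G if_not_P[OF ex] addr ..
  show ?thesis
  proof (cases "c = d")
    case True
    have "(\<Sum>e<z. if col_of e = c \<and> bucket msk (gs \<omega> (?idx e)) = r then val_of e * (sig msk (gs \<omega> (?idx e)) * mW (mem1 \<omega>) (?idx e)) else 0) = 0"
      using entry(2) True by (intro sum.neutral) (auto simp: less_irrefl)
    moreover have "(\<Sum>i<N. if d = c \<and> bucket msk (gs \<omega> i) = r then bv (rl i) * (sig msk (gs \<omega> i) * mW (mem1 \<omega>) i) else 0)
        = sketch msk N (gs \<omega>) (wcol (us \<omega>) c) r"
      unfolding sketch_def using True rl_less by (intro sum.cong) (auto simp: wcol_def colv_def bv_def mW_mem1)
    ultimately show ?thesis unfolding eq by simp
  next
    case False
    then have c: "c < d" using assms(1) by simp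
    have "(\<Sum>e<z. if col_of e = c \<and> bucket msk (gs \<omega> (?idx e)) = r then val_of e * (sig msk (gs \<omega> (?idx e)) * mW (mem1 \<omega>) (?idx e)) else 0)
      = (\<Sum>e\<in>{e. e < z \<and> col_of e = c}. if bucket msk (gs \<omega> (?idx e)) = r then sig msk (gs \<omega> (?idx e)) * wcol (us \<omega>) c (?idx e) else 0)"
    proof (rule sum.mono_neutral_cong_right)
      fix e assume "e \<in> {e. e < z \<and> col_of e = c}"
      then show "(if col_of e = c \<and> bucket msk (gs \<omega> (?idx e)) = r then val_of e * (sig msk (gs \<omega> (?idx e)) * mW (mem1 \<omega>) (?idx e)) else 0)
        = (if bucket msk (gs \<omega> (?idx e)) = r then sig msk (gs \<omega> (?idx e)) * wcol (us \<omega>) c (?idx e) else 0)"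
        using ded_facts(3,4)[of e] entry(3)[of e] c by (auto simp: wcol_def colv_def mW_mem1)
    qed auto
    also have "\<dots> = (\<Sum>i\<in>?idx ` {e. e < z \<and> col_of e = c}. if bucket msk (gs \<omega> i) = r then sig msk (gs \<omega> i) * wcol (us \<omega>) c i else 0)"
    proof (rule sum.reindex_cong[OF _ refl refl, symmetric])
      show "inj_on ?idx {e. e < z \<and> col_of e = c}"
      proof (rule inj_onI)
        fix e e' assume e: "e \<in> {e. e < z \<and> col_of e = c}" "e' \<in> {e. e < z \<and> col_of e = c}" "?idx e = ?idx e'"
        then have "row_of e = row_of e'" using ded_facts(4)[of e] ded_facts(4)[of e'] by simp
        then show "e = e'" using e entry_unique[of e e'] by simp
      qed
    qed
    also have "\<dots> = sketch msk N (gs \<omega>) (wcol (us \<omega>) c) r"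
      unfolding sketch_def
    proof (rule sum.mono_neutral_left)
      show "?idx ` {e. e < z \<and> col_of e = c} \<subseteq> {..<N}" using ded_facts(3) by auto
      show "\<forall>i\<in>{..<N} - ?idx ` {e. e < z \<and> col_of e = c}.
        (if bucket msk (gs \<omega> i) = r then sig msk (gs \<omega> i) * wcol (us \<omega>) c i else 0) = 0"
      proof
        fix i assume i: "i \<in> {..<N} - ?idx ` {e. e < z \<and> col_of e = c}"
        have "A $$ (rl i, c) = 0"
        proof (rule ccontr)
          assume "A $$ (rl i, c) \<noteq> 0"
          then obtain e where e: "e < z" "row_of e = rl i" "col_of e = c"
            using entry_exists[of "rl i" c] rl_less[of i] c i by auto
          then have "?idx e = i" using ded_facts(1)[of i] i by simp
          then show False using e i by blast
        qed
        then show "(if bucket msk (gs \<omega> i) = r then sig msk (gs \<omega> i) * wcol (us \<omega>) c i else 0) = 0"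
          using c by (simp add: wcol_def colv_def)
      qed
    qed simp
    finally show ?thesis unfolding eq using False by simp
  qed
qed

text \<open>The residual on the numbered rows, written as a combination of d + 1 columns with
  coefficient -1 at the right-hand side, so that the estimates for spans of d + 1 vectors
  apply.\<close>

definition resid :: "(nat \<Rightarrow> real) \<Rightarrow> nat \<Rightarrow> real" where
  "resid x i = (\<Sum>j<Suc d. (if j < d then x j else -1) * colv j i)"

definition wresid :: "(nat \<Rightarrow> nat) \<Rightarrow> (nat \<Rightarrow> real) \<Rightarrow> nat \<Rightarrow> real" where
  "wresid u x i = (\<Sum>j<Suc d. (if j < d then x j else -1) * wcol u j i)"

lemma wresid: "wresid u x i = weight L (u i) * resid x i"
  by (simp add: wresid_def resid_def wcol_def sum_distrib_left algebra_simps)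

lemma sketch_wresid: "sketch msk N g (wresid u x) = (\<lambda>r. (\<Sum>j<d. x j * sketch msk N g (wcol u j) r) - sketch msk N g (wcol u d) r)"
proof -
  have "sketch msk N g (wresid u x) = sketch msk N g (\<lambda>r. \<Sum>j<Suc d. (if j < d then x j else -1) * wcol u j r)"
    by (rule arg_cong[where f = "sketch msk N g"]) (simp add: wresid_def fun_eq_iff)
  also have "\<dots> = (\<lambda>r. \<Sum>j<Suc d. (if j < d then x j else -1) * sketch msk N g (wcol u j) r)" by (rule sketch_lincomb)
  finally show ?thesis by simp
qed

definition xout :: "bool stream \<Rightarrow> nat \<Rightarrow> real" where
  "xout \<omega> j = - mgs msk (Suc d) (view (mem2 \<omega>)) d (msk + j)"

text \<open>On the first m rows the last Gram-Schmidt column is minus the sketched residual of some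
  y; in the identity rows it equals -y, which identifies y with \<open>xout\<close>.\<close>

lemma xout_minimal:
  "ip msk (sketch msk N (gs \<omega>) (wresid (us \<omega>) (xout \<omega>))) (sketch msk N (gs \<omega>) (wresid (us \<omega>) (xout \<omega>)))
    \<le> ip msk (sketch msk N (gs \<omega>) (wresid (us \<omega>) x)) (sketch msk N (gs \<omega>) (wresid (us \<omega>) x))"
proof -
  let ?G = "view (mem2 \<omega>)"
  define Q where "Q = mgs msk (Suc d) ?G d"
  have "\<exists>y. \<forall>r. Q r = ?G d r - (\<Sum>j<d. y j * ?G j r)" unfolding Q_def by (rule mgs_col_span) simp
  then obtain y where y: "\<And>r. Q r = ?G d r - (\<Sum>j<d. y j * ?G j r)" by blast
  have yx: "y j = xout \<omega> j" if "j < d" for j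
  proof -
    have "(\<Sum>i<d. y i * ?G i (msk + j)) = (\<Sum>i<d. if i = j then y j else 0)"
      using that by (intro sum.cong) (auto simp: view_bottom)
    then show ?thesis using y[of "msk + j"] that by (simp add: xout_def Q_def[symmetric] view_bottom del: mgs.simps)
  qed
  have sk: "sketch msk N (gs \<omega>) (wresid (us \<omega>) x) r = - (?G d r - (\<Sum>j<d. x j * ?G j r))" if "r < msk" for x r
    using that unfolding sketch_wresid by (simp add: view_top)
  have "ip msk (sketch msk N (gs \<omega>) (wresid (us \<omega>) (xout \<omega>))) (sketch msk N (gs \<omega>) (wresid (us \<omega>) (xout \<omega>))) = ip msk Q Q"
  proof -
    have "sketch msk N (gs \<omega>) (wresid (us \<omega>) (xout \<omega>)) r = - Q r" if "r < msk" for r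
      using sk[OF that, of "xout \<omega>"] y[of r] yx by simp
    then show ?thesis unfolding ip_def by (intro sum.cong) simp_all
  qed
  also have "\<dots> \<le> ip msk (\<lambda>r. ?G d r - (\<Sum>j<d. x j * ?G j r)) (\<lambda>r. ?G d r - (\<Sum>j<d. x j * ?G j r))"
    unfolding Q_def by (rule mgs_residual_minimal)
  also have "\<dots> = ip msk (sketch msk N (gs \<omega>) (wresid (us \<omega>) x)) (sketch msk N (gs \<omega>) (wresid (us \<omega>) x))"
    unfolding ip_def by (intro sum.cong refl) (simp only: sk lessThan_iff minus_mult_minus)
  finally show ?thesis .
qed

text \<open>The residual on all n rows: rows where the matrix vanishes still count in the
  norm.\<close>

definition full :: "(nat \<Rightarrow> real) \<Rightarrow> nat \<Rightarrow> real" where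
  "full x r = (\<Sum>j<d. x j * A $$ (r, j)) - b $ r"

lemma l_residual: "l (A *\<^sub>v vec d x - b) = nf (full x)"
proof -
  have "A *\<^sub>v vec d x - b \<in> carrier_vec n" using A b by simp
  then have "l (A *\<^sub>v vec d x - b) = nf (\<lambda>i. (A *\<^sub>v vec d x - b) $ i)" by (rule l_eq_nf)
  also have "\<dots> = nf (full x)"
    using A b by (intro nf_cong) (simp add: full_def scalar_prod_def mult.commute atLeast0LessThan)
  finally show ?thesis .
qed

lemma full_rl: "i < N \<Longrightarrow> full x (rl i) = resid x i"
  by (simp add: full_def resid_def colv_def)

lemma full_zero_row: "r < n \<Longrightarrow> r \<notin> rl ` {..<N} \<Longrightarrow> full x r = - b $ r"
  using zero_row by (simp add: full_def)

definition nlev :: real where "nlev = samples N (Suc d)"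
definition dil :: real where "dil = 40 * ((real L + 1) * (conc\<^sup>2 + 4 * trunc L N) * harm N)"

definition sampling_ok :: "(nat \<Rightarrow> nat) \<Rightarrow> bool" where
  "sampling_ok u \<longleftrightarrow> (\<forall>T\<in>level_sets N (Suc d) colv. T \<noteq> {} \<longrightarrow> (phi (card T))\<^sup>2 / (64 * nlev) \<le> (\<Sum>i\<in>T. (weight L (u i))\<^sup>2))"

definition dilation_ok :: "(nat \<Rightarrow> real) \<Rightarrow> (nat \<Rightarrow> nat) \<Rightarrow> bool" where
  "dilation_ok x u \<longleftrightarrow> (\<Sum>i<N. (weight L (u i) * resid x i)\<^sup>2) \<le> dil * (nf (full x))\<^sup>2"

definition sketch_ok :: "(nat \<Rightarrow> nat) \<Rightarrow> (nat \<Rightarrow> nat) \<Rightarrow> bool" where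
  "sketch_ok u g \<longleftrightarrow> (\<forall>y. let v = (\<lambda>r. \<Sum>j<Suc d. y j * wcol u j r); S = sketch msk N g v in
     ip N v v / 2 \<le> ip msk S S \<and> ip msk S S \<le> 3 / 2 * ip N v v)"

lemma sketch_okD:
  assumes "sketch_ok u g"
  shows "ip N (wresid u x) (wresid u x) \<le> 2 * ip msk (sketch msk N g (wresid u x)) (sketch msk N g (wresid u x))"
    "ip msk (sketch msk N g (wresid u x)) (sketch msk N g (wresid u x)) \<le> 3 / 2 * ip N (wresid u x) (wresid u x)"
proof -
  let ?y = "\<lambda>j. if j < d then x j else -1"
  have "wresid u x = (\<lambda>r. \<Sum>j<Suc d. ?y j * wcol u j r)" by (simp add: wresid_def fun_eq_iff)
  then have "ip N (wresid u x) (wresid u x) / 2 \<le> ip msk (sketch msk N g (wresid u x)) (sketch msk N g (wresid u x)) \<and>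
    ip msk (sketch msk N g (wresid u x)) (sketch msk N g (wresid u x)) \<le> 3 / 2 * ip N (wresid u x) (wresid u x)"
    using assms[unfolded sketch_ok_def Let_def, rule_format, of ?y] by (simp only:)
  then show "ip N (wresid u x) (wresid u x) \<le> 2 * ip msk (sketch msk N g (wresid u x)) (sketch msk N g (wresid u x))"
    "ip msk (sketch msk N g (wresid u x)) (sketch msk N g (wresid u x)) \<le> 3 / 2 * ip N (wresid u x) (wresid u x)"
    by linarith+
qed

lemma ip_wresid: "ip N (wresid u x) (wresid u x) = (\<Sum>i<N. (weight L (u i) * resid x i)\<^sup>2)"
  by (simp add: ip_def wresid power2_eq_square)

lemma nlev_pos: "20 \<le> nlev"
  by (simp add: nlev_def samples_ge)

text \<open>The squared weighted Euclidean residual of x is at most 2 * 3/2 = 3 times that of x0,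
  hence at most 3 * dil * \<Lambda> ^ 2 with \<Lambda> the norm of the residual of x0.
  \<open>nf_upper\<close> reduces the norm of the residual of x to one level set, whose squared term
  is at most 64 * nlev times the weighted one; this gives 192 = 64 * 3. The zero rows account for
  the final 1.\<close>

lemma output_bound:
  assumes ok: "sampling_ok u" "dilation_ok x0 u" "sketch_ok u g"
    and min: "ip msk (sketch msk N g (wresid u x)) (sketch msk N g (wresid u x))
      \<le> ip msk (sketch msk N g (wresid u x0)) (sketch msk N g (wresid u x0))"
    and dil0: "0 \<le> dil"
  shows "nf (full x) \<le> ((2 * real (Suc L) + 3) * sqrt (192 * nlev * dil) + 1) * nf (full x0)"
proof -
  let ?R = "rl ` {..<N}"
  let ?on = "\<lambda>x r. if r \<in> ?R then full x r else 0" and ?off = "\<lambda>x r. if r \<in> ?R then 0 else full x r"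
  let ?\<Lambda> = "nf (full x0)"
  have total: "(\<Sum>i<N. (weight L (u i) * resid x i)\<^sup>2) \<le> 3 * dil * ?\<Lambda>\<^sup>2"
  proof -
    have "ip N (wresid u x) (wresid u x) \<le> 2 * ip msk (sketch msk N g (wresid u x)) (sketch msk N g (wresid u x))"
      by (rule sketch_okD[OF ok(3)])
    also have "\<dots> \<le> 2 * ip msk (sketch msk N g (wresid u x0)) (sketch msk N g (wresid u x0))" using min by simp
    also have "\<dots> \<le> 3 * ip N (wresid u x0) (wresid u x0)" using sketch_okD(2)[OF ok(3), of x0] by simp
    also have "\<dots> \<le> 3 * (dil * ?\<Lambda>\<^sup>2)" using ok(2) by (simp add: dilation_ok_def ip_wresid)
    finally show ?thesis by (simp add: ip_wresid)
  qed
  have on: "nf (?on x) \<le> (2 * real (Suc L) + 3) * (sqrt (192 * nlev * dil) * ?\<Lambda>)"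
  proof (cases "\<exists>r\<in>?R. full x r \<noteq> 0")
    case False
    then have "nf (?on x) = 0" by (auto simp: nf_eq_0_iff)
    then show ?thesis using nf_nonneg[of "full x0"] dil0 nlev_pos by simp
  next
    case True
    then obtain r0 where r0: "r0 \<in> ?R" "full x r0 \<noteq> 0" by blast
    have Rn: "?R \<subseteq> {..<n}" using rl_less by auto
    have "card ?R \<le> 2 ^ Suc L" using card_image[OF rl_inj] L_facts(2) by simp
    from nf_upper[where v = "full x", OF Rn this r0] obtain t where t: "0 < t" "{r \<in> ?R. t \<le> \<bar>full x r\<bar>} \<noteq> {}"
      "nf (?on x) \<le> (2 * real (Suc L) + 3) * (t * phi (card {r \<in> ?R. t \<le> \<bar>full x r\<bar>}))" by blast
    define T where "T = {i. i < N \<and> t \<le> \<bar>resid x i\<bar>}"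
    have img: "{r \<in> ?R. t \<le> \<bar>full x r\<bar>} = rl ` T" by (auto simp: T_def full_rl)
    have "inj_on rl T" by (rule inj_on_subset[OF rl_inj]) (auto simp: T_def)
    then have cardT: "card {r \<in> ?R. t \<le> \<bar>full x r\<bar>} = card T" unfolding img by (rule card_image)
    have "T \<noteq> {}" using t(2) img by auto
    moreover have "T \<in> level_sets N (Suc d) colv"
      unfolding level_sets_def T_def resid_def
      by (intro CollectI exI[of _ t] exI[of _ "\<lambda>j. if j < d then x j else -1"] conjI refl TrueI)
    ultimately have "(phi (card T))\<^sup>2 / (64 * nlev) \<le> (\<Sum>i\<in>T. (weight L (u i))\<^sup>2)"
      using ok(1) by (auto simp: sampling_ok_def)
    then have "t\<^sup>2 * ((phi (card T))\<^sup>2 / (64 * nlev)) \<le> t\<^sup>2 * (\<Sum>i\<in>T. (weight L (u i))\<^sup>2)"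
      by (intro mult_left_mono) auto
    also have "\<dots> = (\<Sum>i\<in>T. (weight L (u i))\<^sup>2 * t\<^sup>2)" by (simp add: sum_distrib_left mult.commute)
    also have "\<dots> \<le> (\<Sum>i\<in>T. (weight L (u i))\<^sup>2 * \<bar>resid x i\<bar>\<^sup>2)"
      using t(1) by (intro sum_mono mult_left_mono power_mono) (auto simp: T_def)
    also have "\<dots> = (\<Sum>i\<in>T. (weight L (u i) * resid x i)\<^sup>2)" by (simp add: power_mult_distrib)
    also have "\<dots> \<le> (\<Sum>i<N. (weight L (u i) * resid x i)\<^sup>2)" by (intro sum_mono2) (auto simp: T_def)
    also have "\<dots> \<le> 3 * dil * ?\<Lambda>\<^sup>2" by (rule total)
    finally have "t\<^sup>2 * (phi (card T))\<^sup>2 \<le> 3 * dil * ?\<Lambda>\<^sup>2 * (64 * nlev)"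
      using nlev_pos by (simp add: pos_divide_le_eq)
    then have "(t * phi (card T))\<^sup>2 \<le> 192 * nlev * dil * ?\<Lambda>\<^sup>2" by (simp add: power_mult_distrib mult_ac)
    then have "sqrt ((t * phi (card T))\<^sup>2) \<le> sqrt (192 * nlev * dil * ?\<Lambda>\<^sup>2)" by (rule real_sqrt_le_mono)
    then have "t * phi (card T) \<le> sqrt (192 * nlev * dil) * ?\<Lambda>"
      using t(1) phi_nonneg[of "card T"] nf_nonneg[of "full x0"] by (simp add: real_sqrt_mult)
    then have "(2 * real (Suc L) + 3) * (t * phi (card T)) \<le> (2 * real (Suc L) + 3) * (sqrt (192 * nlev * dil) * ?\<Lambda>)"
      by (intro mult_left_mono) auto
    then show ?thesis using t(3) unfolding cardT by linarith
  qed
  have "nf (?off x) = nf (?off x0)"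
    by (rule nf_cong) (auto simp: full_zero_row)
  also have "\<dots> \<le> ?\<Lambda>" by (rule nf_mono) auto
  finally have off: "nf (?off x) \<le> ?\<Lambda>" .
  have "nf (full x) = nf (\<lambda>r. ?on x r + ?off x r)" by (rule nf_cong) auto
  also have "\<dots> \<le> nf (?on x) + nf (?off x)" by (rule nf_add)
  finally show ?thesis using on off by (simp add: algebra_simps)
qed

end

section \<open>Running time, near-minimiser and constants\<close>

context regression
begin

lemma dlen_le: "2 ^ dlen \<le> 2 * Suc d"
proof (cases dlen)
  case (Suc j)
  then have "2 ^ j < Suc d" using dlen(2)[of j] by simp
  then show ?thesis using Suc by simp
qed simp

lemma msk_eq: "msk = 512 * (2 ^ dlen)\<^sup>2"
  by (simp add: msk_def size_bits_def power_add power_mult power2_eq_square power_mult_distrib[symmetric])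

text \<open>The lower bound makes the failure probability 8 * (d + 1) ^ 2 / m of
  \<open>sketch_embedding\<close> at most 1/64; the upper bound keeps the cost of Gram-Schmidt,
  about d ^ 2 * m, polynomial in d.\<close>

lemma msk_bounds: "512 * (Suc d)\<^sup>2 \<le> msk" "msk \<le> 2048 * (Suc d)\<^sup>2"
proof -
  have "(Suc d)\<^sup>2 \<le> (2 ^ dlen)\<^sup>2" by (intro power_mono dlen(1)) simp
  then show "512 * (Suc d)\<^sup>2 \<le> msk" by (simp add: msk_eq)
  have "(2 ^ dlen)\<^sup>2 \<le> (2 * Suc d)\<^sup>2" by (intro power_mono dlen_le) simp
  then show "msk \<le> 2048 * (Suc d)\<^sup>2" by (simp add: msk_eq power2_eq_square)
qed

text \<open>Each row costs logarithmically many coin tosses, and Gram-Schmidt takes at most 43100 *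
  (d + 1) ^ 4 steps. The polynomial 1000000 * (d + 1) ^ 4 dominates the latter and also the sketch
  size, so that \<open>L\<close> and \<open>size_bits\<close> are at most 2 * ln f.\<close>

lemma time_bound_le:
  assumes f: "f = real (z + 1000000 * Suc d ^ 4)"
  shows "real time_bound \<le> f * (100 + 60 * ln f)"
proof -
  define D where "D = real (Suc d)"
  have D1: "1 \<le> D" by (simp add: D_def)
  have f': "f = real z + 1000000 * D ^ 4" by (simp add: f D_def)
  have D4: "D \<le> D ^ 4" "1 \<le> D ^ 4" using D1 power_increasing[of 1 4 D] by (simp_all add: one_le_power)
  have D24: "D\<^sup>2 \<le> D ^ 4" using D1 by (intro power_increasing) auto
  have f0: "1 \<le> f" "0 \<le> ln f" using f' D4 by simp_all
  have m: "real msk \<le> 2048 * D\<^sup>2"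
  proof -
    have "real msk \<le> real (2048 * (Suc d)\<^sup>2)" using msk_bounds(2) by (simp only: of_nat_le_iff)
    then show ?thesis by (simp add: D_def)
  qed
  have Nz: "real N \<le> real z" using N_le_z by simp
  have L: "real L \<le> 2 * ln f"
  proof (cases "1 \<le> N")
    case True
    have "(2 :: real) ^ L \<le> real N" using L_facts(1)[OF True] by (metis of_nat_le_iff of_nat_numeral of_nat_power)
    also have "\<dots> \<le> f" using Nz D4 f' by linarith
    finally show ?thesis by (rule two_power_le_imp_le_ln)
  next
    case False
    then have "bitlen N = 0" using bitlen(2)[of 0 N] by (cases "bitlen N") auto
    then show ?thesis using f0 by (simp add: L_def)
  qed
  have bl: "real (bitlen N) \<le> real L + 1" by (simp add: L_def)
  have sb: "real size_bits \<le> 2 * ln f"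
  proof -
    have "(2 :: real) ^ size_bits = real msk" by (simp add: msk_def)
    also have "\<dots> \<le> f" using m D24 f' D4 by linarith
    finally show ?thesis by (rule two_power_le_imp_le_ln)
  qed
  have dl: "real dlen \<le> 2 * ln f" using sb by (simp add: size_bits_def)
  have d: "real d \<le> D" by (simp add: D_def)
  have mgs_time: "D * (D * (13 + 11 * real msk + 10 * (real msk + real d)) + 7) \<le> 43100 * D ^ 4"
  proof -
    have DD: "D \<le> D\<^sup>2" "1 \<le> D\<^sup>2" using D1 power_increasing[of 1 2 D] by (simp_all add: one_le_power)
    have "13 + 11 * real msk + 10 * (real msk + real d) \<le> 43031 * D\<^sup>2"
    proof -
      have "21 * real msk \<le> 43008 * D\<^sup>2" "10 * real d \<le> 10 * D\<^sup>2" "13 \<le> 13 * D\<^sup>2" using m d DD by simp_all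
      moreover have "13 + 11 * real msk + 10 * (real msk + real d) = 13 + 21 * real msk + 10 * real d" by simp
      ultimately show ?thesis by linarith
    qed
    then have "D * (13 + 11 * real msk + 10 * (real msk + real d)) \<le> D * (43031 * D\<^sup>2)"
      using D1 by (intro mult_left_mono) auto
    then have "D * (D * (13 + 11 * real msk + 10 * (real msk + real d)) + 7) \<le> D * (D * (43031 * D\<^sup>2) + 7)"
      using D1 by (intro mult_left_mono add_right_mono) auto
    also have "\<dots> = 43031 * D ^ 4 + 7 * D" by (simp add: power_numeral_reduce algebra_simps power2_eq_square)
    also have "\<dots> \<le> 43100 * D ^ 4" using D4 by linarith
    finally show ?thesis .
  qed
  have N1: "real N * (10 * real L + 12) \<le> real z * (20 * ln f + 12)"
    using Nz L f0 by (intro mult_mono) auto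
  have N2: "real N * (7 * (real size_bits + 1) + 25) \<le> real z * (14 * ln f + 32)"
    using Nz sb f0 by (intro mult_mono) auto
  have "real time_bound = 2 + ((real z * 9 + 3) + ((real N * 5 + 3) + ((2 * real N + 6 * real (bitlen N) + 4) + ((5 * real dlen + 4) + ((5 * D + 5)
     + ((real N * (10 * real L + 12) + 3) + ((real N * (7 * (real size_bits + 1) + 25) + 3) + ((real z * 16 + 3) + ((real d * 8 + 3)
     + ((D * (D * (13 + 11 * real msk + 10 * (real msk + real d)) + 7) + 3) + (real d * 10 + 3)))))))))))"
    by (simp add: time_bound_def D_def algebra_simps)
  also have "\<dots> \<le> real z * 76 + real z * (34 * ln f) + 22 * ln f + 200 * D ^ 4 + 43100 * D ^ 4"
    using N1 N2 mgs_time Nz L bl dl d D4 by (simp add: algebra_simps)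
  also have "\<dots> \<le> f * 76 + f * (34 * ln f) + f * (22 * ln f) + f"
  proof -
    have "real z * (34 * ln f) \<le> f * (34 * ln f)" using f' f0 D4 by (intro mult_right_mono) auto
    moreover have "1 * (22 * ln f) \<le> f * (22 * ln f)" using f0 by (intro mult_right_mono) auto
    ultimately show ?thesis using f' D4 by linarith
  qed
  also have "\<dots> \<le> f * (100 + 60 * ln f)"
    using f0 mult_nonneg_nonneg[of f "ln f"] by (simp add: algebra_simps)
  finally show ?thesis .
qed

text \<open>This avoids showing that the infimum is attained: a positive infimum leaves room for the
  factor 2. If it is 0, an exact solution is required. The Euclidean minimiser y is one, since a
  positive least-squares error q would bound the norm of every residual below by phi 1 * sqrt (q /
  n).\<close>

lemma ex_near_minimizer:
  "\<exists>x0. nf (full x0) \<le> 2 * (INF x\<in>carrier_vec d. l (A *\<^sub>v x - b))"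
proof -
  let ?I = "INF x\<in>carrier_vec d. l (A *\<^sub>v x - b)"
  have val: "l (A *\<^sub>v x - b) = nf (full (\<lambda>j. x $ j))" if "x \<in> carrier_vec d" for x
    using l_residual[of "\<lambda>j. x $ j"] that by (metis carrier_vecD eq_vecI dim_vec index_vec)
  have ne: "carrier_vec d \<noteq> ({} :: real vec set)" using zero_carrier_vec[of d] by blast
  have bdd: "bdd_below ((\<lambda>x. l (A *\<^sub>v x - b)) ` carrier_vec d)"
    by (rule bdd_belowI2[of _ 0]) (simp add: val nf_nonneg)
  have I0: "0 \<le> ?I" by (rule cINF_greatest[OF ne]) (simp add: val nf_nonneg)
  show ?thesis
  proof (cases "?I = 0")
    case False
    then have "?I < 2 * ?I" using I0 by simp
    then obtain x where "x \<in> carrier_vec d" "l (A *\<^sub>v x - b) < 2 * ?I" using cINF_less_iff[OF ne bdd] by blast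
    then show ?thesis by (intro exI[of _ "\<lambda>j. x $ j"]) (simp add: val)
  next
    case True
    define G where "G j r = (if j < d then A $$ (r, j) else b $ r)" for j r
    define Q where "Q = mgs n (Suc d) G d"
    have "\<exists>y. \<forall>r. Q r = G d r - (\<Sum>j<d. y j * G j r)" unfolding Q_def by (rule mgs_col_span) simp
    then obtain y where y: "\<And>r. Q r = G d r - (\<Sum>j<d. y j * G j r)" by blast
    have full_G: "G d r - (\<Sum>j<d. x j * G j r) = - full x r" for x r by (simp add: G_def full_def)
    have Qy: "Q r = - full y r" for r using y full_G by simp
    have min: "ip n Q Q \<le> (\<Sum>r<n. (full x r)\<^sup>2)" for x
      using mgs_residual_minimal[of n d G x] unfolding Q_def[symmetric] full_G
      by (simp add: ip_def power2_eq_square)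
    show ?thesis
    proof (cases "ip n Q Q = 0")
      case True
      then have "\<forall>r<n. full y r = 0" by (simp add: ip_self_eq_0 Qy)
      then have "nf (full y) = 0" by (simp add: nf_eq_0_iff)
      then show ?thesis using I0 by (intro exI[of _ y]) simp
    next
      case False
      define q where "q = ip n Q Q"
      have q: "0 < q" using False ip_self_nonneg[of n Q] by (simp add: q_def)
      have "phi 1 * sqrt (q / real n) \<le> nf (full x)" for x
      proof -
        have "\<exists>r<n. q / real n \<le> (full x r)\<^sup>2"
        proof (rule ccontr)
          assume "\<not> (\<exists>r<n. q / real n \<le> (full x r)\<^sup>2)"
          then have "(\<Sum>r<n. (full x r)\<^sup>2) < (\<Sum>r<n. q / real n)"
            using n_pos by (intro sum_strict_mono) (auto simp: not_le lessThan_empty_iff)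
          then show False using min[of x] n_pos by (simp add: q_def)
        qed
        then obtain r where r: "r < n" "q / real n \<le> (full x r)\<^sup>2" by blast
        then have "sqrt (q / real n) \<le> \<bar>full x r\<bar>" using real_sqrt_le_mono[OF r(2)] by simp
        then have "phi 1 * sqrt (q / real n) \<le> phi 1 * \<bar>full x r\<bar>" using phi_nonneg by (intro mult_left_mono)
        also have "\<dots> \<le> nf (full x)" using nf_ge_coord[OF r(1), of "full x"] by (simp add: mult.commute)
        finally show ?thesis .
      qed
      then have "phi 1 * sqrt (q / real n) \<le> ?I" by (intro cINF_greatest[OF ne]) (simp add: val)
      moreover have "0 < phi 1 * sqrt (q / real n)" using q n_pos phi_pos[of 1] by simp
      ultimately show ?thesis using True by simp
    qed
  qed
qed

lemma harm_N: "1 \<le> N \<Longrightarrow> 1 \<le> (harm N :: real) \<and> harm N \<le> 1 + ln (real n)"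
proof
  assume N: "1 \<le> N"
  have "harm 1 \<le> (harm N :: real)" using N by (intro harm_mono) auto
  then show "1 \<le> (harm N :: real)" by (simp add: harm_expand)
  have "(harm N :: real) \<le> 1 + ln (real N)" by (rule harm_le_ln[OF N])
  also have "\<dots> \<le> 1 + ln (real n)" using N N_le_n by simp
  finally show "harm N \<le> 1 + ln (real n)" .
qed

text \<open>\<open>conc\<close> is at most \<open>mmc\<close> times 4 * (1 + ln n), which turns the
  fourth power of the logarithm into the fifth. The first bound serves to absorb additive
  constants.\<close>

lemma conc_factor:
  "1 \<le> sqrt (real d) * conc * (1 + ln (real n)) ^ 4"
  "210002 * (sqrt (real d) * conc * (1 + ln (real n)) ^ 4) \<le> sqrt (real d) * (1000000 * (1 + ln (real n)) ^ 5) * mmc n l"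
proof -
  define lam where "lam = 1 + ln (real n)"
  have l1: "1 \<le> lam" using n_pos by (simp add: lam_def)
  have C1: "1 \<le> conc" by (rule conc_ge_1)
  have d1: "1 \<le> real d" using d_pos by simp
  have one: "1 \<le> sqrt (real d) * conc * lam ^ 4"
  proof -
    have "1 * 1 * 1 \<le> sqrt (real d) * conc * lam ^ 4" using d1 C1 l1 by (intro mult_mono) (auto simp: one_le_power)
    then show ?thesis by simp
  qed
  have conc_le: "conc \<le> 4 * lam * mmc n l"
  proof -
    have "ln (4 * real n + 1) \<le> ln (exp 2 * real n)"
    proof -
      have "4 * real n + 1 \<le> 5 * real n" using n_pos by simp
      also have "\<dots> \<le> exp 2 * real n" using exp_lower_Taylor_quadratic[of "2 :: real"] by (intro mult_right_mono) auto
      finally show ?thesis using n_pos by simp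
    qed
    also have "\<dots> = 2 + ln (real n)" using n_pos by (simp add: ln_mult)
    also have "\<dots> \<le> (2 * lam)\<^sup>2"
    proof -
      have "2 * lam * 1 \<le> (2 * lam) * (2 * lam)" using l1 by (intro mult_left_mono) auto
      moreover have "2 + ln (real n) \<le> 2 * lam" using n_pos by (simp add: lam_def)
      ultimately show ?thesis unfolding power2_eq_square by linarith
    qed
    finally have "sqrt (ln (4 * real n + 1)) \<le> sqrt ((2 * lam)\<^sup>2)" by (rule real_sqrt_le_mono)
    also have "\<dots> = 2 * lam" unfolding real_sqrt_abs using l1 by simp
    finally have "sqrt (ln (4 * real n + 1)) \<le> 2 * lam" .
    then have "mmc n l * (2 * sqrt (ln (4 * real n + 1))) \<le> mmc n l * (2 * (2 * lam))"
      using mmc_nonneg by (intro mult_left_mono) auto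
    then show ?thesis by (simp add: conc_def algebra_simps)
  qed
  show "1 \<le> sqrt (real d) * conc * (1 + ln (real n)) ^ 4" using one by (simp add: lam_def)
  have "210002 * (sqrt (real d) * conc * lam ^ 4) \<le> 210002 * (sqrt (real d) * (4 * lam * mmc n l) * lam ^ 4)"
    using conc_le l1 by (intro mult_left_mono mult_right_mono) auto
  also have "\<dots> = 840008 * (sqrt (real d) * mmc n l * lam ^ 5)" by (simp add: power_numeral_reduce algebra_simps)
  also have "\<dots> \<le> 1000000 * (sqrt (real d) * mmc n l * lam ^ 5)"
    using mmc_nonneg l1 by (intro mult_right_mono) auto
  finally show "210002 * (sqrt (real d) * conc * (1 + ln (real n)) ^ 4) \<le> sqrt (real d) * (1000000 * (1 + ln (real n)) ^ 5) * mmc n l"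
    by (simp add: lam_def mult_ac)
qed

text \<open>With lam = 1 + ln n, \<open>dil\<close> is of order conc ^ 2 * lam ^ 4 and
  \<open>nlev\<close> of order d * lam, so the square root is of order sqrt d * conc * lam ^ 3 after
  rounding up; the number of layers adds one power of lam. The leading factor 2 pays for
  \<open>ex_near_minimizer\<close>.\<close>

lemma factor_le:
  assumes N: "1 \<le> N"
  shows "0 \<le> dil"
    "2 * ((2 * real (Suc L) + 3) * sqrt (192 * nlev * dil) + 1) \<le> sqrt (real d) * (1000000 * (1 + ln (real n)) ^ 5) * mmc n l"
proof -
  define lam where "lam = 1 + ln (real n)"
  have l1: "1 \<le> lam" using n_pos by (simp add: lam_def)
  have h: "1 \<le> (harm N :: real)" "harm N \<le> lam" using harm_N[OF N] by (auto simp: lam_def)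
  have C1: "1 \<le> conc" by (rule conc_ge_1)
  have L: "real L + 1 \<le> 2 * lam"
  proof -
    have "(2 :: real) ^ L \<le> real N" using L_facts(1)[OF N] by (metis of_nat_le_iff of_nat_numeral of_nat_power)
    also have "\<dots> \<le> real n" using N_le_n by simp
    finally have "real L \<le> 2 * ln (real n)" by (rule two_power_le_imp_le_ln)
    then show ?thesis by (simp add: lam_def)
  qed
  have tr: "0 \<le> trunc L N" "trunc L N \<le> 80 * lam\<^sup>2"
  proof -
    show "0 \<le> trunc L N" using h by (simp add: trunc_def)
    have "40 * (real L + 1) * harm N \<le> 40 * (2 * lam) * lam" using L h l1 by (intro mult_mono) auto
    then show "trunc L N \<le> 80 * lam\<^sup>2" by (simp add: trunc_def power2_eq_square)
  qed
  have c: "conc\<^sup>2 + 4 * trunc L N \<le> 321 * (conc\<^sup>2 * lam\<^sup>2)"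
  proof -
    have "1 \<le> lam\<^sup>2" "1 \<le> conc\<^sup>2" using l1 C1 by (simp_all add: one_le_power)
    then have "conc\<^sup>2 * 1 \<le> conc\<^sup>2 * lam\<^sup>2" "1 * lam\<^sup>2 \<le> conc\<^sup>2 * lam\<^sup>2" by (intro mult_left_mono mult_right_mono; simp)+
    then show ?thesis using tr by linarith
  qed
  show dil0: "0 \<le> dil" unfolding dil_def using h tr by simp
  have dil: "dil \<le> 25680 * (conc\<^sup>2 * lam ^ 4)"
  proof -
    have "(real L + 1) * (conc\<^sup>2 + 4 * trunc L N) \<le> (2 * lam) * (321 * (conc\<^sup>2 * lam\<^sup>2))"
      using L c tr l1 by (intro mult_mono) auto
    then have "(real L + 1) * (conc\<^sup>2 + 4 * trunc L N) * harm N \<le> (2 * lam) * (321 * (conc\<^sup>2 * lam\<^sup>2)) * lam"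
      using h l1 by (rule_tac mult_mono) auto
    also have "\<dots> = 642 * (conc\<^sup>2 * lam ^ 4)" by (simp add: power_numeral_reduce power2_eq_square algebra_simps)
    finally show ?thesis unfolding dil_def by linarith
  qed
  have d1: "1 \<le> real d" using d_pos by simp
  have nlev: "nlev \<le> 44 * (real d * lam)"
  proof -
    have "ln (real N + 1) \<le> ln (2 * real n)" using N N_le_n n_pos by simp
    also have "\<dots> = ln 2 + ln (real n)" using n_pos by (simp add: ln_mult)
    also have "\<dots> \<le> lam" using ln_le_minus_one[of 2] by (simp add: lam_def)
    finally have "8 * (real (Suc d) + 1) * ln (real N + 1) \<le> 8 * (3 * real d) * lam"
      using d1 by (intro mult_mono) auto
    moreover have "1 * 1 \<le> real d * lam" using d1 l1 by (intro mult_mono) auto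
    ultimately show ?thesis by (simp add: nlev_def samples_def)
  qed
  have "192 * nlev * dil \<le> 192 * (44 * (real d * lam)) * (25680 * (conc\<^sup>2 * lam ^ 4))"
    using nlev nlev_pos dil dil0 l1 d1 by (intro mult_mono) auto
  also have "\<dots> = 216944640 * (real d * conc\<^sup>2 * lam ^ 5)" by (simp add: power_numeral_reduce algebra_simps)
  \<comment> \<open>Rounding up to 15000 ^ 2 and to an even power of lam produces a perfect
    square.\<close>
  also have "\<dots> \<le> 225000000 * (real d * conc\<^sup>2 * lam ^ 6)"
  proof -
    have "lam ^ 5 \<le> lam ^ 6" using l1 by (intro power_increasing) auto
    then have "real d * conc\<^sup>2 * lam ^ 5 \<le> real d * conc\<^sup>2 * lam ^ 6" by (intro mult_left_mono) auto
    moreover have "0 \<le> real d * conc\<^sup>2 * lam ^ 5" using l1 by simp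
    ultimately show ?thesis by linarith
  qed
  also have "\<dots> = (15000 * sqrt (real d) * conc * lam ^ 3)\<^sup>2"
    by (simp add: power_mult_distrib flip: power_mult)
  finally have "sqrt (192 * nlev * dil) \<le> sqrt ((15000 * sqrt (real d) * conc * lam ^ 3)\<^sup>2)" by (rule real_sqrt_le_mono)
  then have sq: "sqrt (192 * nlev * dil) \<le> 15000 * sqrt (real d) * conc * lam ^ 3" using C1 l1 by simp
  have "(2 * real (Suc L) + 3) * sqrt (192 * nlev * dil) \<le> (7 * lam) * (15000 * sqrt (real d) * conc * lam ^ 3)"
    using L l1 sq nlev_pos dil0 by (intro mult_mono) auto
  also have "\<dots> = 105000 * (sqrt (real d) * conc * lam ^ 4)" by (simp add: power_numeral_reduce algebra_simps)
  finally have main: "(2 * real (Suc L) + 3) * sqrt (192 * nlev * dil) \<le> 105000 * (sqrt (real d) * conc * lam ^ 4)" .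
  have "2 * ((2 * real (Suc L) + 3) * sqrt (192 * nlev * dil) + 1) \<le> 210002 * (sqrt (real d) * conc * lam ^ 4)"
    using main conc_factor(1) by (simp add: lam_def)
  also have "\<dots> \<le> sqrt (real d) * (1000000 * (1 + ln (real n)) ^ 5) * mmc n l"
    using conc_factor(2) by (simp add: lam_def)
  finally show "2 * ((2 * real (Suc L) + 3) * sqrt (192 * nlev * dil) + 1) \<le> sqrt (real d) * (1000000 * (1 + ln (real n)) ^ 5) * mmc n l" .
qed

lemma factor_ge_2: "2 \<le> sqrt (real d) * (1000000 * (1 + ln (real n)) ^ 5) * mmc n l"
  using conc_factor by linarith

text \<open>This makes the success event a function of the two draws and hence measurable.\<close>

lemma mem2_cong:
  assumes "\<And>i. i < N \<Longrightarrow> us \<omega> i = us \<omega>' i" "\<And>i. i < N \<Longrightarrow> gs \<omega> i = gs \<omega>' i"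
  shows "mem2 \<omega> = mem2 \<omega>'"
proof -
  have 1: "mem1 \<omega> = mem1 \<omega>'"
    unfolding mem1_def using assms(1) by (auto simp: fun_eq_iff)
  have "hashed N x (gs \<omega>) = hashed N x (gs \<omega>')" for x
    unfolding hashed_def using assms(2) by (auto simp: fun_eq_iff intro!: mem.fold_congs sum.cong)
  then show ?thesis by (simp only: mem2_def 1)
qed

text \<open>The failure probabilities 1/40, 1/20 and 1/40 add up to 1/10. The sketch is averaged for
  fixed weights u, because the subspace that it must preserve depends on u.\<close>

lemma prob_events:
  assumes N: "1 \<le> N"
  shows "9/10 \<le> avg (2 ^ L) N (\<lambda>u. avg (2 ^ Suc size_bits) N (\<lambda>g. of_bool (sampling_ok u \<and> dilation_ok x0 u \<and> sketch_ok u g)))"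
proof -
  let ?M = "2 * msk"
  have M: "2 ^ Suc size_bits = ?M" by (simp add: msk_def)
  have M0: "0 < ?M" "0 < msk" by (simp_all add: msk_def)
  have b1: "pr (2 ^ L) N (\<lambda>u. \<not> sampling_ok u) \<le> 1/40"
  proof -
    have "\<not> sampling_ok u \<longleftrightarrow> (\<exists>T\<in>level_sets N (Suc d) colv. T \<noteq> {} \<and>
      (\<Sum>i\<in>T. (weight L (u i))\<^sup>2) < (phi (card T))\<^sup>2 / (64 * samples N (Suc d)))" for u
      by (auto simp: sampling_ok_def nlev_def not_le)
    then show ?thesis using pr_sampling[OF N_le_n L_facts(2), of "Suc d" colv] by (simp only:)
  qed
  have b2: "pr (2 ^ L) N (\<lambda>u. \<not> dilation_ok x0 u) \<le> 1/20"
  proof -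
    have w: "t * phi (card T) \<le> nf (full x0)" if T: "T \<subseteq> {..<N}" "0 \<le> t" "\<And>i. i \<in> T \<Longrightarrow> t \<le> \<bar>resid x0 i\<bar>" for T t
    proof -
      have "card (rl ` T) = card T" using inj_on_subset[OF rl_inj T(1)] by (rule card_image)
      moreover have "t * phi (card (rl ` T)) \<le> nf (full x0)"
      proof (rule nf_lower[OF _ T(2)])
        show "rl ` T \<subseteq> {..<n}" using T(1) rl_less by auto
        fix r assume "r \<in> rl ` T"
        then obtain i where i: "i \<in> T" "r = rl i" by blast
        then have "full x0 r = resid x0 i" using T(1) by (simp add: full_rl subset_iff)
        then show "t \<le> \<bar>full x0 r\<bar>" using T(3)[OF i(1)] by simp
      qed
      ultimately show ?thesis by simp
    qed
    have "\<not> dilation_ok x0 u \<longleftrightarrow> 40 * ((real L + 1) * (conc\<^sup>2 + 4 * trunc L N) * harm N * (nf (full x0))\<^sup>2)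
      < (\<Sum>i<N. (weight L (u i) * resid x0 i)\<^sup>2)" for u
      by (auto simp: dilation_ok_def dil_def not_le mult.assoc)
    then show ?thesis using pr_dilation[OF N N_le_n L_facts(1)[OF N] nf_nonneg w] by (simp only:)
  qed
  have b3: "avg ?M N (\<lambda>g. of_bool (\<not> sketch_ok u g)) \<le> 1/40" for u
  proof -
    have "\<not> sketch_ok u g \<longleftrightarrow> (\<exists>y. let v = (\<lambda>r. \<Sum>j<Suc d. y j * wcol u j r); S = sketch msk N g v in
      ip msk S S < ip N v v / 2 \<or> 3 / 2 * ip N v v < ip msk S S)" for g
      unfolding sketch_ok_def Let_def not_all de_Morgan_conj not_le ..
    then have "avg ?M N (\<lambda>g. of_bool (\<not> sketch_ok u g)) \<le> 8 * (real (Suc d))\<^sup>2 / real msk"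
      using sketch_embedding[OF M0(2), where N = N and D = "Suc d" and G = "wcol u"] by (simp only:)
    also have "\<dots> \<le> 1/40"
    proof -
      have "real (512 * (Suc d)\<^sup>2) \<le> real msk" using msk_bounds(1) by (simp only: of_nat_le_iff)
      then have "320 * (real (Suc d))\<^sup>2 \<le> real msk" by simp
      then show ?thesis using M0 by (simp add: field_simps)
    qed
    finally show ?thesis .
  qed
  have "avg (2 ^ L) N (\<lambda>u. avg ?M N (\<lambda>g. 1 + (-1) * of_bool (\<not> sketch_ok u g) + ((-1) * of_bool (\<not> sampling_ok u) + (-1) * of_bool (\<not> dilation_ok x0 u))))
    \<le> avg (2 ^ L) N (\<lambda>u. avg ?M N (\<lambda>g. of_bool (sampling_ok u \<and> dilation_ok x0 u \<and> sketch_ok u g)))"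
    by (intro avg_mono) (auto simp: of_bool_def)
  moreover have "avg (2 ^ L) N (\<lambda>u. avg ?M N (\<lambda>g. 1 + (-1) * of_bool (\<not> sketch_ok u g) + ((-1) * of_bool (\<not> sampling_ok u) + (-1) * of_bool (\<not> dilation_ok x0 u))))
    = avg (2 ^ L) N (\<lambda>u. 1 + (-1) * avg ?M N (\<lambda>g. of_bool (\<not> sketch_ok u g)) + ((-1) * of_bool (\<not> sampling_ok u) + (-1) * of_bool (\<not> dilation_ok x0 u)))"
    unfolding avg_add avg_cmult avg_const[OF M0(1)] ..
  moreover have "avg (2 ^ L) N (\<lambda>u. 39/40 + ((-1) * of_bool (\<not> sampling_ok u) + (-1) * of_bool (\<not> dilation_ok x0 u)))
    \<le> avg (2 ^ L) N (\<lambda>u. 1 + (-1) * avg ?M N (\<lambda>g. of_bool (\<not> sketch_ok u g)) + ((-1) * of_bool (\<not> sampling_ok u) + (-1) * of_bool (\<not> dilation_ok x0 u)))"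
  proof (rule avg_mono)
    fix u show "39/40 + ((-1) * of_bool (\<not> sampling_ok u) + (-1) * of_bool (\<not> dilation_ok x0 u))
      \<le> 1 + (-1) * avg ?M N (\<lambda>g. of_bool (\<not> sketch_ok u g)) + ((-1) * of_bool (\<not> sampling_ok u) + (-1) * of_bool (\<not> dilation_ok x0 u))"
      using b3[of u] by simp
  qed
  moreover have "avg (2 ^ L) N (\<lambda>u. 39/40 + ((-1) * of_bool (\<not> sampling_ok u) + (-1) * of_bool (\<not> dilation_ok x0 u)))
    = 39/40 + ((-1) * pr (2 ^ L) N (\<lambda>u. \<not> sampling_ok u) + (-1) * pr (2 ^ L) N (\<lambda>u. \<not> dilation_ok x0 u))"
    unfolding avg_add avg_cmult by (subst avg_const) simp_all
  ultimately show ?thesis unfolding M using b1 b2 by linarith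
qed

text \<open>\<open>us\<close> and \<open>draws\<close> agree only below N, since
  \<open>draws\<close> is undefined elsewhere; the events look at no other index.\<close>

lemma ok_cong:
  assumes "\<And>i. i < N \<Longrightarrow> u i = u' i" "\<And>i. i < N \<Longrightarrow> g i = g' i"
  shows "sampling_ok u = sampling_ok u'" "dilation_ok x0 u = dilation_ok x0 u'" "sketch_ok u g = sketch_ok u' g'"
proof -
  have T: "T \<subseteq> {..<N}" if "T \<in> level_sets N (Suc d) colv" for T using that by (auto simp: level_sets_def)
  have "(\<Sum>i\<in>T. (weight L (u i))\<^sup>2) = (\<Sum>i\<in>T. (weight L (u' i))\<^sup>2)" if "T \<in> level_sets N (Suc d) colv" for T
    using T[OF that] assms(1) by (intro sum.cong) auto
  then show "sampling_ok u = sampling_ok u'" unfolding sampling_ok_def by (intro ball_cong refl) simp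
  show "dilation_ok x0 u = dilation_ok x0 u'" unfolding dilation_ok_def using assms(1) by simp
  have w: "wcol u j i = wcol u' j i" if "i < N" for i j using assms(1)[OF that] by (simp add: wcol_def)
  have "sketch msk N g (\<lambda>r. \<Sum>j<Suc d. y j * wcol u j r) = sketch msk N g' (\<lambda>r. \<Sum>j<Suc d. y j * wcol u' j r)" for y
    unfolding sketch_def using assms(2) w by (intro ext sum.cong) auto
  moreover have "ip N (\<lambda>r. \<Sum>j<Suc d. y j * wcol u j r) (\<lambda>r. \<Sum>j<Suc d. y j * wcol u j r)
      = ip N (\<lambda>r. \<Sum>j<Suc d. y j * wcol u' j r) (\<lambda>r. \<Sum>j<Suc d. y j * wcol u' j r)" for y
    using w by (intro ip_cong) auto
  ultimately show "sketch_ok u g = sketch_ok u' g'" unfolding sketch_ok_def Let_def by simp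
qed

lemma exec_regression:
  "\<exists>t s \<omega>'. exec n l regression_prog (init_state n d es b, \<omega>) t (s, \<omega>') \<and> t \<le> time_bound \<and> out_vec d s = vec d (xout \<omega>)"
proof -
  from wp_regression[OF N_le_n, of \<omega>] obtain t s \<omega>' where
    "exec n l regression_prog (init_state n d es b, \<omega>) t (s, \<omega>')" "t \<le> time_bound" "\<forall>j<d. rarr s 2 j = xout \<omega> j"
    unfolding wp_def xout_def by blast
  moreover from this(3) have "out_vec d s = vec d (xout \<omega>)" by (auto simp: out_vec_def intro: eq_vecI)
  ultimately show ?thesis by blast
qed

text \<open>By determinism the existential over runs speaks of a single run, so the success event
  becomes a condition on \<open>xout\<close>.\<close>

lemma exec_regression_iff:
  "(\<exists>t s \<omega>'. exec n l regression_prog (init_state n d es b, \<omega>) t (s, \<omega>') \<and> R (out_vec d s)) \<longleftrightarrow> R (vec d (xout \<omega>))"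
  using exec_regression[of \<omega>] exec_deterministic[of n l regression_prog "(init_state n d es b, \<omega>)"] by (metis Pair_inject)

lemma approximation:
  "9/10 \<le> measure coin_tosses {\<omega> \<in> space coin_tosses. l (A *\<^sub>v vec d (xout \<omega>) - b)
    \<le> sqrt (real d) * (1000000 * (1 + ln (real n)) ^ 5) * mmc n l * (INF x\<in>carrier_vec d. l (A *\<^sub>v x - b))}"
  (is "_ \<le> measure _ {\<omega> \<in> _. ?P \<omega>}")
proof -
  interpret C: prob_space coin_tosses by (rule prob_space_coin_tosses)
  obtain x0 where x0: "nf (full x0) \<le> 2 * (INF x\<in>carrier_vec d. l (A *\<^sub>v x - b))" using ex_near_minimizer by blast
  let ?I = "INF x\<in>carrier_vec d. l (A *\<^sub>v x - b)"
  let ?c = "sqrt (real d) * (1000000 * (1 + ln (real n)) ^ 5) * mmc n l"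
  have I0: "0 \<le> ?I" using order_trans[OF nf_nonneg x0] by simp
  let ?d1 = "\<lambda>\<omega>. draws L N \<omega>" and ?d2 = "\<lambda>\<omega>. draws (Suc size_bits) N (sdrop (N * L) \<omega>)"
  have us: "us \<omega> i = ?d1 \<omega> i" and gs: "gs \<omega> i = ?d2 \<omega> i" if "i < N" for i \<omega>
    using that by (simp_all only: us_def gs_def draws_def restrict_apply lessThan_iff if_True)
  have suff: "?P \<omega>" if "nf (full (xout \<omega>)) \<le> K * nf (full x0)" "0 \<le> K" "2 * K \<le> ?c" for \<omega> K
  proof -
    have "nf (full (xout \<omega>)) \<le> K * (2 * ?I)" using that(1) mult_left_mono[OF x0 that(2)] by linarith
    also have "\<dots> \<le> ?c * ?I" using mult_right_mono[OF that(3) I0] by (simp add: mult_ac)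
    finally show ?thesis by (simp add: l_residual)
  qed
  have meas: "{\<omega> \<in> space coin_tosses. ?P \<omega>} \<in> sets coin_tosses"
  proof -
    \<comment> \<open>Q expresses the event through the values of the draws; by
      \<open>mem2_cong\<close> it does not matter which toss sequence produced them.\<close>
    define Q where "Q f g \<longleftrightarrow> (\<exists>\<omega>. ?d1 \<omega> = f \<and> ?d2 \<omega> = g \<and> ?P \<omega>)" for f g
    have "?P \<omega> \<longleftrightarrow> Q (?d1 \<omega>) (?d2 \<omega>)" for \<omega>
    proof
      assume "Q (?d1 \<omega>) (?d2 \<omega>)"
      then obtain \<omega>' where \<omega>': "?d1 \<omega>' = ?d1 \<omega>" "?d2 \<omega>' = ?d2 \<omega>" "?P \<omega>'" unfolding Q_def by blast
      have "mem2 \<omega>' = mem2 \<omega>" using \<omega>'(1,2) by (intro mem2_cong) (simp_all only: us gs)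
      then have "xout \<omega>' = xout \<omega>" by (simp only: xout_def[abs_def])
      then show "?P \<omega>" using \<omega>'(3) by (simp only:)
    qed (auto simp: Q_def)
    then have "{\<omega> \<in> space coin_tosses. ?P \<omega>} = {\<omega> \<in> space coin_tosses. Q (?d1 \<omega>) (?d2 \<omega>)}" by blast
    then show ?thesis using measurable_draws[of Q L N "Suc size_bits"] by (simp only:)
  qed
  show ?thesis
  \<comment> \<open>If the matrix is zero, every residual is -b and any output is optimal;
    \<open>prob_events\<close> and \<open>factor_le\<close> speak of at least one nonzero
    row.\<close>
  proof (cases "N = 0")
    case True
    then have "nf (full (xout \<omega>)) = nf (full x0)" for \<omega>
      by (intro nf_cong) (simp add: full_zero_row)
    then have "?P \<omega>" for \<omega> using factor_ge_2 by (intro suff[of \<omega> 1]) simp_all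
    then have "{\<omega> \<in> space coin_tosses. ?P \<omega>} = space coin_tosses" by blast
    then show ?thesis using C.prob_space by simp
  next
    case False
    then have N: "1 \<le> N" by simp
    let ?Q = "\<lambda>u g. sampling_ok u \<and> dilation_ok x0 u \<and> sketch_ok u g"
    have "9/10 \<le> measure coin_tosses {\<omega> \<in> space coin_tosses. ?Q (?d1 \<omega>) (?d2 \<omega>)}"
      using prob_events[OF N, of x0] prob_draws[of L N "Suc size_bits" ?Q] by (rule order_trans)
    also have "\<dots> \<le> measure coin_tosses {\<omega> \<in> space coin_tosses. ?P \<omega>}"
    proof (rule C.finite_measure_mono[OF _ meas], rule subsetI)
      fix \<omega> assume "\<omega> \<in> {\<omega> \<in> space coin_tosses. ?Q (?d1 \<omega>) (?d2 \<omega>)}"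
      then have \<omega>: "\<omega> \<in> space coin_tosses" and ok: "sampling_ok (?d1 \<omega>)" "dilation_ok x0 (?d1 \<omega>)" "sketch_ok (?d1 \<omega>) (?d2 \<omega>)"
        by blast+
      have ok': "sampling_ok (us \<omega>)" "dilation_ok x0 (us \<omega>)" "sketch_ok (us \<omega>) (gs \<omega>)"
        using ok ok_cong[of "us \<omega>" "?d1 \<omega>" "gs \<omega>" "?d2 \<omega>", OF us gs] by blast+
      have "nf (full (xout \<omega>)) \<le> ((2 * real (Suc L) + 3) * sqrt (192 * nlev * dil) + 1) * nf (full x0)"
        by (rule output_bound[OF ok' xout_minimal factor_le(1)[OF N]])
      moreover have "0 \<le> (2 * real (Suc L) + 3) * sqrt (192 * nlev * dil) + 1"
        using factor_le(1)[OF N] nlev_pos by simp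
      ultimately have "?P \<omega>" using factor_le(2)[OF N] by (rule suff)
      then show "\<omega> \<in> {\<omega> \<in> space coin_tosses. ?P \<omega>}" using \<omega> by blast
    qed
    finally show ?thesis .
  qed
qed

end

theorem theorem1p2:
  shows "\<exists>(P :: prog) (p :: real poly) (q :: nat poly) (r :: real poly).
    \<forall>(n :: nat) (d :: nat) (l :: real vec \<Rightarrow> real) (A :: real mat) (b :: real vec) es.
      n \<ge> 1 \<longrightarrow> d \<ge> 1 \<longrightarrow> symmetric_norm n l \<longrightarrow>
      A \<in> carrier_mat n d \<longrightarrow> b \<in> carrier_vec n \<longrightarrow> sparse_repr A es \<longrightarrow>
        (\<forall>\<omega>. \<exists>t s \<omega>'. exec n l P (init_state n d es b, \<omega>) t (s, \<omega>') \<and>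
                real t \<le> soft_O r (nnz A + poly q d)) \<and>
        measure coin_tosses
          {\<omega> \<in> space coin_tosses. \<exists>t s \<omega>'. exec n l P (init_state n d es b, \<omega>) t (s, \<omega>') \<and>
             l (A *\<^sub>v out_vec d s - b)
               \<le> sqrt (real d) * poly p (ln (real n)) * mmc n l
                  * (INF x\<in>carrier_vec d. l (A *\<^sub>v x - b))} \<ge> 9/10"
proof -
  define p :: "real poly" where "p = [:1000000:] * [:1, 1:] ^ 5"
  define q :: "nat poly" where "q = [:1000000:] * [:1, 1:] ^ 4"
  define r :: "real poly" where "r = [:100, 60:]"
  have poly_p: "poly p y = 1000000 * (1 + y) ^ 5" for y by (simp add: p_def poly_power)
  have poly_q: "poly q k = 1000000 * Suc k ^ 4" for k by (simp add: q_def poly_power)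
  show ?thesis
  proof (rule exI[of _ regression_prog], rule exI[of _ p], rule exI[of _ q], rule exI[of _ r], intro allI impI)
    fix n d :: nat and l :: "real vec \<Rightarrow> real" and A :: "real mat" and b :: "real vec" and es :: "(nat \<times> nat \<times> real) list"
    assume "1 \<le> n" "1 \<le> d" "symmetric_norm n l" "A \<in> carrier_mat n d" "b \<in> carrier_vec n" "sparse_repr A es"
    then interpret regression n l d es b A by unfold_locales auto
    show "(\<forall>\<omega>. \<exists>t s \<omega>'. exec n l regression_prog (init_state n d es b, \<omega>) t (s, \<omega>') \<and> real t \<le> soft_O r (nnz A + poly q d)) \<and>
      9/10 \<le> measure coin_tosses {\<omega> \<in> space coin_tosses. \<exists>t s \<omega>'. exec n l regression_prog (init_state n d es b, \<omega>) t (s, \<omega>') \<and>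
        l (A *\<^sub>v out_vec d s - b) \<le> sqrt (real d) * poly p (ln (real n)) * mmc n l * (INF x\<in>carrier_vec d. l (A *\<^sub>v x - b))}"
    proof (intro conjI allI)
      fix \<omega>
      obtain t s \<omega>' where t: "exec n l regression_prog (init_state n d es b, \<omega>) t (s, \<omega>')" "t \<le> time_bound"
        using exec_regression by blast
      have "real t \<le> real time_bound" using t(2) by simp
      also have "\<dots> \<le> soft_O r (nnz A + poly q d)"
        using time_bound_le[OF refl] by (simp add: soft_O_def r_def nnz_eq poly_q mult.commute)
      finally show "\<exists>t s \<omega>'. exec n l regression_prog (init_state n d es b, \<omega>) t (s, \<omega>') \<and> real t \<le> soft_O r (nnz A + poly q d)"
        using t(1) by blast
    next
      have "(\<exists>t s \<omega>'. exec n l regression_prog (init_state n d es b, \<omega>) t (s, \<omega>') \<and>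
          l (A *\<^sub>v out_vec d s - b) \<le> sqrt (real d) * poly p (ln (real n)) * mmc n l * (INF x\<in>carrier_vec d. l (A *\<^sub>v x - b)))
        \<longleftrightarrow> l (A *\<^sub>v vec d (xout \<omega>) - b) \<le> sqrt (real d) * poly p (ln (real n)) * mmc n l * (INF x\<in>carrier_vec d. l (A *\<^sub>v x - b))" for \<omega>
        by (rule exec_regression_iff[where R = "\<lambda>v. l (A *\<^sub>v v - b) \<le> sqrt (real d) * poly p (ln (real n)) * mmc n l * (INF x\<in>carrier_vec d. l (A *\<^sub>v x - b))"])
      then show "9/10 \<le> measure coin_tosses {\<omega> \<in> space coin_tosses. \<exists>t s \<omega>'. exec n l regression_prog (init_state n d es b, \<omega>) t (s, \<omega>') \<and>
        l (A *\<^sub>v out_vec d s - b) \<le> sqrt (real d) * poly p (ln (real n)) * mmc n l * (INF x\<in>carrier_vec d. l (A *\<^sub>v x - b))}"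
        using approximation unfolding poly_p by (simp only:)
    qed
  qed
qed

end
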